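(* Let $j_1(t), j_2(t)$ be nonconstant functions of a complex variable $t$ such that $j_1(t)+j_2(t)$ and $j_1(t)\,j_2(t)$ are rational functions of $t$. Then $$\Box(j_1(t)) = \Box(j_2(t))$$ if and only if $(j_1(t), j_2(t))$ is a parametrization of the modular curve $X_0(n)$ for some integer $n \geq 1$.
   Context: For a function $j(t)$ of a complex variable $t$, define $$\Box(j(t)) = j'(t)^2\,\frac{36\, j(t)^2 - 41\, j(t) + 32}{144\,(j(t)-1)^2\, j(t)^2} + \frac{1}{2}\{j(t),t\},$$ where $\{j(t),t\} = \frac{2 j'(t) j'''(t) - 3 j''(t)^2}{2 j'(t)^2}$ is the Schwarzian derivative. Let $j:\mathbb{H}\to\mathbb{C}$ be the elliptic modular function, normalized so that $j(i)=1$ (i.e. $j$ is the usual $j$-invariant divided by $1728$). For $n\ge 1$, $X_0(n)$ denotes the closure in $\mathbb{P}^2$ of the image of the map $\mathbb{H}\to\mathbb{P}^2$, $\tau\mapsto [j(\tau), j(n\tau), 1]$; it is a compactification of $\Gamma_0(n)\backslash\mathbb{H}$ parametrizing ordered pairs of $n$-isogenous elliptic curves. "$(j_1(t),j_2(t))$ is a parametrization of $X_0(n)$" means that the point $[j_1(t), j_2(t), 1]$ lies on $X_0(n)$ for all $t$. *)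

theory Defs
  imports "HOL-Complex_Analysis.Complex_Analysis" "HOL-Computational_Algebra.Polynomial"
begin

definition sigma_pow :: "nat \<Rightarrow> nat \<Rightarrow> nat" where
  "sigma_pow k n = (\<Sum>d\<in>{d. d dvd n}. d ^ k)"

definition nome :: "complex \<Rightarrow> complex" where
  "nome \<tau> = exp (2 * of_real pi * \<i> * \<tau>)"

definition E4 :: "complex \<Rightarrow> complex" where
  "E4 \<tau> = 1 + 240 * (\<Sum>n. of_nat (sigma_pow 3 (Suc n)) * nome \<tau> ^ Suc n)"

definition E6 :: "complex \<Rightarrow> complex" where
  "E6 \<tau> = 1 - 504 * (\<Sum>n. of_nat (sigma_pow 5 (Suc n)) * nome \<tau> ^ Suc n)"

text \<open>Modular j-invariant divided by 1728 (so that J(i) = 1):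
  j = 1728 E4^3/(E4^3 - E6^2). Meaningful for Im tau > 0.\<close>
definition modJ :: "complex \<Rightarrow> complex" where
  "modJ \<tau> = E4 \<tau> ^ 3 / (E4 \<tau> ^ 3 - E6 \<tau> ^ 2)"

text \<open>Affine part (chart z = 1) of X_0(n): closure in C^2 of the image of
  tau |-> (J(tau), J(n tau)) over the upper half plane. Since the chart is open
  in P^2 and the image lies in it, this equals X_0(n) intersected with the chart.\<close>
definition X0_affine :: "nat \<Rightarrow> (complex \<times> complex) set" where
  "X0_affine n = closure ((\<lambda>\<tau>. (modJ \<tau>, modJ (of_nat n * \<tau>))) ` {\<tau>. Im \<tau> > 0})"

definition schwarzian :: "(complex \<Rightarrow> complex) \<Rightarrow> complex \<Rightarrow> complex" where
  "schwarzian f t =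
     (2 * deriv f t * (deriv ^^ 3) f t - 3 * (deriv (deriv f) t)^2) / (2 * (deriv f t)^2)"

definition Box :: "(complex \<Rightarrow> complex) \<Rightarrow> complex \<Rightarrow> complex" where
  "Box f t = (deriv f t)^2 * (36 * (f t)^2 - 41 * f t + 32) / (144 * (f t - 1)^2 * (f t)^2)
             + schwarzian f t / 2"

definition rational_on :: "complex set \<Rightarrow> (complex \<Rightarrow> complex) \<Rightarrow> bool" where
  "rational_on U f \<longleftrightarrow> (\<exists>p q :: complex poly. q \<noteq> 0 \<and>
      (\<forall>t\<in>U. poly q t \<noteq> 0 \<longrightarrow> f t = poly p t / poly q t))"

end

theory Submission
  imports Defs
begin

text \<open>
  The function \<open>modJ\<close> satisfies \<open>Box modJ = 0\<close>; this follows from Ramanujan's differential equations for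
  \<open>E2\<close>, \<open>E4\<close>, \<open>E6\<close>, which reduce to convolution identities for divisor sums.
  Writing locally \<open>j1 = modJ \<circ> s\<close> and \<open>j2 = modJ \<circ> u\<close>, the equation \<open>Box j1 = Box j2\<close> therefore says
  that \<open>s\<close> and \<open>u\<close> have the same Schwarzian derivative, i.e. that \<open>u = A s\<close> for a Moebius transformation \<open>A\<close>.
  Since \<open>j1 + j2\<close> and \<open>j1 j2\<close> are rational, \<open>j1\<close> and \<open>j2\<close> are algebraically dependent, and so are
  \<open>modJ\<close> and \<open>modJ \<circ> A\<close>. As the real line is a natural boundary of \<open>modJ\<close>, such an \<open>A\<close> preserves the
  upper half-plane. For unipotent \<open>T\<close> in the modular group the functions \<open>modJ \<circ> A T\<^sup>m\<close>
  are all roots of one polynomial over the functions of \<open>modJ\<close>, so two of them coincide and a conjugate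
  \<open>A T\<^sup>m A\<^sup>-\<^sup>1\<close> is integral; hence \<open>A\<close> is proportional to a primitive integer matrix,
  and the Smith normal form turns \<open>modJ \<circ> A\<close> into \<open>\<tau> \<mapsto> modJ (n \<tau>)\<close> up to modular substitutions.
  Conversely, the affine curve is already the image of the half-plane, and \<open>modJ x = modJ y\<close> forces \<open>x\<close> and
  \<open>y\<close> into one orbit, so that \<open>j2\<close> is locally \<open>modJ (n g s)\<close> with \<open>g\<close> in the modular group.
\<close>

section \<open>Convolution identities for divisor sums\<close>

text \<open>\<open>Box j\<close> is half the Schwarzian of s, where s is a local lift of j through
  \<open>modJ\<close>: the rational coefficient in \<open>Box\<close> is exactly what cancels the
  Schwarzian of \<open>modJ\<close>. Two obstacles shape the argument. \<open>E4\<close> and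
  \<open>E6\<close> are given by their coefficients, so the invariance of \<open>modJ\<close> under
  z -> -1/z is not visible; it is recovered by identifying both series with lattice sums. And lifts
  exist only locally, away from the values 0 and 1, while one n must serve on all of U. For a fixed
  n, the interior of the set of points lying on the curve is open and closed in the generic set,
  which stays connected because only countably many points are removed. The recurring device is the
  countability of the modular group: a holomorphic function that agrees pointwise, on an uncountable
  set, with varying members of a countable holomorphic family agrees everywhere with a single
  member. That \<open>modJ\<close> separates generic orbits is itself obtained from the Moebius
  argument, applied to two lifts of \<open>modJ\<close> with the polynomial relation X - Y =
  0.\<close>

definition weighted_reps :: "nat \<Rightarrow> (nat \<times> nat \<times> nat \<times> nat) set" where
  "weighted_reps n = {(a,b,x,y). 0 < a \<and> 0 < b \<and> 0 < x \<and> 0 < y \<and> a * x + b * y = n}"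

lemma finite_weighted_reps: "finite (weighted_reps n)"
proof (rule finite_subset)
  show "weighted_reps n \<subseteq> {..n} \<times> {..n} \<times> {..n} \<times> {..n}"
  proof
    fix p assume "p \<in> weighted_reps n"
    then obtain a b x y where p: "p = (a,b,x,y)" "0 < a" "0 < b" "0 < x" "0 < y" "a * x + b * y = n"
      by (auto simp: weighted_reps_def)
    have "a \<le> a * x" "x \<le> a * x" "b \<le> b * y" "y \<le> b * y"
      using p by auto
    then have "a \<le> n" "b \<le> n" "x \<le> n" "y \<le> n" using p(6) by linarith+
    with p(1) show "p \<in> {..n} \<times> {..n} \<times> {..n} \<times> {..n}" by auto
  qed
qed auto

text \<open>Liouville's method: the part with \<open>x > y\<close> is mapped onto the part with \<open>a < b\<close> by
  \<open>(a, b, x, y) \<mapsto> (a, a + b, x - y, y)\<close>, and symmetrically for \<open>x < y\<close>; only the diagonals survive.\<close>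
lemma sum_weighted_reps_shift:
  fixes f :: "int \<Rightarrow> int \<Rightarrow> 'r::ab_group_add"
  assumes f: "\<And>a b. f a b = f b a" and K: "\<And>a b. f (a - b) b = f (b - a) a"
  shows "(\<Sum>(a,b,x,y)\<in>weighted_reps n. f (int a) (int b) - f (int a - int b) (int b))
     = (\<Sum>(a,b,x,y)\<in>{(a,b,x,y)\<in>weighted_reps n. x = y}. f (int a) (int b))
       - (\<Sum>(a,b,x,y)\<in>{(a,b,x,y)\<in>weighted_reps n. a = b}. f 0 (int a))"
proof -
  let ?Q = "weighted_reps n"
  let ?X = "\<lambda>R. {(a,b,x,y)\<in>?Q. R x y}" and ?A = "\<lambda>R. {(a,b,x,y)\<in>?Q. R a b}"
  let ?F = "\<lambda>(a,b,x,y). f (int a) (int b)"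
  let ?G = "\<lambda>(a,b,x,y). f (int a - int b) (int b)"
  have split: "sum h ?Q = sum h (S (=)) + sum h (S (<)) + sum h (S (>))"
    if "S = ?X \<or> S = ?A" for h :: "nat \<times> nat \<times> nat \<times> nat \<Rightarrow> 'r" and S
  proof -
    have fin: "finite (S (=))" "finite (S (<))" "finite (S (>))"
      using that by (auto intro!: finite_subset[OF _ finite_weighted_reps[of n]])
    have Q: "?Q = (S (=) \<union> S (<)) \<union> S (>)"
      using that by (auto simp: weighted_reps_def)
    have "sum h ?Q = sum h (S (=) \<union> S (<)) + sum h (S (>))"
      unfolding Q using fin that by (subst sum.union_disjoint) auto
    also have "sum h (S (=) \<union> S (<)) = sum h (S (=)) + sum h (S (<))"
      using fin that by (subst sum.union_disjoint) auto
    finally show ?thesis .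
  qed
  \<comment> \<open>Together with symmetry this is invariance under (a, b) -> (-b, a + b), the
    rotation of order 6 that preserves a^2 + a b + b^2. It matches the substitution sending the part
    x > y to the part a < b.\<close>
  have K': "f (- b) (a + b) = f a b" for a b using K[of a "a + b"] f[of a b] by simp
  have 1: "sum ?F (?X (>)) = sum ?G (?A (<))"
    by (rule sum.reindex_bij_witness[where i = "\<lambda>(a,b,x,y). (a, b - a, x + y, y)"
              and j = "\<lambda>(a,b,x,y). (a, a + b, x - y, y)"])
       (auto simp: weighted_reps_def algebra_simps diff_mult_distrib diff_mult_distrib2 of_nat_diff
          K' trans_le_add1 less_imp_le)
  have 2: "sum ?F (?X (<)) = sum ?G (?A (>))"
    by (rule sum.reindex_bij_witness[where i = "\<lambda>(a,b,x,y). (a - b, b, x, x + y)"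
              and j = "\<lambda>(a,b,x,y). (a + b, b, x, y - x)"])
       (auto simp: weighted_reps_def algebra_simps diff_mult_distrib diff_mult_distrib2 of_nat_diff
          trans_le_add1 less_imp_le)
  have 3: "sum ?G (?A (=)) = (\<Sum>(a,b,x,y)\<in>?A (=). f 0 (int a))"
    by (rule sum.cong) auto
  have "(\<Sum>(a,b,x,y)\<in>?Q. f (int a) (int b) - f (int a - int b) (int b)) = sum ?F ?Q - sum ?G ?Q"
    by (simp add: sum_subtractf case_prod_unfold)
  also have "sum ?F ?Q = sum ?F (?X (=)) + sum ?F (?X (<)) + sum ?F (?X (>))"
    by (rule split) auto
  also have "sum ?G ?Q = sum ?G (?A (=)) + sum ?G (?A (<)) + sum ?G (?A (>))"
    by (rule split) auto
  finally have 4: "(\<Sum>(a,b,x,y)\<in>?Q. f (int a) (int b) - f (int a - int b) (int b))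
      = (sum ?F (?X (=)) + sum ?F (?X (<)) + sum ?F (?X (>)))
        - (sum ?G (?A (=)) + sum ?G (?A (<)) + sum ?G (?A (>)))" .
  have "x = a - d'" if "x = (a + b + c) - (d + e + g)" "c = e" "b = g" "d = d'" for x a b c d e g d' :: 'r
    using that by simp
  from this[OF 4 1 2 3] show ?thesis .
qed

text \<open>On x = y the equation reads (a + b) x = n, so d = a + b is a divisor and a is any number
  in 1..d-1.\<close>

lemma sum_weighted_reps_diag1:
  assumes "n > 0"
  shows "(\<Sum>(a,b,x,y)\<in>{(a,b,x,y)\<in>weighted_reps n. x = y}. g a b)
       = (\<Sum>d\<in>{d. d dvd n}. \<Sum>a\<in>{1..<d}. g a (d - a))"
proof -
  have "(\<Sum>d\<in>{d. d dvd n}. \<Sum>a\<in>{1..<d}. g a (d - a))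
      = (\<Sum>(d,a)\<in>(SIGMA d:{d. d dvd n}. {1..<d}). g a (d - a))"
    using assms by (subst sum.Sigma) auto
  also have "\<dots> = (\<Sum>(a,b,x,y)\<in>{(a,b,x,y)\<in>weighted_reps n. x = y}. g a b)"
    by (rule sum.reindex_bij_witness[where j = "\<lambda>(d,a). (a, d - a, n div d, n div d)"
              and i = "\<lambda>(a,b,x,y). (a + b, a)"])
       (use assms in \<open>auto simp: weighted_reps_def elim!: dvdE simp flip: add_mult_distrib\<close>)
  finally show ?thesis by simp
qed

text \<open>On a = b the equation reads a (x + y) = n, and a divisor d = a leaves n/d - 1 choices
  for x.\<close>

lemma sum_weighted_reps_diag2:
  fixes g :: "nat \<Rightarrow> 'r::comm_ring_1"
  assumes "n > 0"
  shows "(\<Sum>(a,b,x,y)\<in>{(a,b,x,y)\<in>weighted_reps n. a = b}. g a)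
       = (\<Sum>d\<in>{d. d dvd n}. (of_nat (n div d) - 1) * g d)"
proof -
  have "(\<Sum>d\<in>{d. d dvd n}. (of_nat (n div d) - 1) * g d)
      = (\<Sum>d\<in>{d. d dvd n}. \<Sum>x\<in>{1..<n div d}. g d)"
  proof (rule sum.cong)
    fix d assume "d \<in> {d. d dvd n}"
    then have "n div d \<ge> 1" using assms by (auto elim!: dvdE)
    then show "(of_nat (n div d) - 1) * g d = (\<Sum>x\<in>{1..<n div d}. g d)" by (simp add: of_nat_diff)
  qed auto
  also have "\<dots> = (\<Sum>(d,x)\<in>(SIGMA d:{d. d dvd n}. {1..<n div d}). g d)"
    using assms by (subst sum.Sigma) auto
  also have "\<dots> = (\<Sum>(a,b,x,y)\<in>{(a,b,x,y)\<in>weighted_reps n. a = b}. g a)"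
    by (rule sum.reindex_bij_witness[where j = "\<lambda>(d,x). (d, d, x, n div d - x)"
              and i = "\<lambda>(a,b,x,y). (a, x)"])
       (use assms in \<open>auto simp: weighted_reps_def elim!: dvdE simp flip: add_mult_distrib2\<close>)
  finally show ?thesis by simp
qed

text \<open>Grouping by k = a x: divisors a of k and b of n - k correspond to the representation
  with cofactors x = k/a and y = (n - k)/b.\<close>

lemma sum_weighted_reps_convolution:
  fixes g h :: "nat \<Rightarrow> 'r::comm_ring_1"
  shows "(\<Sum>k\<in>{1..<n}. (\<Sum>a\<in>{a. a dvd k}. g a) * (\<Sum>b\<in>{b. b dvd n - k}. h b))
       = (\<Sum>(a,b,x,y)\<in>weighted_reps n. g a * h b)"
proof -
  have "(\<Sum>k\<in>{1..<n}. (\<Sum>a\<in>{a. a dvd k}. g a) * (\<Sum>b\<in>{b. b dvd n - k}. h b))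
      = (\<Sum>k\<in>{1..<n}. \<Sum>(a,b)\<in>{a. a dvd k} \<times> {b. b dvd n - k}. g a * h b)"
    by (simp add: sum_product sum.cartesian_product)
  also have "\<dots> = (\<Sum>(k,a,b)\<in>(SIGMA k:{1..<n}. {a. a dvd k} \<times> {b. b dvd n - k}). g a * h b)"
    by (subst sum.Sigma) (auto simp: case_prod_unfold)
  also have "\<dots> = (\<Sum>(a,b,x,y)\<in>weighted_reps n. g a * h b)"
    by (rule sum.reindex_bij_witness[where j = "\<lambda>(k,a,b). (a, b, k div a, (n - k) div b)"
              and i = "\<lambda>(a,b,x,y). (a * x, a, b)"])
       (auto simp: weighted_reps_def dvd_div_mult_self dest: dvd_pos_nat intro!: Nat.gr0I elim!: dvdE split: if_splits)
  finally show ?thesis .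
qed

lemma sum_power_lessThan:
  fixes d :: nat
  shows "(\<Sum>a\<in>{1..<d}. (of_nat a :: complex)) = (of_nat d ^ 2 - of_nat d) / 2"
    and "(\<Sum>a\<in>{1..<d}. (of_nat a :: complex) ^ 2) = (2 * of_nat d ^ 3 - 3 * of_nat d ^ 2 + of_nat d) / 6"
    and "(\<Sum>a\<in>{1..<d}. (of_nat a :: complex) ^ 3) = (of_nat d ^ 4 - 2 * of_nat d ^ 3 + of_nat d ^ 2) / 4"
    and "(\<Sum>a\<in>{1..<d}. (of_nat a :: complex) ^ 4)
      = (6 * of_nat d ^ 5 - 15 * of_nat d ^ 4 + 10 * of_nat d ^ 3 - of_nat d) / 30"
    and "(\<Sum>a\<in>{1..<d}. (of_nat a :: complex) ^ 5)
      = (2 * of_nat d ^ 6 - 6 * of_nat d ^ 5 + 5 * of_nat d ^ 4 - of_nat d ^ 2) / 12"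
    and "(\<Sum>a\<in>{1..<d}. (of_nat a :: complex) ^ 6)
      = (6 * of_nat d ^ 7 - 21 * of_nat d ^ 6 + 21 * of_nat d ^ 5 - 7 * of_nat d ^ 3 + of_nat d) / 42"
proof -
  have *: "sum f {1..<d} = g (of_nat d)"
    if "f 0 = 0" "g 0 = 0" "\<And>n. g (of_nat n + 1) = g (of_nat n) + f n" for f :: "nat \<Rightarrow> complex" and g
  proof -
    have "sum f {..<n} = g (of_nat n)" for n
      by (induction n) (use that in \<open>auto simp: add_ac\<close>)
    moreover have "sum f {..<d} = sum f {1..<d}"
      by (rule sum.mono_neutral_right) (use that(1) in \<open>auto simp: Suc_le_eq intro: Nat.gr0I\<close>)
    ultimately show ?thesis by simp
  qed
  show "(\<Sum>a\<in>{1..<d}. (of_nat a :: complex)) = (of_nat d ^ 2 - of_nat d) / 2"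
    by (rule *) (auto simp: eval_nat_numeral field_simps)
  show "(\<Sum>a\<in>{1..<d}. (of_nat a :: complex) ^ 2) = (2 * of_nat d ^ 3 - 3 * of_nat d ^ 2 + of_nat d) / 6"
    by (rule *) (auto simp: eval_nat_numeral field_simps)
  show "(\<Sum>a\<in>{1..<d}. (of_nat a :: complex) ^ 3) = (of_nat d ^ 4 - 2 * of_nat d ^ 3 + of_nat d ^ 2) / 4"
    by (rule *) (auto simp: eval_nat_numeral field_simps)
  show "(\<Sum>a\<in>{1..<d}. (of_nat a :: complex) ^ 4)
      = (6 * of_nat d ^ 5 - 15 * of_nat d ^ 4 + 10 * of_nat d ^ 3 - of_nat d) / 30"
    by (rule *) (auto simp: eval_nat_numeral field_simps)
  show "(\<Sum>a\<in>{1..<d}. (of_nat a :: complex) ^ 5)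
      = (2 * of_nat d ^ 6 - 6 * of_nat d ^ 5 + 5 * of_nat d ^ 4 - of_nat d ^ 2) / 12"
    by (rule *) (auto simp: eval_nat_numeral field_simps)
  show "(\<Sum>a\<in>{1..<d}. (of_nat a :: complex) ^ 6)
      = (6 * of_nat d ^ 7 - 21 * of_nat d ^ 6 + 21 * of_nat d ^ 5 - 7 * of_nat d ^ 3 + of_nat d) / 42"
    by (rule *) (auto simp: eval_nat_numeral field_simps)
qed

abbreviation dsum :: "nat \<Rightarrow> nat \<Rightarrow> complex" where
  "dsum k n \<equiv> of_nat (sigma_pow k n)"

lemma dsum_eq: "dsum k n = (\<Sum>d\<in>{d. d dvd n}. of_nat d ^ k)"
  by (simp add: sigma_pow_def)

lemma sum_quotient_divisors:
  assumes "n > 0"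
  shows "(\<Sum>d\<in>{d. d dvd n}. (of_nat (n div d) - 1) * of_nat d ^ Suc k) = of_nat n * dsum k n - dsum (Suc k) n"
proof -
  have "(of_nat (n div d) - 1) * of_nat d ^ Suc k = of_nat n * of_nat d ^ k - (of_nat d ^ Suc k :: complex)"
    if "d dvd n" for d
    using that assms by (auto elim!: dvdE simp: algebra_simps)
  then have "(\<Sum>d\<in>{d. d dvd n}. (of_nat (n div d) - 1) * of_nat d ^ Suc k)
      = (\<Sum>d\<in>{d. d dvd n}. of_nat n * of_nat d ^ k - (of_nat d ^ Suc k :: complex))"
    by (intro sum.cong) auto
  then show ?thesis by (simp add: dsum_eq sum_subtractf sum_distrib_left)
qed

lemma weighted_reps_convolution:
  "(\<Sum>k\<in>{1..<n}. dsum i k * dsum j (n - k)) = (\<Sum>(a,b,x,y)\<in>weighted_reps n. of_nat a ^ i * of_nat b ^ j)"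
  unfolding dsum_eq by (rule sum_weighted_reps_convolution)

lemma convolution_commute:
  "(\<Sum>k\<in>{1..<n}. dsum i k * dsum j (n - k)) = (\<Sum>k\<in>{1..<n}. dsum j k * dsum i (n - k))"
  by (rule sum.reindex_bij_witness[where i = "\<lambda>k. n - k" and j = "\<lambda>k. n - k"]) auto

text \<open>Template for the four identities below: \<open>D\<close> is the polynomial whose
  monomials a^i b^j become convolutions, \<open>S\<close> is the inner sum of the diagonal x = y,
  and f 0 d is the contribution of the diagonal a = b.\<close>

lemma sum_weighted_reps_identity:
  fixes f :: "int \<Rightarrow> int \<Rightarrow> complex"
  assumes n: "n > 0" and f: "\<And>a b. f a b = f b a" and K: "\<And>a b. f (a - b) b = f (b - a) a"
    and D: "\<And>a b. f a b - f (a - b) b = D a b"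
    and diag: "\<And>d. d > 0 \<Longrightarrow> (\<Sum>a\<in>{1..<d}. f (int a) (int (d - a))) = S d"
  shows "(\<Sum>(a,b,x,y)\<in>weighted_reps n. D (int a) (int b)) =
    (\<Sum>d\<in>{d. d dvd n}. S d) - (\<Sum>d\<in>{d. d dvd n}. (of_nat (n div d) - 1) * f 0 (int d))"
proof -
  have "(\<Sum>(a,b,x,y)\<in>weighted_reps n. D (int a) (int b)) =
     (\<Sum>(a,b,x,y)\<in>weighted_reps n. f (int a) (int b) - f (int a - int b) (int b))"
    by (simp add: D)
  also note sum_weighted_reps_shift[OF f K]
  also note sum_weighted_reps_diag1[OF n, of "\<lambda>a b. f (int a) (int b)"]
  also note sum_weighted_reps_diag2[OF n, of "\<lambda>a. f 0 (int a)"]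
  also have "(\<Sum>d\<in>{d. d dvd n}. \<Sum>a\<in>{1..<d}. f (int a) (int (d - a))) = (\<Sum>d\<in>{d. d dvd n}. S d)"
    using n by (intro sum.cong diag) (auto intro: Nat.gr0I)
  finally show ?thesis .
qed

text \<open>The kernel Q = a^2 + a b + b^2 is the basic invariant of (a, b) -> (-b, a + b), and Q(a,
  b) - Q(a - b, b) = 2 a b isolates the product to be convolved. The \<open>dsum 2\<close> terms of
  the two diagonals cancel.\<close>

lemma convolution_1_1:
  assumes n: "n > 0"
  shows "12 * (\<Sum>k\<in>{1..<n}. dsum 1 k * dsum 1 (n - k)) = 5 * dsum 3 n + dsum 1 n - 6 * of_nat n * dsum 1 n"
proof -
  let ?f = "\<lambda>a b. of_int (a^2 + a*b + b^2) :: complex"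
  let ?D = "\<lambda>a b. 2 * of_int a * of_int b :: complex"
  let ?S = "\<lambda>d::nat. (5 * of_nat d ^ 3 - 6 * of_nat d ^ 2 + of_nat d ^ 1) / 6 :: complex"
  have F: "\<And>a b. ?f a b = ?f b a" "\<And>a b. ?f (a - b) b = ?f (b - a) a"
    by (rule arg_cong[of _ _ of_int], algebra)+
  have D: "\<And>a b. ?f a b - ?f (a - b) b = ?D a b"
    by (simp only: of_int_add of_int_diff of_int_mult of_int_power of_int_numeral, algebra)
  have S: "(\<Sum>a\<in>{1..<d}. ?f (int a) (int (d - a))) = (5 * of_nat d ^ 3 - 6 * of_nat d ^ 2 + of_nat d ^ 1) / 6" if d: "d > 0" for d
  proof -
    have "(\<Sum>a\<in>{1..<d}. ?f (int a) (int (d - a)))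
       = (\<Sum>a\<in>{1..<d}. of_nat d ^ 2 - of_nat d * of_nat a + of_nat a ^ 2)"
      by (rule sum.cong) (auto simp: of_nat_diff power2_eq_square algebra_simps)
    also have "\<dots> = of_nat (d - 1) * of_nat d ^ 2 - of_nat d * (\<Sum>a\<in>{1..<d}. of_nat a) + (\<Sum>a\<in>{1..<d}. of_nat a ^ 2)"
      by (simp add: sum_subtractf sum.distrib sum_distrib_left)
    also have "\<dots> = ?S d"
      unfolding sum_power_lessThan using d by (simp add: of_nat_diff field_simps eval_nat_numeral)
    finally show ?thesis .
  qed
  have E: "(\<Sum>(a,b,x,y)\<in>weighted_reps n. ?D (int a) (int b)) =
    (\<Sum>d\<in>{d. d dvd n}. (5 * of_nat d ^ 3 - 6 * of_nat d ^ 2 + of_nat d ^ 1) / 6)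
     - (\<Sum>d\<in>{d. d dvd n}. (of_nat (n div d) - 1) * ?f 0 (int d))"
    by (rule sum_weighted_reps_identity[OF n, where f = ?f and D = ?D and S = ?S, OF F D S])
  have C1: "(\<Sum>(a,b,x,y)\<in>weighted_reps n. ?D (int a) (int b))
      = 2 * (\<Sum>k\<in>{1..<n}. dsum 1 k * dsum 1 (n - k))"
    by (subst weighted_reps_convolution) (simp add: sum_distrib_left case_prod_unfold mult_ac)
  have C2: "(\<Sum>d\<in>{d. d dvd n}. (5 * of_nat d ^ 3 - 6 * of_nat d ^ 2 + of_nat d ^ 1) / 6) =
     (5 * dsum 3 n - 6 * dsum 2 n + dsum 1 n) / 6"
    by (simp add: dsum_eq sum_subtractf sum.distrib sum_distrib_left flip: sum_divide_distrib)
  have C3: "(\<Sum>d\<in>{d. d dvd n}. (of_nat (n div d) - 1) * ?f 0 (int d)) = of_nat n * dsum 1 n - dsum 2 n"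
    using sum_quotient_divisors[OF n, of 1] by (simp add: numeral_2_eq_2)
  show ?thesis using E 
    unfolding C1 C2 C3 by (simp add: field_simps)
qed

text \<open>For the kernel Q^2 the difference factors as 2 a b times 2 (a^2 + b^2); its two
  monomials give the same convolution by symmetry.\<close>

lemma convolution_1_3:
  assumes n: "n > 0"
  shows "240 * (\<Sum>k\<in>{1..<n}. dsum 1 k * dsum 3 (n - k))
    = 21 * dsum 5 n + 10 * dsum 3 n - dsum 1 n - 30 * of_nat n * dsum 3 n"
proof -
  let ?f = "\<lambda>a b. of_int ((a^2 + a*b + b^2)^2) :: complex"
  let ?S = "\<lambda>d::nat. (21 * of_nat d ^ 5 - 30 * of_nat d ^ 4 + 10 * of_nat d ^ 3 - of_nat d ^ 1) / 30 :: complex"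
  let ?D = "\<lambda>a b. 4 * of_int a * of_int b ^ 3 + 4 * of_int a ^ 3 * of_int b :: complex"
  have F: "\<And>a b. ?f a b = ?f b a" "\<And>a b. ?f (a - b) b = ?f (b - a) a"
    by (rule arg_cong[of _ _ of_int], algebra)+
  have D: "\<And>a b. ?f a b - ?f (a - b) b = ?D a b"
    by (simp only: of_int_add of_int_diff of_int_mult of_int_power of_int_numeral, algebra)
  have S: "(\<Sum>a\<in>{1..<d}. ?f (int a) (int (d - a)))
        = (21 * of_nat d ^ 5 - 30 * of_nat d ^ 4 + 10 * of_nat d ^ 3 - of_nat d ^ 1) / 30" if d: "d > 0" for d
  proof -
    have "(\<Sum>a\<in>{1..<d}. ?f (int a) (int (d - a)))
       = (\<Sum>a\<in>{1..<d}. of_nat d ^ 4 - 2 * of_nat d ^ 3 * of_nat a + 3 * of_nat d ^ 2 * of_nat a ^ 2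
            - 2 * of_nat d * of_nat a ^ 3 + of_nat a ^ 4)"
      by (rule sum.cong) (auto simp: of_nat_diff eval_nat_numeral algebra_simps)
    also have "\<dots> = of_nat (d - 1) * of_nat d ^ 4 - 2 * of_nat d ^ 3 * (\<Sum>a\<in>{1..<d}. of_nat a)
        + 3 * of_nat d ^ 2 * (\<Sum>a\<in>{1..<d}. of_nat a ^ 2) - 2 * of_nat d * (\<Sum>a\<in>{1..<d}. of_nat a ^ 3)
        + (\<Sum>a\<in>{1..<d}. of_nat a ^ 4)"
      by (simp add: sum_subtractf sum.distrib sum_distrib_left)
    also have "\<dots> = ?S d"
      unfolding sum_power_lessThan using d by (simp add: of_nat_diff field_simps eval_nat_numeral)
    finally show ?thesis .
  qed
  have E: "(\<Sum>(a,b,x,y)\<in>weighted_reps n. ?D (int a) (int b)) =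
    (\<Sum>d\<in>{d. d dvd n}. (21 * of_nat d ^ 5 - 30 * of_nat d ^ 4 + 10 * of_nat d ^ 3 - of_nat d ^ 1) / 30)
     - (\<Sum>d\<in>{d. d dvd n}. (of_nat (n div d) - 1) * ?f 0 (int d))"
    by (rule sum_weighted_reps_identity[OF n, where f = ?f and D = ?D and S = ?S, OF F D S])
  have C1: "(\<Sum>(a,b,x,y)\<in>weighted_reps n. ?D (int a) (int b))
      = 4 * (\<Sum>k\<in>{1..<n}. dsum 1 k * dsum 3 (n - k)) + 4 * (\<Sum>k\<in>{1..<n}. dsum 3 k * dsum 1 (n - k))"
    by (subst (1 2) weighted_reps_convolution) (simp add: sum_distrib_left sum.distrib case_prod_unfold mult_ac)
  note C0 = convolution_commute[where i = 3 and j = 1 and n = n]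
  have C2: "(\<Sum>d\<in>{d. d dvd n}. (21 * of_nat d ^ 5 - 30 * of_nat d ^ 4 + 10 * of_nat d ^ 3 - of_nat d ^ 1) / 30)
     = (21 * dsum 5 n - 30 * dsum 4 n + 10 * dsum 3 n - dsum 1 n) / 30"
    by (simp add: dsum_eq sum_subtractf sum.distrib sum_distrib_left flip: sum_divide_distrib)
  have C3: "(\<Sum>d\<in>{d. d dvd n}. (of_nat (n div d) - 1) * ?f 0 (int d)) = of_nat n * dsum 3 n - dsum 4 n"
    using sum_quotient_divisors[OF n, of 3] by (simp add: power_mult [symmetric])
  show ?thesis using E 
    unfolding C1 C0 C2 C3 by (simp add: field_simps)
qed

text \<open>The product a b (a + b) changes sign under (a, b) -> (-b, a + b), so its square is a
  second invariant of degree 6 besides Q^3. It vanishes at a = 0, hence the diagonal a = b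
  contributes nothing.\<close>

lemma convolution_3_3:
  assumes n: "n > 0"
  shows "120 * (\<Sum>k\<in>{1..<n}. dsum 3 k * dsum 3 (n - k)) = dsum 7 n - dsum 3 n"
proof -
  let ?f = "\<lambda>a b. of_int ((a*b*(a+b))^2) :: complex"
  let ?S = "\<lambda>d::nat. (of_nat d ^ 7 - of_nat d ^ 3) / 30 :: complex"
  let ?D = "\<lambda>a b. 4 * of_int a ^ 3 * of_int b ^ 3 :: complex"
  have F: "\<And>a b. ?f a b = ?f b a" "\<And>a b. ?f (a - b) b = ?f (b - a) a"
    by (rule arg_cong[of _ _ of_int], algebra)+
  have D: "\<And>a b. ?f a b - ?f (a - b) b = ?D a b"
    by (simp only: of_int_add of_int_diff of_int_mult of_int_power of_int_numeral, algebra)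
  have S: "(\<Sum>a\<in>{1..<d}. ?f (int a) (int (d - a))) = (of_nat d ^ 7 - of_nat d ^ 3) / 30" if d: "d > 0" for d
  proof -
    have "(\<Sum>a\<in>{1..<d}. ?f (int a) (int (d - a)))
       = (\<Sum>a\<in>{1..<d}. of_nat d ^ 4 * of_nat a ^ 2 - 2 * of_nat d ^ 3 * of_nat a ^ 3 + of_nat d ^ 2 * of_nat a ^ 4)"
      by (rule sum.cong) (auto simp: of_nat_diff eval_nat_numeral algebra_simps)
    also have "\<dots> = of_nat d ^ 4 * (\<Sum>a\<in>{1..<d}. of_nat a ^ 2) - 2 * of_nat d ^ 3 * (\<Sum>a\<in>{1..<d}. of_nat a ^ 3)
        + of_nat d ^ 2 * (\<Sum>a\<in>{1..<d}. of_nat a ^ 4)"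
      by (simp add: sum_subtractf sum.distrib sum_distrib_left)
    also have "\<dots> = ?S d"
      unfolding sum_power_lessThan by (simp add: field_simps eval_nat_numeral)
    finally show ?thesis .
  qed
  have E: "(\<Sum>(a,b,x,y)\<in>weighted_reps n. ?D (int a) (int b)) =
    (\<Sum>d\<in>{d. d dvd n}. (of_nat d ^ 7 - of_nat d ^ 3) / 30)
     - (\<Sum>d\<in>{d. d dvd n}. (of_nat (n div d) - 1) * ?f 0 (int d))"
    by (rule sum_weighted_reps_identity[OF n, where f = ?f and D = ?D and S = ?S, OF F D S])
  have C1: "(\<Sum>(a,b,x,y)\<in>weighted_reps n. ?D (int a) (int b))
      = 4 * (\<Sum>k\<in>{1..<n}. dsum 3 k * dsum 3 (n - k))"
    by (subst weighted_reps_convolution) (simp add: sum_distrib_left case_prod_unfold mult_ac)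
  have C2: "(\<Sum>d\<in>{d. d dvd n}. (of_nat d ^ 7 - of_nat d ^ 3) / 30 :: complex) = (dsum 7 n - dsum 3 n) / 30"
    by (simp add: dsum_eq sum_subtractf flip: sum_divide_distrib)
  show ?thesis using E 
    unfolding C1 C2 by (simp add: field_simps)
qed

text \<open>The kernel Q^3 mixes a b^5 and a^5 b with 14 a^3 b^3. The last part is the (3,3)
  convolution; in \<open>?S\<close> the summand over 120 is kept apart because it is 14 times the
  closed form of that convolution and cancels against it.\<close>

lemma convolution_1_5:
  assumes n: "n > 0"
  shows "504 * (\<Sum>k\<in>{1..<n}. dsum 1 k * dsum 5 (n - k))
    = 20 * dsum 7 n + 21 * dsum 5 n + dsum 1 n - 42 * of_nat n * dsum 5 n"
proof -
  let ?f = "\<lambda>a b. of_int ((a^2 + a*b + b^2)^3) :: complex"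
  let ?D = "\<lambda>a b. 6 * of_int a * of_int b ^ 5 + 6 * of_int a ^ 5 * of_int b + 14 * of_int a ^ 3 * of_int b ^ 3 :: complex"
  let ?S = "\<lambda>d::nat. (20 * of_nat d ^ 7 - 42 * of_nat d ^ 6 + 21 * of_nat d ^ 5 + of_nat d ^ 1) / 42
          + 14 * (of_nat d ^ 7 - of_nat d ^ 3) / 120 :: complex"
  have F: "\<And>a b. ?f a b = ?f b a" "\<And>a b. ?f (a - b) b = ?f (b - a) a"
    by (rule arg_cong[of _ _ of_int], algebra)+
  have D: "\<And>a b. ?f a b - ?f (a - b) b = ?D a b"
    by (simp only: of_int_add of_int_diff of_int_mult of_int_power of_int_numeral, algebra)
  have S: "(\<Sum>a\<in>{1..<d}. ?f (int a) (int (d - a))) = ?S d" if d: "d > 0" for d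
  proof -
    have "(\<Sum>a\<in>{1..<d}. ?f (int a) (int (d - a)))
       = (\<Sum>a\<in>{1..<d}. of_nat d ^ 6 - 3 * of_nat d ^ 5 * of_nat a + 6 * of_nat d ^ 4 * of_nat a ^ 2
            - 7 * of_nat d ^ 3 * of_nat a ^ 3 + 6 * of_nat d ^ 2 * of_nat a ^ 4 - 3 * of_nat d * of_nat a ^ 5 + of_nat a ^ 6)"
      by (rule sum.cong) (auto simp: of_nat_diff eval_nat_numeral algebra_simps)
    also have "\<dots> = of_nat (d - 1) * of_nat d ^ 6 - 3 * of_nat d ^ 5 * (\<Sum>a\<in>{1..<d}. of_nat a)
        + 6 * of_nat d ^ 4 * (\<Sum>a\<in>{1..<d}. of_nat a ^ 2) - 7 * of_nat d ^ 3 * (\<Sum>a\<in>{1..<d}. of_nat a ^ 3)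
        + 6 * of_nat d ^ 2 * (\<Sum>a\<in>{1..<d}. of_nat a ^ 4) - 3 * of_nat d * (\<Sum>a\<in>{1..<d}. of_nat a ^ 5)
        + (\<Sum>a\<in>{1..<d}. of_nat a ^ 6)"
      by (simp add: sum_subtractf sum.distrib sum_distrib_left)
    also have "\<dots> = ?S d"
      unfolding sum_power_lessThan using d by (simp add: of_nat_diff field_simps eval_nat_numeral)
    finally show ?thesis .
  qed
  have E: "(\<Sum>(a,b,x,y)\<in>weighted_reps n. ?D (int a) (int b)) =
    (\<Sum>d\<in>{d. d dvd n}. ?S d)
     - (\<Sum>d\<in>{d. d dvd n}. (of_nat (n div d) - 1) * ?f 0 (int d))"
    by (rule sum_weighted_reps_identity[OF n, where f = ?f and D = ?D and S = ?S, OF F D S])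
  have C1: "(\<Sum>(a,b,x,y)\<in>weighted_reps n. ?D (int a) (int b))
      = 6 * (\<Sum>k\<in>{1..<n}. dsum 1 k * dsum 5 (n - k)) + 6 * (\<Sum>k\<in>{1..<n}. dsum 5 k * dsum 1 (n - k))
        + 14 * (\<Sum>k\<in>{1..<n}. dsum 3 k * dsum 3 (n - k))"
    by (subst (1 2 3) weighted_reps_convolution) (simp add: sum_distrib_left sum.distrib case_prod_unfold mult_ac)
  note C0 = convolution_commute[where i = 5 and j = 1 and n = n]
  have C2: "(\<Sum>d\<in>{d. d dvd n}. ?S d)
     = (20 * dsum 7 n - 42 * dsum 6 n + 21 * dsum 5 n + dsum 1 n) / 42 + 14 * (dsum 7 n - dsum 3 n) / 120"
    by (simp add: dsum_eq sum_subtractf sum.distrib sum_distrib_left flip: sum_divide_distrib)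
  have C3: "(\<Sum>d\<in>{d. d dvd n}. (of_nat (n div d) - 1) * ?f 0 (int d)) = of_nat n * dsum 5 n - dsum 6 n"
    using sum_quotient_divisors[OF n, of 5] by (simp add: power_mult [symmetric])
  have "dsum 3 n = dsum 7 n - 120 * (\<Sum>k\<in>{1..<n}. dsum 3 k * dsum 3 (n - k))"
    using convolution_3_3[OF n] by (simp add: algebra_simps)
  from E[unfolded C1 C0 C2 C3, unfolded this] show ?thesis by (simp add: field_simps)
qed

section \<open>Ramanujan's differential equations\<close>

definition sigma_fps :: "nat \<Rightarrow> complex fps" where
  "sigma_fps k = Abs_fps (dsum k)"

definition fps_E2 :: "complex fps" where "fps_E2 = 1 - fps_const 24 * sigma_fps 1"
definition fps_E4 :: "complex fps" where "fps_E4 = 1 + fps_const 240 * sigma_fps 3"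
definition fps_E6 :: "complex fps" where "fps_E6 = 1 - fps_const 504 * sigma_fps 5"

lemma sigma_pow_0: "sigma_pow k 0 = 0"
  by (simp add: sigma_pow_def)

lemma sigma_fps_mult_nth:
  "fps_nth (sigma_fps i * sigma_fps j) n = (\<Sum>k\<in>{1..<n}. dsum i k * dsum j (n - k))"
proof -
  have "fps_nth (sigma_fps i * sigma_fps j) n = (\<Sum>k\<in>{0..n}. dsum i k * dsum j (n - k))"
    by (simp add: fps_mult_nth sigma_fps_def)
  also have "\<dots> = (\<Sum>k\<in>{1..<n}. dsum i k * dsum j (n - k))"
    by (rule sum.mono_neutral_right) (auto simp: sigma_pow_0 not_less Suc_le_eq le_antisym)
  finally show ?thesis .
qed

lemma sigma_fps_nth [simp]: "fps_nth (sigma_fps i) n = dsum i n"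
  by (simp add: sigma_fps_def)

text \<open>X d/dX multiplies the n-th coefficient by n, so for n > 0 the equations are the
  convolutions (1,1), (1,3) and, for the last one, (1,5) together with (3,3).\<close>

lemma ramanujan_fps:
  "fps_const 12 * (fps_X * fps_deriv fps_E2) = fps_E2 * fps_E2 - fps_E4"
  "fps_const 3 * (fps_X * fps_deriv fps_E4) = fps_E2 * fps_E4 - fps_E6"
  "fps_const 2 * (fps_X * fps_deriv fps_E6) = fps_E2 * fps_E6 - fps_E4 * fps_E4"
proof -
  have X: "fps_nth (fps_X * fps_deriv f) n = of_nat n * fps_nth f n" for f :: "complex fps" and n
    by (cases n) simp_all
  have e2: "fps_E2 * fps_E2 = 1 - fps_const 48 * sigma_fps 1 + fps_const 576 * (sigma_fps 1 * sigma_fps 1)"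
    by (simp add: fps_E2_def algebra_simps flip: fps_const_mult numeral_fps_const)
  have e24: "fps_E2 * fps_E4 = 1 - fps_const 24 * sigma_fps 1 + fps_const 240 * sigma_fps 3
      - fps_const 5760 * (sigma_fps 1 * sigma_fps 3)"
    by (simp add: fps_E2_def fps_E4_def algebra_simps flip: fps_const_mult numeral_fps_const)
  have e26: "fps_E2 * fps_E6 = 1 - fps_const 24 * sigma_fps 1 - fps_const 504 * sigma_fps 5
      + fps_const 12096 * (sigma_fps 1 * sigma_fps 5)"
    by (simp add: fps_E2_def fps_E6_def algebra_simps flip: fps_const_mult numeral_fps_const)
  have e44: "fps_E4 * fps_E4 = 1 + fps_const 480 * sigma_fps 3 + fps_const 57600 * (sigma_fps 3 * sigma_fps 3)"
    by (simp add: fps_E4_def algebra_simps flip: fps_const_mult numeral_fps_const)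
  show "fps_const 12 * (fps_X * fps_deriv fps_E2) = fps_E2 * fps_E2 - fps_E4"
  proof (rule fps_ext)
    fix n show "fps_nth (fps_const 12 * (fps_X * fps_deriv fps_E2)) n = fps_nth (fps_E2 * fps_E2 - fps_E4) n"
    proof (cases "n = 0")
      case False
      have "fps_nth (fps_E2 * fps_E2 - fps_E4) n = 48 * (12 * (\<Sum>k\<in>{1..<n}. dsum 1 k * dsum 1 (n - k))) - 48 * dsum 1 n - 240 * dsum 3 n"
        unfolding e2 fps_E4_def using False by (simp add: sigma_fps_mult_nth)
      also have "\<dots> = 12 * (of_nat n * (- 24 * dsum 1 n))"
        using False by (subst convolution_1_1) (auto simp: algebra_simps)
      finally show ?thesis using False by (simp add: X) (simp add: fps_E2_def)
    qed (simp add: fps_E2_def fps_E4_def sigma_pow_0)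
  qed
  show "fps_const 3 * (fps_X * fps_deriv fps_E4) = fps_E2 * fps_E4 - fps_E6"
  proof (rule fps_ext)
    fix n show "fps_nth (fps_const 3 * (fps_X * fps_deriv fps_E4)) n = fps_nth (fps_E2 * fps_E4 - fps_E6) n"
    proof (cases "n = 0")
      case False
      have "fps_nth (fps_E2 * fps_E4 - fps_E6) n
         = 240 * dsum 3 n - 24 * dsum 1 n - 24 * (240 * (\<Sum>k\<in>{1..<n}. dsum 1 k * dsum 3 (n - k))) + 504 * dsum 5 n"
        unfolding e24 fps_E6_def using False by (simp add: sigma_fps_mult_nth)
      also have "\<dots> = 3 * (of_nat n * (240 * dsum 3 n))"
        using False by (subst convolution_1_3) (auto simp: algebra_simps)
      finally show ?thesis using False by (simp add: X) (simp add: fps_E4_def)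
    qed (simp add: fps_E2_def fps_E4_def fps_E6_def sigma_pow_0)
  qed
  show "fps_const 2 * (fps_X * fps_deriv fps_E6) = fps_E2 * fps_E6 - fps_E4 * fps_E4"
  proof (rule fps_ext)
    fix n show "fps_nth (fps_const 2 * (fps_X * fps_deriv fps_E6)) n = fps_nth (fps_E2 * fps_E6 - fps_E4 * fps_E4) n"
    proof (cases "n = 0")
      case False
      have "fps_nth (fps_E2 * fps_E6 - fps_E4 * fps_E4) n
         = 24 * (504 * (\<Sum>k\<in>{1..<n}. dsum 1 k * dsum 5 (n - k))) - 24 * dsum 1 n - 504 * dsum 5 n
           - 480 * dsum 3 n - 480 * (120 * (\<Sum>k\<in>{1..<n}. dsum 3 k * dsum 3 (n - k)))"
        unfolding e26 e44 using False by (simp add: sigma_fps_mult_nth)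
      also have "\<dots> = 2 * (of_nat n * (- 504 * dsum 5 n))"
        using False by (subst convolution_1_5, simp, subst convolution_3_3) (auto simp: algebra_simps)
      finally show ?thesis using False by (simp add: X) (simp add: fps_E6_def)
    qed (simp add: fps_E2_def fps_E4_def fps_E6_def sigma_pow_0)
  qed
qed

section \<open>Convergence of the series in the unit disc\<close>

lemma summable_power_mult_power:
  fixes r :: real
  assumes "0 < r" "ereal r < 1"
  shows "summable (\<lambda>n. real n ^ k * r ^ n)"
proof -
  have "conv_radius (\<lambda>n. of_nat n ^ k :: real) = ereal 1"
  proof (rule conv_radius_ratio_limit_ereal)
    show "eventually (\<lambda>n. (of_nat n ^ k :: real) \<noteq> 0) sequentially"
      using eventually_gt_at_top[of 0] by eventually_elim auto
    have "(\<lambda>n. (real n / real (Suc n)) ^ k) \<longlonglongrightarrow> 1 ^ k"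
      by (intro tendsto_power LIMSEQ_n_over_Suc_n)
    then show "(\<lambda>n. ereal (norm (real n ^ k) / norm (real (Suc n) ^ k))) \<longlonglongrightarrow> ereal 1"
      by (simp add: power_divide)
  qed
  then show ?thesis using assms by (intro summable_in_conv_radius) auto
qed

text \<open>There are at most n divisors, each at most n, which gives the polynomial bound
  n^(k+1).\<close>

lemma conv_radius_sigma_fps: "fps_conv_radius (sigma_fps k) \<ge> 1"
  unfolding fps_conv_radius_def
proof (rule conv_radius_geI_ex')
  fix r :: real assume r: "0 < r" "ereal r < 1"
  have s: "summable (\<lambda>n. real n ^ Suc k * r ^ n)" by (rule summable_power_mult_power[OF r])
  have "norm (fps_nth (sigma_fps k) n * of_real r ^ n) \<le> real n ^ Suc k * r ^ n" for n
  proof -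
    have "sigma_pow k n \<le> n ^ Suc k"
    proof (cases "n = 0")
      case False
      have "sigma_pow k n \<le> (\<Sum>d\<in>{1..n}. d ^ k)"
        unfolding sigma_pow_def using False by (intro sum_mono2) (auto simp: Suc_le_eq dest: dvd_imp_le intro: Nat.gr0I)
      also have "\<dots> \<le> (\<Sum>d\<in>{1..n}. n ^ k)" by (intro sum_mono power_mono) auto
      finally show ?thesis by simp
    qed (simp add: sigma_pow_0)
    then have "real (sigma_pow k n) \<le> real n ^ Suc k"
      by (metis of_nat_le_iff of_nat_power)
    then show ?thesis using r by (simp add: norm_mult norm_power mult_right_mono del: power_Suc)
  qed
  then show "summable (\<lambda>n. fps_nth (sigma_fps k) n * of_real r ^ n)"
    by (intro summable_comparison_test'[OF s]) 
qed

lemma conv_radius_fps_E: "fps_conv_radius fps_E2 \<ge> 1" "fps_conv_radius fps_E4 \<ge> 1" "fps_conv_radius fps_E6 \<ge> 1"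
proof -
  have c: "fps_conv_radius (fps_const c * sigma_fps k) \<ge> 1" for c k
    using fps_conv_radius_mult[of "fps_const c" "sigma_fps k"] conv_radius_sigma_fps[of k]
    by (auto simp: min_def split: if_splits intro: order_trans)
  show "fps_conv_radius fps_E2 \<ge> 1"
    using fps_conv_radius_diff[of 1 "fps_const 24 * sigma_fps 1"] c[of 24 1]
    unfolding fps_E2_def by (auto simp: min_def split: if_splits intro: order_trans)
  show "fps_conv_radius fps_E4 \<ge> 1"
    using fps_conv_radius_add[of 1 "fps_const 240 * sigma_fps 3"] c[of 240 3]
    unfolding fps_E4_def by (auto simp: min_def split: if_splits intro: order_trans)
  show "fps_conv_radius fps_E6 \<ge> 1"
    using fps_conv_radius_diff[of 1 "fps_const 504 * sigma_fps 5"] c[of 504 5]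
    unfolding fps_E6_def by (auto simp: min_def split: if_splits intro: order_trans)
qed

section \<open>The upper half-plane and derivatives of the Eisenstein series\<close>

abbreviation uhp :: "complex set" where "uhp \<equiv> {z. Im z > 0}"

lemma open_uhp: "open uhp" and convex_uhp: "convex uhp"
  by (auto simp: open_halfspace_Im_gt convex_halfspace_Im_gt)

lemma connected_uhp: "connected uhp"
  by (rule convex_connected[OF convex_uhp])

lemma norm_nome: "norm (nome \<tau>) = exp (- 2 * pi * Im \<tau>)"
  by (simp add: nome_def)

lemma norm_nome_less: "Im \<tau> > 0 \<Longrightarrow> norm (nome \<tau>) < 1"
  by (simp add: norm_nome)

lemma DERIV_nome: "(nome has_field_derivative 2 * pi * \<i> * nome \<tau>) (at \<tau>)"
  unfolding nome_def by (auto intro!: derivative_eq_intros)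

lemma less_conv_radius: "norm (z::complex) < 1 \<Longrightarrow> R \<ge> 1 \<Longrightarrow> ereal (norm z) < R"
  by (rule less_le_trans[of _ 1]) auto

text \<open>The quasi-modular Eisenstein series of weight 2; up to the factor 2 pi i it is the
  logarithmic derivative of \<open>disc\<close>.\<close>

definition E2 :: "complex \<Rightarrow> complex" where
  "E2 \<tau> = eval_fps fps_E2 (nome \<tau>)"

lemma eval_sigma_fps:
  assumes "norm q < 1"
  shows "eval_fps (sigma_fps k) q = (\<Sum>n. of_nat (sigma_pow k (Suc n)) * q ^ Suc n)"
proof -
  have "summable (\<lambda>n. fps_nth (sigma_fps k) n * q ^ n)"
    by (rule summable_fps) (intro less_conv_radius assms conv_radius_sigma_fps)
  from suminf_split_head[OF this] show ?thesis
    by (simp add: eval_fps_def sigma_pow_0)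
qed

lemma eval_fps_const_mult:
  assumes "norm z < 1" "fps_conv_radius f \<ge> 1"
  shows "eval_fps (fps_const c * f) z = c * eval_fps f (z :: complex)"
  using assms by (subst eval_fps_mult) (auto intro: less_conv_radius)

lemma E4_eq: assumes "Im \<tau> > 0" shows "E4 \<tau> = eval_fps fps_E4 (nome \<tau>)"
  and E6_eq: "E6 \<tau> = eval_fps fps_E6 (nome \<tau>)"
proof -
  have q: "norm (nome \<tau>) < 1" using norm_nome_less[OF assms] .
  have c: "ereal (norm (nome \<tau>)) < fps_conv_radius (fps_const c * sigma_fps k)" for c k
    using fps_conv_radius_mult[of "fps_const c" "sigma_fps k"] conv_radius_sigma_fps[of k]
    by (intro less_conv_radius q) (auto simp: min_def split: if_splits intro: order_trans)
  show "E4 \<tau> = eval_fps fps_E4 (nome \<tau>)"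
    unfolding E4_def fps_E4_def
    by (subst eval_fps_add) (auto simp: c eval_fps_const_mult[OF q conv_radius_sigma_fps] eval_sigma_fps[OF q])
  show "E6 \<tau> = eval_fps fps_E6 (nome \<tau>)"
    unfolding E6_def fps_E6_def
    by (subst eval_fps_diff) (auto simp: c eval_fps_const_mult[OF q conv_radius_sigma_fps] eval_sigma_fps[OF q])
qed

lemma DERIV_eval_nome:
  assumes "Im \<tau> > 0" "fps_conv_radius f \<ge> 1"
  shows "((\<lambda>\<tau>. eval_fps f (nome \<tau>)) has_field_derivative 2 * pi * \<i> * eval_fps (fps_X * fps_deriv f) (nome \<tau>)) (at \<tau>)"
proof -
  have q: "norm (nome \<tau>) < 1" using norm_nome_less[OF assms(1)] .
  have "((\<lambda>\<tau>. eval_fps f (nome \<tau>)) has_field_derivative eval_fps (fps_deriv f) (nome \<tau>) * (2 * pi * \<i> * nome \<tau>)) (at \<tau>)"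
    by (rule DERIV_chain2[OF has_field_derivative_eval_fps DERIV_nome]) (intro less_conv_radius q assms)
  also have "eval_fps (fps_deriv f) (nome \<tau>) * (2 * pi * \<i> * nome \<tau>) = 2 * pi * \<i> * eval_fps (fps_X * fps_deriv f) (nome \<tau>)"
    using order_trans[OF assms(2) fps_conv_radius_deriv]
    by (subst eval_fps_mult) (auto intro!: less_conv_radius q)
  finally show ?thesis .
qed

lemma eval_fps_eq_div:
  assumes "fps_const c * f = g" "norm z < 1" "fps_conv_radius f \<ge> 1" "c \<noteq> 0"
  shows "eval_fps f z = eval_fps g (z :: complex) / c"
  using eval_fps_const_mult[OF assms(2,3), of c] assms by simp

text \<open>Differentiation in \<tau> is 2 pi i times q d/dq, so these are the formal identities
  evaluated at the nome.\<close>

lemma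
  assumes "Im \<tau> > 0"
  shows DERIV_E2: "(E2 has_field_derivative 2 * pi * \<i> * ((E2 \<tau> ^ 2 - E4 \<tau>) / 12)) (at \<tau>)"
    and DERIV_E4: "(E4 has_field_derivative 2 * pi * \<i> * ((E2 \<tau> * E4 \<tau> - E6 \<tau>) / 3)) (at \<tau>)"
    and DERIV_E6: "(E6 has_field_derivative 2 * pi * \<i> * ((E2 \<tau> * E6 \<tau> - E4 \<tau> ^ 2) / 2)) (at \<tau>)"
proof -
  have q: "norm (nome \<tau>) < 1" using norm_nome_less[OF assms] .
  note R = conv_radius_fps_E
  have RX: "fps_conv_radius (fps_X * fps_deriv f) \<ge> 1" if "fps_conv_radius f \<ge> 1" for f :: "complex fps"
    using fps_conv_radius_mult[of fps_X "fps_deriv f"] order_trans[OF that fps_conv_radius_deriv]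
    by (auto simp: min_def split: if_splits intro: order_trans)
  have RM: "fps_conv_radius (f * g) \<ge> 1" if "fps_conv_radius f \<ge> 1" "fps_conv_radius g \<ge> 1" for f g :: "complex fps"
    using fps_conv_radius_mult[of f g] that by (auto simp: min_def split: if_splits intro: order_trans)
  have M: "eval_fps (f * g - h) (nome \<tau>) = eval_fps f (nome \<tau>) * eval_fps g (nome \<tau>) - eval_fps h (nome \<tau>)"
    if "fps_conv_radius f \<ge> 1" "fps_conv_radius g \<ge> 1" "fps_conv_radius h \<ge> 1" for f g h :: "complex fps"
    using that q by (subst eval_fps_diff) (auto intro!: less_conv_radius RM simp: eval_fps_mult less_conv_radius)
  have 2: "eval_fps (fps_X * fps_deriv fps_E2) (nome \<tau>) = (E2 \<tau> ^ 2 - E4 \<tau>) / 12"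
    using eval_fps_eq_div[OF ramanujan_fps(1) q RX[OF R(1)]] M[OF R(1) R(1) R(2)]
    by (simp add: E2_def E4_eq[OF assms] power2_eq_square)
  have 4: "eval_fps (fps_X * fps_deriv fps_E4) (nome \<tau>) = (E2 \<tau> * E4 \<tau> - E6 \<tau>) / 3"
    using eval_fps_eq_div[OF ramanujan_fps(2) q RX[OF R(2)]] M[OF R(1) R(2) R(3)]
    by (simp add: E2_def E4_eq[OF assms] E6_eq[OF assms])
  have 6: "eval_fps (fps_X * fps_deriv fps_E6) (nome \<tau>) = (E2 \<tau> * E6 \<tau> - E4 \<tau> ^ 2) / 2"
  proof -
    have "eval_fps (fps_E2 * fps_E6 - fps_E4 * fps_E4) (nome \<tau>) = E2 \<tau> * E6 \<tau> - E4 \<tau> ^ 2"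
      using M[OF R(1) R(3) RM[OF R(2) R(2)]] R q
      by (simp add: E2_def E4_eq[OF assms] E6_eq[OF assms] power2_eq_square eval_fps_mult less_conv_radius)
    then show ?thesis using eval_fps_eq_div[OF ramanujan_fps(3) q RX[OF R(3)]] by simp
  qed
  show "(E2 has_field_derivative 2 * pi * \<i> * ((E2 \<tau> ^ 2 - E4 \<tau>) / 12)) (at \<tau>)"
    using DERIV_eval_nome[OF assms R(1)] unfolding 2 by (simp add: E2_def[abs_def])
  show "(E4 has_field_derivative 2 * pi * \<i> * ((E2 \<tau> * E4 \<tau> - E6 \<tau>) / 3)) (at \<tau>)"
    by (rule has_field_derivative_transform_within_open[OF DERIV_eval_nome[OF assms R(2), unfolded 4] open_uhp])
       (auto simp: assms E4_eq)
  show "(E6 has_field_derivative 2 * pi * \<i> * ((E2 \<tau> * E6 \<tau> - E4 \<tau> ^ 2) / 2)) (at \<tau>)"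
    by (rule has_field_derivative_transform_within_open[OF DERIV_eval_nome[OF assms R(3), unfolded 6] open_uhp])
       (auto simp: assms E6_eq)
qed

section \<open>The differential equation of modJ\<close>

text \<open>1728 times the normalized discriminant q - 24 q^2 + ...\<close>

definition disc :: "complex \<Rightarrow> complex" where
  "disc \<tau> = E4 \<tau> ^ 3 - E6 \<tau> ^ 2"

lemma modJ_eq: "modJ \<tau> = E4 \<tau> ^ 3 / disc \<tau>"
  by (simp add: modJ_def disc_def)

lemma DERIV_disc:
  assumes "Im \<tau> > 0"
  shows "(disc has_field_derivative 2 * pi * \<i> * E2 \<tau> * disc \<tau>) (at \<tau>)"
  unfolding disc_def[abs_def]
  by (rule derivative_eq_intros DERIV_E4[OF assms] DERIV_E6[OF assms] refl)+
     (simp add: eval_nat_numeral field_simps)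

lemma holomorphic_E: "E2 holomorphic_on uhp" "E4 holomorphic_on uhp" "E6 holomorphic_on uhp" "disc holomorphic_on uhp"
  unfolding holomorphic_on_open[OF open_uhp] mem_Collect_eq
  using DERIV_E2 DERIV_E4 DERIV_E6 DERIV_disc by blast+

text \<open>\<open>v\<close> is 1/modJ as a function of the nome. Its derivative at 0 is 3 * 240 + 2
  * 504 = 1728, and being nonzero this gives local injectivity. The last claim is a product formula
  rather than a quotient because the nonvanishing of \<open>disc\<close> is deduced from it.\<close>

lemma inverse_modJ_at_cusp:
  obtains r v where "0 < r" "r < 1" "v holomorphic_on ball 0 r" "inj_on v (ball 0 r)" "v 0 = 0"
    "\<forall>\<tau>. norm (nome \<tau>) < r \<longrightarrow> E4 \<tau> \<noteq> 0"
    "\<forall>\<tau>. norm (nome \<tau>) < r \<longrightarrow> disc \<tau> = v (nome \<tau>) * E4 \<tau> ^ 3"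
proof -
  define F where "F = eval_fps fps_E4"
  define G where "G = eval_fps fps_E6"
  have hol: "F holomorphic_on ball 0 1" "G holomorphic_on ball 0 1"
    unfolding F_def G_def using conv_radius_fps_E
    by (auto intro!: holomorphic_intros less_conv_radius)
  have d: "(F has_field_derivative 240) (at 0)" "(G has_field_derivative - 504) (at 0)"
    using has_field_derivative_eval_fps[of 0 fps_E4 UNIV] has_field_derivative_eval_fps[of 0 fps_E6 UNIV] conv_radius_fps_E
      less_conv_radius[of 0]
    by (simp_all add: F_def G_def eval_fps_at_0 fps_E4_def fps_E6_def sigma_pow_def)
  have 0: "F 0 = 1" "G 0 = 1"
    by (simp_all add: F_def G_def eval_fps_at_0 fps_E4_def fps_E6_def sigma_pow_0)
  define S where "S = {q \<in> ball 0 1. F q \<noteq> 0}"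
  have S: "open S"
  proof -
    have "open (ball 0 1 \<inter> F -` (- {0}))"
      by (rule continuous_open_preimage[OF holomorphic_on_imp_continuous_on[OF hol(1)]]) auto
    then show ?thesis by (simp add: S_def vimage_def Int_def)
  qed
  have 0: "F 0 = 1" "G 0 = 1" "0 \<in> S" using 0 by (auto simp: S_def)
  define v where "v = (\<lambda>q. (F q ^ 3 - G q ^ 2) / F q ^ 3)"
  have v: "v holomorphic_on S"
    unfolding v_def by (intro holomorphic_intros holomorphic_on_subset[OF hol(1)] holomorphic_on_subset[OF hol(2)])
      (auto simp: S_def)
  have "(v has_field_derivative 1728) (at 0)"
    unfolding v_def using 0 by (auto intro!: derivative_eq_intros d)
  then have "deriv v 0 \<noteq> 0" by (simp add: DERIV_imp_deriv)
  then obtain s where s: "s > 0" "ball 0 s \<subseteq> S" "inj_on v (ball 0 s)"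
    using has_complex_derivative_locally_injective[OF v 0(3) S] by metis
  define r where "r = min s (1/2)"
  have r: "0 < r" "r < 1" "ball 0 r \<subseteq> S" "ball 0 r \<subseteq> ball 0 s" using s by (auto simp: r_def)
  show ?thesis
  proof
    show "0 < r" "r < 1" using r by auto
    show "v holomorphic_on ball 0 r" using v r by (rule_tac holomorphic_on_subset)
    show "inj_on v (ball 0 r)" using s r by (auto intro: inj_on_subset)
    show "v 0 = 0" using 0 by (simp add: v_def)
    have "E4 \<tau> \<noteq> 0 \<and> disc \<tau> = v (nome \<tau>) * E4 \<tau> ^ 3" if \<tau>: "norm (nome \<tau>) < r" for \<tau>
    proof
    have "norm (nome \<tau>) < 1" using \<tau> r by simp
    then have Im: "Im \<tau> > 0" by (simp add: norm_nome zero_less_mult_iff)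
    have "nome \<tau> \<in> S" using \<tau> r by (auto simp: subset_iff)
    then have nz: "F (nome \<tau>) \<noteq> 0" by (simp add: S_def)
    then show "E4 \<tau> \<noteq> 0" by (simp add: E4_eq Im F_def)
    show "disc \<tau> = v (nome \<tau>) * E4 \<tau> ^ 3"
      using nz by (simp add: disc_def v_def E4_eq E6_eq Im F_def G_def)
    qed
    then show "\<forall>\<tau>. norm (nome \<tau>) < r \<longrightarrow> E4 \<tau> \<noteq> 0"
      "\<forall>\<tau>. norm (nome \<tau>) < r \<longrightarrow> disc \<tau> = v (nome \<tau>) * E4 \<tau> ^ 3" by blast+
  qed
qed

lemma norm_nome_less_radius:
  assumes "r > 0" "Im \<tau> > - ln r / (2 * pi)"
  shows "norm (nome \<tau>) < r"
proof -
  have "- 2 * pi * Im \<tau> < ln r" using assms by (simp add: field_simps)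
  then have "exp (- 2 * pi * Im \<tau>) < exp (ln r)" by (simp only: exp_less_mono)
  then show ?thesis using assms by (simp add: norm_nome)
qed

text \<open>\<open>disc\<close> solves a first-order linear equation, so it is a constant times the
  exponential of a primitive of 2 pi i \<open>E2\<close>. One nonzero value suffices, and near the
  cusp \<open>v\<close> vanishes only at nome 0.\<close>

lemma disc_nonzero:
  assumes "Im \<tau> > 0"
  shows "disc \<tau> \<noteq> 0"
proof -
  obtain g where g: "\<And>x. x \<in> uhp \<Longrightarrow> (g has_field_derivative 2 * pi * \<i> * E2 x) (at x within uhp)"
    by (rule holomorphic_convex_primitive'[OF convex_uhp open_uhp, of "\<lambda>x. 2 * pi * \<i> * E2 x"])
       (auto intro!: holomorphic_intros holomorphic_E)
  have "\<exists>c. \<forall>x\<in>uhp. disc x * exp (- g x) = c"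
  proof (rule has_field_derivative_zero_constant[OF convex_uhp])
    fix x assume x: "x \<in> uhp"
    then have "(disc has_field_derivative 2 * pi * \<i> * E2 x * disc x) (at x within uhp)"
      using DERIV_disc by (auto intro: has_field_derivative_at_within)
    then show "((\<lambda>x. disc x * exp (- g x)) has_field_derivative 0) (at x within uhp)"
      by (auto intro!: derivative_eq_intros g[OF x])
  qed
  then obtain c where c: "\<And>x. Im x > 0 \<Longrightarrow> disc x * exp (- g x) = c" by auto
  obtain r v where v: "0 < r" "r < 1" "v holomorphic_on ball 0 r" "inj_on v (ball 0 r)" "v 0 = 0"
    "\<forall>\<tau>. norm (nome \<tau>) < r \<longrightarrow> E4 \<tau> \<noteq> 0"
    "\<forall>\<tau>. norm (nome \<tau>) < r \<longrightarrow> disc \<tau> = v (nome \<tau>) * E4 \<tau> ^ 3"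
    by (rule inverse_modJ_at_cusp)
  \<comment> \<open>High enough for the nome to lie in the disc of radius r.\<close>
  define y where "y = \<i> * of_real (1 + (- ln r / (2 * pi)))"
  have y: "norm (nome y) < r" by (rule norm_nome_less_radius) (use v in \<open>auto simp: y_def\<close>)
  then have "norm (nome y) < 1" using v by simp
  then have y0: "Im y > 0" by (simp add: norm_nome zero_less_mult_iff)
  have "nome y \<noteq> 0" by (simp add: nome_def)
  then have "v (nome y) \<noteq> v 0" using inj_onD[OF v(4), of "nome y" 0] y v(1) by auto
  then have "disc y \<noteq> 0" using v y by simp
  then have "c \<noteq> 0" using c[OF y0] by auto
  then show ?thesis using c[OF assms] by auto
qed

lemma holomorphic_modJ: "modJ holomorphic_on uhp"
  unfolding modJ_eq[abs_def] by (intro holomorphic_intros holomorphic_E) (auto simp: disc_nonzero)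

lemma modJ_cusp_inj:
  obtains Y where "\<And>x y. Im x > Y \<Longrightarrow> Im y > Y \<Longrightarrow> modJ x = modJ y \<Longrightarrow> \<exists>k::int. x = y + of_int k"
proof -
  obtain r v where v: "0 < r" "r < 1" "v holomorphic_on ball 0 r" "inj_on v (ball 0 r)" "v 0 = 0"
    "\<forall>\<tau>. norm (nome \<tau>) < r \<longrightarrow> E4 \<tau> \<noteq> 0"
    "\<forall>\<tau>. norm (nome \<tau>) < r \<longrightarrow> disc \<tau> = v (nome \<tau>) * E4 \<tau> ^ 3"
    by (rule inverse_modJ_at_cusp)
  have J: "modJ x = inverse (v (nome x))" if "norm (nome x) < r" for x
    using v(6,7)[rule_format, OF that] by (simp add: modJ_eq field_simps)
  show ?thesis
  proof
    fix x y assume "Im x > - ln r / (2 * pi)" "Im y > - ln r / (2 * pi)" and eq: "modJ x = modJ y"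
    then have xy: "norm (nome x) < r" "norm (nome y) < r" using norm_nome_less_radius v(1) by auto
    with eq have "v (nome x) = v (nome y)" by (simp add: J)
    then have "nome x = nome y" using inj_onD[OF v(4)] xy by simp
    then obtain n :: int where "2 * of_real pi * \<i> * x = 2 * of_real pi * \<i> * y + of_real (of_int (2 * n) * pi) * \<i>"
      unfolding nome_def exp_eq by blast
    then have "2 * of_real pi * \<i> * x = 2 * of_real pi * \<i> * (y + of_int n)" by (simp add: algebra_simps)
    then show "\<exists>k::int. x = y + of_int k" by (intro exI[of _ n]) simp
  qed
qed

lemma modJ_at_cusp:
  obtains Y where "\<And>x. Im x > Y \<Longrightarrow> norm (modJ x) > B"
proof -
  obtain r v where v: "0 < r" "r < 1" "v holomorphic_on ball 0 r" "inj_on v (ball 0 r)" "v 0 = 0"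
    "\<forall>\<tau>. norm (nome \<tau>) < r \<longrightarrow> E4 \<tau> \<noteq> 0"
    "\<forall>\<tau>. norm (nome \<tau>) < r \<longrightarrow> disc \<tau> = v (nome \<tau>) * E4 \<tau> ^ 3"
    by (rule inverse_modJ_at_cusp)
  have J: "modJ x = inverse (v (nome x))" if "norm (nome x) < r" for x
    using v(6,7)[rule_format, OF that] by (simp add: modJ_eq field_simps)
  have "isCont v 0"
    using holomorphic_on_imp_continuous_on[OF v(3)] v(1) by (simp add: continuous_on_eq_continuous_at)
  then have "\<forall>e>0. \<exists>d>0. \<forall>x. dist x 0 < d \<longrightarrow> dist (v x) (v 0) < e"
    unfolding continuous_at_eps_delta .
  moreover have "inverse (\<bar>B\<bar> + 1) > 0" by simp
  ultimately obtain d where d: "d > 0" "\<And>q. norm q < d \<Longrightarrow> norm (v q) < inverse (\<bar>B\<bar> + 1)"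
    using v(5) by (metis dist_0_norm dist_commute)
  define r' where "r' = min r d"
  have r': "r' > 0" using v d by (auto simp: r'_def)
  show ?thesis
  proof
    fix x assume "Im x > - ln r' / (2 * pi)"
    then have "norm (nome x) < r'" using r' norm_nome_less_radius by blast
    then have x: "norm (nome x) < r" "norm (v (nome x)) < inverse (\<bar>B\<bar> + 1)" using d by (auto simp: r'_def)
    have "nome x \<noteq> 0" by (simp add: nome_def)
    then have "v (nome x) \<noteq> v 0" using inj_onD[OF v(4), of "nome x" 0] x v(1) by auto
    then have "norm (v (nome x)) > 0" using v(5) by simp
    then have "inverse (norm (v (nome x))) > \<bar>B\<bar> + 1"
      using x(2) by (metis inverse_inverse_eq less_imp_inverse_less)
    then show "norm (modJ x) > B" using J[OF x(1)] by (simp add: norm_inverse)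
  qed
qed

lemma modJ_minus_1: "Im \<tau> > 0 \<Longrightarrow> modJ \<tau> - 1 = E6 \<tau> ^ 2 / disc \<tau>"
  using disc_nonzero[of \<tau>] by (simp add: modJ_eq field_simps) (simp add: disc_def)

text \<open>The terms in \<open>E2\<close> cancel, as they must for the derivative of a function of
  weight 0; what remains vanishes exactly where \<open>modJ\<close> is 0 or 1.\<close>

lemma DERIV_modJ:
  assumes "Im \<tau> > 0"
  shows "(modJ has_field_derivative - (2 * pi * \<i> * E4 \<tau> ^ 2 * E6 \<tau> / disc \<tau>)) (at \<tau>)"
proof -
  have "(modJ has_field_derivative ((3 * E4 \<tau> ^ 2 * (2 * pi * \<i> * ((E2 \<tau> * E4 \<tau> - E6 \<tau>) / 3))) * disc \<tau> 
      - E4 \<tau> ^ 3 * (2 * pi * \<i> * E2 \<tau> * disc \<tau>)) / (disc \<tau> * disc \<tau>)) (at \<tau>)"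
    unfolding modJ_eq[abs_def]
    by (rule derivative_eq_intros DERIV_E4[OF assms] DERIV_disc[OF assms] disc_nonzero[OF assms] refl)+ 
       (auto simp: eval_nat_numeral)
  also have "((3 * E4 \<tau> ^ 2 * (2 * pi * \<i> * ((E2 \<tau> * E4 \<tau> - E6 \<tau>) / 3))) * disc \<tau> 
      - E4 \<tau> ^ 3 * (2 * pi * \<i> * E2 \<tau> * disc \<tau>)) / (disc \<tau> * disc \<tau>) = - (2 * pi * \<i> * E4 \<tau> ^ 2 * E6 \<tau> / disc \<tau>)"
    using disc_nonzero[OF assms] by (simp add: field_simps eval_nat_numeral)
  finally show ?thesis .
qed

lemma modJ_notin_iff: "Im \<tau> > 0 \<Longrightarrow> modJ \<tau> \<notin> {0, 1} \<longleftrightarrow> E4 \<tau> \<noteq> 0 \<and> E6 \<tau> \<noteq> 0"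
  using modJ_minus_1[of \<tau>] disc_nonzero[of \<tau>] by (auto simp: modJ_eq)

lemma deriv_modJ_nonzero: "Im \<tau> > 0 \<Longrightarrow> modJ \<tau> \<notin> {0, 1} \<Longrightarrow> deriv modJ \<tau> \<noteq> 0"
  using modJ_notin_iff[of \<tau>] disc_nonzero[of \<tau>] by (simp add: DERIV_imp_deriv[OF DERIV_modJ])

text \<open>Here h is the logarithmic derivative f''/f', for which the Schwarzian is h' - h^2/2.
  Second and third derivatives of quotients need not be expanded in this form.\<close>

lemma schwarzian_via_log_deriv:
  assumes S: "open S" "t \<in> S" and f: "\<And>x. x \<in> S \<Longrightarrow> (f has_field_derivative g x) (at x)"
    and g: "\<And>x. x \<in> S \<Longrightarrow> (g has_field_derivative g x * h x) (at x)"
    and h: "(h has_field_derivative m) (at t)" and nz: "g t \<noteq> 0"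
  shows "schwarzian f t = m - h t ^ 2 / 2"
proof -
  have 1: "deriv f x = g x" if "x \<in> S" for x using f[OF that] by (rule DERIV_imp_deriv)
  have "(deriv f has_field_derivative g x * h x) (at x)" if "x \<in> S" for x
    by (rule has_field_derivative_transform_within_open[OF g[OF that] S(1) that]) (simp add: 1)
  then have 2: "deriv (deriv f) x = g x * h x" if "x \<in> S" for x using that by (blast intro: DERIV_imp_deriv)
  have "((\<lambda>x. g x * h x) has_field_derivative g t * h t * h t + m * g t) (at t)"
    by (rule DERIV_mult[OF g[OF S(2)] h])
  then have "(deriv (deriv f) has_field_derivative g t * h t * h t + m * g t) (at t)"
    by (rule has_field_derivative_transform_within_open[OF _ S]) (simp add: 2)
  then have 3: "(deriv ^^ 3) f t = g t * h t * h t + m * g t"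
    by (simp add: numeral_3_eq_3 DERIV_imp_deriv)
  show ?thesis using nz unfolding schwarzian_def 3 2[OF S(2)] 1[OF S(2)]
    by (simp add: field_simps power2_eq_square)
qed

text \<open>The coefficient in \<open>Box\<close> is half of 4/(9 j^2) + 3/(8 (j-1)^2) - 23/(72 j
  (j-1)), the Schwarzian of the inverse of \<open>modJ\<close> as a triangle map: local exponents
  1/3, 1/2, 0 at j = 0, 1, infinity give the numerators (1 - 1/9)/2, (1 - 1/4)/2 and (1/9 + 1/4 -
  1)/2. Ramanujan's equations turn the claim into a rational identity in \<open>E2\<close>,
  \<open>E4\<close>, \<open>E6\<close>.\<close>

lemma Box_modJ:
  assumes "Im \<tau> > 0" "modJ \<tau> \<notin> {0, 1}"
  shows "Box modJ \<tau> = 0"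
proof -
  define c :: complex where "c = 2 * pi * \<i>"
  define S where "S = {x \<in> uhp. E4 x * E6 x \<noteq> 0}"
  have "continuous_on uhp (\<lambda>x. E4 x * E6 x)"
    by (intro continuous_intros holomorphic_on_imp_continuous_on holomorphic_E)
  then have "open (uhp \<inter> (\<lambda>x. E4 x * E6 x) -` (- {0}))"
    by (rule continuous_open_preimage) (auto simp: open_uhp)
  also have "uhp \<inter> (\<lambda>x. E4 x * E6 x) -` (- {0}) = S" by (auto simp: S_def)
  finally have S: "open S" .
  have \<tau>: "\<tau> \<in> S" using assms modJ_notin_iff[of \<tau>] by (simp add: S_def)
  let ?g = "\<lambda>x. - (c * E4 x ^ 2 * E6 x / disc x)"
  \<comment> \<open>Logarithmic derivative of \<open>?g\<close>: twice that of \<open>E4\<close>,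
    plus that of \<open>E6\<close>, minus that of \<open>disc\<close>; the coefficient of
    \<open>E2\<close> is 2/3 + 1/2 - 1 = 1/6.\<close>
  let ?h = "\<lambda>x. c * (E2 x / 6 - 2/3 * (E6 x / E4 x) - 1/2 * (E4 x ^ 2 / E6 x))"
  define P Q R D where PQR: "P = E2 \<tau>" "Q = E4 \<tau>" "R = E6 \<tau>" "D = disc \<tau>"
  have nz: "Q \<noteq> 0" "R \<noteq> 0" "D \<noteq> 0" "Q^3 - R^2 = D" and c0: "c \<noteq> 0"
    using \<tau> disc_nonzero[of \<tau>] assms by (auto simp: PQR S_def c_def disc_def)
  define P' Q' R' where PQR': "P' = c * ((P\<^sup>2 - Q) / 12)" "Q' = c * ((P * Q - R) / 3)" "R' = c * ((P * R - Q\<^sup>2) / 2)"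
  define m where "m = c * (P' / 6 - 2/3 * ((R' * Q - R * Q') / (Q * Q)) - 1/2 * ((2 * Q * Q' * R - Q\<^sup>2 * R') / (R * R)))"
  have "schwarzian modJ \<tau> = m - ?h \<tau> ^ 2 / 2"
  proof (rule schwarzian_via_log_deriv[OF S \<tau>])
    fix x assume x: "x \<in> S"
    then have Im: "Im x > 0" and n: "E4 x \<noteq> 0" "E6 x \<noteq> 0" "disc x \<noteq> 0" using disc_nonzero[of x] by (auto simp: S_def)
    show "(modJ has_field_derivative ?g x) (at x)" using DERIV_modJ[OF Im] by (simp add: c_def)
    have "(?g has_field_derivative - ((c * (2 * E4 x * (c * ((E2 x * E4 x - E6 x) / 3))) * E6 x
        + c * E4 x ^ 2 * (c * ((E2 x * E6 x - E4 x ^ 2) / 2))) * disc x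
       - c * E4 x ^ 2 * E6 x * (c * E2 x * disc x)) / (disc x * disc x)) (at x)"
      unfolding c_def
      by (rule derivative_eq_intros DERIV_E4[OF Im] DERIV_E6[OF Im] DERIV_disc[OF Im] n(3) refl)+
         (simp add: field_simps n)
    then show "(?g has_field_derivative ?g x * ?h x) (at x)"
      by (rule back_subst[of "\<lambda>d. (?g has_field_derivative d) (at x)"])
         (use n in \<open>simp add: field_simps power2_eq_square\<close>)
  next
    have Im: "Im \<tau> > 0" using assms by auto
    have n: "E4 \<tau> \<noteq> 0" "E6 \<tau> \<noteq> 0" using nz by (auto simp: PQR)
    have d: "(E2 has_field_derivative P') (at \<tau>)" "(E4 has_field_derivative Q') (at \<tau>)" "(E6 has_field_derivative R') (at \<tau>)"
      unfolding PQR PQR' c_def by (rule DERIV_E2[OF Im] DERIV_E4[OF Im] DERIV_E6[OF Im])+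
    have "((\<lambda>x. E6 x / E4 x) has_field_derivative (R' * Q - R * Q') / (Q * Q)) (at \<tau>)"
      unfolding PQR by (rule DERIV_divide[OF d(3) d(2) n(1)])
    moreover have "((\<lambda>x. E4 x ^ 2 / E6 x) has_field_derivative (2 * Q * Q' * R - Q\<^sup>2 * R') / (R * R)) (at \<tau>)"
      unfolding PQR by (rule DERIV_divide[OF _ d(3) n(2)]) (auto intro!: derivative_eq_intros d(2))
    ultimately show "(?h has_field_derivative m) (at \<tau>)"
      unfolding m_def by (intro DERIV_cmult DERIV_diff DERIV_cdivide d(1))
    show "?g \<tau> \<noteq> 0" using nz c0 by (simp add: PQR)
  qed
  moreover have "deriv modJ \<tau> = - (c * Q ^ 2 * R / D)"
    using DERIV_imp_deriv[OF DERIV_modJ[of \<tau>]] assms by (simp add: c_def PQR)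
  moreover have J: "modJ \<tau> = Q ^ 3 / D" by (simp add: modJ_eq PQR)
  moreover have "modJ \<tau> - 1 = R ^ 2 / D" using modJ_minus_1[of \<tau>] assms by (simp add: PQR)
  ultimately have "Box modJ \<tau> = (- (c * Q ^ 2 * R / D))\<^sup>2 * (36 * (Q ^ 3 / D)\<^sup>2 - 41 * (Q ^ 3 / D) + 32)
     / (144 * (R ^ 2 / D)\<^sup>2 * (Q ^ 3 / D)\<^sup>2) + (m - (c * (P / 6 - 2/3 * (R / Q) - 1/2 * (Q ^ 2 / R)))\<^sup>2 / 2) / 2"
    unfolding Box_def by (simp add: PQR)
  moreover have "(- (c * Q ^ 2 * R / D))\<^sup>2 * (36 * (Q ^ 3 / D)\<^sup>2 - 41 * (Q ^ 3 / D) + 32)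
     / (144 * (R ^ 2 / D)\<^sup>2 * (Q ^ 3 / D)\<^sup>2) = c^2 * (36 * Q^6 - 41 * Q^3 * D + 32 * D^2) / (144 * R^2 * Q^2)"
    using nz(1-3) by (simp add: field_simps eval_nat_numeral)
  \<comment> \<open>With D replaced by Q^3 - R^2, the terms in P cancel and only Q and R
    remain.\<close>
  moreover have "c^2 * (36 * Q^6 - 41 * Q^3 * D + 32 * D^2) / (144 * R^2 * Q^2)
      + (m - (c * (P / 6 - 2/3 * (R / Q) - 1/2 * (Q ^ 2 / R)))\<^sup>2 / 2) / 2 = 0"
    unfolding m_def PQR' nz(4)[symmetric] using nz(1,2) by (simp add: divide_simps) algebra
  ultimately show ?thesis by simp
qed

section \<open>Schwarzian derivatives and Moebius transformations\<close>

lemma higher_deriv_3: "(deriv ^^ 3) f = deriv (deriv (deriv f))"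
  by (simp add: numeral_3_eq_3)

lemma schwarzian_compose:
  assumes S: "open S" "t \<in> S" and T: "open T" and s: "s holomorphic_on S" "s ` S \<subseteq> T" and f: "f holomorphic_on T"
    and j: "\<And>x. x \<in> S \<Longrightarrow> j x = f (s x)" and nz: "deriv s t \<noteq> 0" "deriv f (s t) \<noteq> 0"
  shows "deriv j t = deriv f (s t) * deriv s t"
    and "schwarzian j t = schwarzian f (s t) * deriv s t ^ 2 + schwarzian s t"
proof -
  note hs = holomorphic_derivI[OF s(1) S(1)]
  note hs1 = holomorphic_derivI[OF holomorphic_deriv[OF s(1) S(1)] S(1)]
  note hs2 = holomorphic_derivI[OF holomorphic_deriv[OF holomorphic_deriv[OF s(1) S(1)] S(1)] S(1)]
  note hf = holomorphic_derivI[OF f T]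
  note hf1 = holomorphic_derivI[OF holomorphic_deriv[OF f T] T]
  note hf2 = holomorphic_derivI[OF holomorphic_deriv[OF holomorphic_deriv[OF f T] T] T]
  have sT: "s x \<in> T" if "x \<in> S" for x using s(2) that by auto
  have 1: "deriv j x = deriv f (s x) * deriv s x" if x: "x \<in> S" for x
  proof (rule DERIV_imp_deriv, rule has_field_derivative_transform_within_open[OF _ S(1) x])
    show "((\<lambda>x. f (s x)) has_field_derivative deriv f (s x) * deriv s x) (at x)"
      by (rule DERIV_chain2[OF hf[OF sT[OF x]] hs[OF x]])
  qed (simp add: j)
  have 2: "deriv (deriv j) x = deriv (deriv f) (s x) * deriv s x * deriv s x + deriv (deriv s) x * deriv f (s x)"
    if x: "x \<in> S" for x
  proof (rule DERIV_imp_deriv, rule has_field_derivative_transform_within_open[OF _ S(1) x])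
    show "((\<lambda>x. deriv f (s x) * deriv s x) has_field_derivative
       deriv (deriv f) (s x) * deriv s x * deriv s x + deriv (deriv s) x * deriv f (s x)) (at x)"
      by (rule DERIV_mult[OF DERIV_chain2[OF hf1[OF sT[OF x]] hs[OF x]] hs1[OF x]])
  qed (simp add: 1)
  have 3: "deriv (deriv (deriv j)) t = deriv (deriv (deriv f)) (s t) * deriv s t ^ 3
     + 3 * deriv (deriv f) (s t) * deriv s t * deriv (deriv s) t + deriv f (s t) * deriv (deriv (deriv s)) t"
  proof (rule DERIV_imp_deriv, rule has_field_derivative_transform_within_open[OF _ S])
    show "((\<lambda>x. deriv (deriv f) (s x) * deriv s x * deriv s x + deriv (deriv s) x * deriv f (s x)) has_field_derivative
       deriv (deriv (deriv f)) (s t) * deriv s t ^ 3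
     + 3 * deriv (deriv f) (s t) * deriv s t * deriv (deriv s) t + deriv f (s t) * deriv (deriv (deriv s)) t) (at t)"
      by (rule derivative_eq_intros DERIV_chain2[OF hf1[OF sT[OF S(2)]] hs[OF S(2)]]
            DERIV_chain2[OF hf[OF sT[OF S(2)]] hs[OF S(2)]] DERIV_chain2[OF hf2[OF sT[OF S(2)]] hs[OF S(2)]]
            hs1[OF S(2)] hs2[OF S(2)] refl)+ (simp add: algebra_simps power3_eq_cube)
  qed (simp add: 2)
  show "deriv j t = deriv f (s t) * deriv s t" using 1 S(2) .
  show "schwarzian j t = schwarzian f (s t) * deriv s t ^ 2 + schwarzian s t"
    unfolding schwarzian_def higher_deriv_3 1[OF S(2)] 2[OF S(2)] 3 using nz
    by (simp add: field_simps eval_nat_numeral)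
qed

text \<open>Both parts of \<open>Box\<close> pull back with the factor s'^2, the Schwarzian with the
  extra summand for s; the modular part is zero by \<open>Box_modJ\<close>.\<close>

lemma Box_compose_modJ:
  assumes S: "open S" "t \<in> S" and s: "s holomorphic_on S" "s ` S \<subseteq> uhp"
    and j: "\<And>x. x \<in> S \<Longrightarrow> j x = modJ (s x)" and nz: "deriv j t \<noteq> 0" and "modJ (s t) \<notin> {0, 1}"
  shows "deriv s t \<noteq> 0" "Box j t = schwarzian s t / 2"
proof -
  have st: "Im (s t) > 0" using s(2) S(2) by auto
  have "((\<lambda>x. modJ (s x)) has_field_derivative deriv modJ (s t) * deriv s t) (at t)"
    using DERIV_chain2[OF holomorphic_derivI[OF holomorphic_modJ open_uhp] holomorphic_derivI[OF s(1) S]] st by simp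
  then have "(j has_field_derivative deriv modJ (s t) * deriv s t) (at t)"
    by (rule has_field_derivative_transform_within_open[OF _ S]) (simp add: j)
  then have d: "deriv j t = deriv modJ (s t) * deriv s t" by (rule DERIV_imp_deriv)
  with nz show s0: "deriv s t \<noteq> 0" by auto
  have J0: "deriv modJ (s t) \<noteq> 0" using nz d by auto
  have "Box j t = Box modJ (s t) * deriv s t ^ 2 + schwarzian s t / 2"
    using schwarzian_compose(2)[OF S open_uhp s holomorphic_modJ j s0 J0]
    unfolding Box_def d j[OF S(2)] by (simp add: field_simps)
  then show "Box j t = schwarzian s t / 2" using Box_modJ[OF st assms(7)] by simp
qed

text \<open>If \<open>h\<^sup>-\<^sup>2\<close> is the derivative of \<open>s\<close>, then \<open>h\<close> and \<open>s h\<close> solve the linear equation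
  \<open>y'' + {s,t} y / 2 = 0\<close>, so equal Schwarzians give linearly related solution pairs.\<close>
lemma schwarzian_linear_ode:
  assumes S: "open S" "convex S" and s: "s holomorphic_on S" and nz: "\<And>x. x \<in> S \<Longrightarrow> deriv s x \<noteq> 0"
  obtains h where "\<And>x. x \<in> S \<Longrightarrow> h x \<noteq> 0" "\<And>x. x \<in> S \<Longrightarrow> (h has_field_derivative deriv h x) (at x)"
    "\<And>x. x \<in> S \<Longrightarrow> (deriv h has_field_derivative - schwarzian s x / 2 * h x) (at x)"
    "\<And>x. x \<in> S \<Longrightarrow> deriv s x * h x ^ 2 = 1"
proof -
  note hs = holomorphic_derivI[OF s(1) S(1)]
  note hol1 = holomorphic_deriv[OF s(1) S(1)]
  note hs1 = holomorphic_derivI[OF hol1 S(1)]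
  note hs2 = holomorphic_derivI[OF holomorphic_deriv[OF hol1 S(1)] S(1)]
  obtain r where r: "r holomorphic_on S" "\<And>x. x \<in> S \<Longrightarrow> deriv s x = r x ^ 2"
    using simply_connected_eq_holomorphic_sqrt[OF S(1)] convex_imp_simply_connected[OF S(2)] hol1 nz by metis
  define h where "h = (\<lambda>x. inverse (r x))"
  have r0: "r x \<noteq> 0" if "x \<in> S" for x using nz[OF that] r(2)[OF that] by auto
  have hol: "h holomorphic_on S" unfolding h_def by (intro holomorphic_intros r) (simp add: r0)
  have h2: "deriv s x * h x ^ 2 = 1" if "x \<in> S" for x
    using r0[OF that] by (simp add: r(2)[OF that] h_def power_inverse)
  have h0: "h x \<noteq> 0" if "x \<in> S" for x using r0[OF that] by (simp add: h_def)
  note dh = holomorphic_derivI[OF hol S(1)]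
  note dh1 = holomorphic_derivI[OF holomorphic_deriv[OF hol S(1)] S(1)]
  have e1: "deriv h x = - (deriv (deriv s) x * h x ^ 3) / 2" if x: "x \<in> S" for x
  proof -
    have "((\<lambda>x. deriv s x * h x ^ 2) has_field_derivative deriv (deriv s) x * h x ^ 2 + 2 * h x * deriv h x * deriv s x) (at x)"
      by (rule derivative_eq_intros hs1[OF x] dh[OF x] refl)+ (simp add: algebra_simps)
    moreover have "((\<lambda>x. deriv s x * h x ^ 2) has_field_derivative 0) (at x)"
      by (rule has_field_derivative_transform_within_open[OF _ S(1) x, of "\<lambda>_. 1"]) (simp_all add: h2)
    ultimately have "deriv (deriv s) x * h x ^ 2 + 2 * h x * deriv h x * deriv s x = 0" by (rule DERIV_unique)
    then have "h x * (deriv (deriv s) x * h x ^ 2 + 2 * h x * deriv h x * deriv s x) = 0" by simp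
    then have "deriv (deriv s) x * h x ^ 3 + 2 * deriv h x * (deriv s x * h x ^ 2) = 0"
      by (simp add: algebra_simps power2_eq_square power3_eq_cube)
    then show ?thesis using h2[OF x] by (simp add: field_simps eq_neg_iff_add_eq_0)
  qed
  have e2: "deriv (deriv h) x = - schwarzian s x / 2 * h x" if x: "x \<in> S" for x
  proof -
    have "((\<lambda>x. deriv (deriv s) x * (h x * h x * h x)) has_field_derivative
      deriv (deriv (deriv s)) x * h x ^ 3 + 3 * h x ^ 2 * deriv h x * deriv (deriv s) x) (at x)"
      by (rule derivative_eq_intros hs2[OF x] dh[OF x] refl)+ (simp add: algebra_simps eval_nat_numeral)
    then have "(deriv h has_field_derivative
      - 1/2 * (deriv (deriv (deriv s)) x * h x ^ 3 + 3 * h x ^ 2 * deriv h x * deriv (deriv s) x)) (at x)"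
      by (rule has_field_derivative_transform_within_open[OF DERIV_cmult S(1) x]) (simp add: e1 power3_eq_cube)
    then have "deriv (deriv h) x
      = - 1/2 * (deriv (deriv (deriv s)) x * h x ^ 3 + 3 * h x ^ 2 * deriv h x * deriv (deriv s) x)"
      by (rule DERIV_imp_deriv)
    also have "\<dots> = - schwarzian s x / 2 * h x"
    proof -
      define d0 d1 d2 H where "d0 = deriv s x" "d1 = deriv (deriv s) x" "d2 = deriv (deriv (deriv s)) x" "H = h x"
      have "d0 \<noteq> 0" "H \<noteq> 0" using nz[OF x] h0[OF x] by (simp_all add: d0_d1_d2_H_def)
      moreover have "d0 * H\<^sup>2 = 1" using h2[OF x] by (simp add: d0_d1_d2_H_def)
      ultimately have d0: "d0 = 1 / H ^ 2" "H \<noteq> 0" by (simp_all add: field_simps)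
      show ?thesis unfolding schwarzian_def higher_deriv_3 e1[OF x] d0_d1_d2_H_def[symmetric] d0(1)
        using d0(2) by (simp add: field_simps eval_nat_numeral)
    qed
    finally show ?thesis .
  qed
  show ?thesis
    by (rule that[of h]) (use h0 dh dh1 e2 h2 in auto)
qed

text \<open>s = (s h)/h and u = (u k)/k are quotients of solutions of one second-order equation. The
  Wronskians a', b', c', d' are the constants that express k and u k in the basis h, s h.\<close>

lemma equal_schwarzian_imp_moebius:
  assumes S: "open S" "convex S" "S \<noteq> {}"
    and s: "s holomorphic_on S" "\<And>x. x \<in> S \<Longrightarrow> deriv s x \<noteq> 0"
    and u: "u holomorphic_on S" "\<And>x. x \<in> S \<Longrightarrow> deriv u x \<noteq> 0"
    and eq: "\<And>x. x \<in> S \<Longrightarrow> schwarzian s x = schwarzian u x"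
  obtains a b c d :: complex where "a * d - b * c = 1" "\<And>x. x \<in> S \<Longrightarrow> c * s x + d \<noteq> 0"
    "\<And>x. x \<in> S \<Longrightarrow> u x = (a * s x + b) / (c * s x + d)"
proof -
  obtain h where h: "\<And>x. x \<in> S \<Longrightarrow> h x \<noteq> 0" "\<And>x. x \<in> S \<Longrightarrow> (h has_field_derivative deriv h x) (at x)"
    "\<And>x. x \<in> S \<Longrightarrow> (deriv h has_field_derivative - schwarzian s x / 2 * h x) (at x)"
    "\<And>x. x \<in> S \<Longrightarrow> deriv s x * h x ^ 2 = 1"
    using schwarzian_linear_ode[OF S(1,2) s] by metis
  obtain k where k: "\<And>x. x \<in> S \<Longrightarrow> k x \<noteq> 0" "\<And>x. x \<in> S \<Longrightarrow> (k has_field_derivative deriv k x) (at x)"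
    "\<And>x. x \<in> S \<Longrightarrow> (deriv k has_field_derivative - schwarzian u x / 2 * k x) (at x)"
    "\<And>x. x \<in> S \<Longrightarrow> deriv u x * k x ^ 2 = 1"
    using schwarzian_linear_ode[OF S(1,2) u] by metis
  note hs = holomorphic_derivI[OF s(1) S(1)]
  note hu = holomorphic_derivI[OF u(1) S(1)]
  have const: "\<exists>c. \<forall>x\<in>S. W x = c" if "\<And>x. x \<in> S \<Longrightarrow> (W has_field_derivative 0) (at x)" for W :: "complex \<Rightarrow> complex"
    using has_field_derivative_zero_constant[OF S(2), of W] that by (auto intro: has_field_derivative_at_within)
  define sh where "sh = (\<lambda>x. deriv s x * h x + s x * deriv h x)"
  define uk where "uk = (\<lambda>x. deriv u x * k x + u x * deriv k x)"
  have dsh: "((\<lambda>x. s x * h x) has_field_derivative sh x) (at x)" if "x \<in> S" for x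
    unfolding sh_def by (rule derivative_eq_intros hs[OF that] h(2)[OF that] refl)+ (simp add: algebra_simps)
  have duk: "((\<lambda>x. u x * k x) has_field_derivative uk x) (at x)" if "x \<in> S" for x
    unfolding uk_def by (rule derivative_eq_intros hu[OF that] k(2)[OF that] refl)+ (simp add: algebra_simps)
  \<comment> \<open>For y^2 = 1/f', the function f y solves the same equation as y: differentiating
    f' y^2 = 1 gives f'' y + 2 f' y' = 0, which kills the extra terms.\<close>
  have second: "(yh has_field_derivative - schwarzian f x / 2 * (f x * y x)) (at x)"
    if x: "x \<in> S" and f: "f holomorphic_on S" and y: "\<And>x. x \<in> S \<Longrightarrow> (y has_field_derivative deriv y x) (at x)"
     "\<And>x. x \<in> S \<Longrightarrow> (deriv y has_field_derivative - schwarzian f x / 2 * y x) (at x)"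
     "\<And>x. x \<in> S \<Longrightarrow> deriv f x * y x ^ 2 = 1" and yh: "yh = (\<lambda>x. deriv f x * y x + f x * deriv y x)"
    for f y yh x
  proof -
    note hf = holomorphic_derivI[OF f S(1)]
    note hf1 = holomorphic_derivI[OF holomorphic_deriv[OF f S(1)] S(1)]
    have "((\<lambda>x. deriv f x * y x ^ 2) has_field_derivative deriv (deriv f) x * y x ^ 2 + 2 * y x * deriv y x * deriv f x) (at x)"
      by (rule derivative_eq_intros hf1[OF x] y(1)[OF x] refl)+ (simp add: algebra_simps)
    moreover have "((\<lambda>x. deriv f x * y x ^ 2) has_field_derivative 0) (at x)"
      by (rule has_field_derivative_transform_within_open[OF _ S(1) x, of "\<lambda>_. 1"]) (simp_all add: y(3))
    ultimately have "deriv (deriv f) x * y x ^ 2 + 2 * y x * deriv y x * deriv f x = 0" by (rule DERIV_unique)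
    then have "y x * (deriv (deriv f) x * y x + 2 * deriv y x * deriv f x) = 0"
      by (simp add: algebra_simps power2_eq_square)
    moreover have "y x \<noteq> 0" using y(3)[OF x] by auto
    ultimately have z: "deriv (deriv f) x * y x + 2 * deriv y x * deriv f x = 0" by simp
    have "(yh has_field_derivative (deriv (deriv f) x * y x + 2 * deriv y x * deriv f x)
       + - schwarzian f x / 2 * (f x * y x)) (at x)"
      unfolding yh
      by (rule derivative_eq_intros hf1[OF x] y(1)[OF x] hf[OF x] y(2)[OF x] refl)+ (simp add: algebra_simps)
    then show ?thesis unfolding z by simp
  qed
  have dsh1: "(sh has_field_derivative - schwarzian s x / 2 * (s x * h x)) (at x)" if "x \<in> S" for x
    by (rule second[OF that s(1) h(2-4) sh_def])
  have duk1: "(uk has_field_derivative - schwarzian s x / 2 * (u x * k x)) (at x)" if "x \<in> S" for x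
    using second[OF that u(1) k(2-4) uk_def] by (simp add: eq[OF that])
  have k3: "(deriv k has_field_derivative - schwarzian s x / 2 * k x) (at x)" if "x \<in> S" for x
    using k(3)[OF that] by (simp add: eq[OF that])
  have W: "((\<lambda>x. y x * z' x - z x * y' x) has_field_derivative 0) (at x)"
    if "(y has_field_derivative y' x) (at x)" "(z has_field_derivative z' x) (at x)"
      "(y' has_field_derivative q * y x) (at x)" "(z' has_field_derivative q * z x) (at x)" for y z y' z' q x
    by (rule derivative_eq_intros that refl)+ (simp add: algebra_simps)
  \<comment> \<open>Wronskians of two solutions of the same equation are constant.\<close>
  obtain d' where d': "\<And>x. x \<in> S \<Longrightarrow> k x * sh x - (s x * h x) * deriv k x = d'"
    using const[OF W[OF k(2) dsh k3 dsh1]] by auto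
  obtain c' where c': "\<And>x. x \<in> S \<Longrightarrow> k x * deriv h x - h x * deriv k x = c'"
    using const[OF W[OF k(2) h(2) k3 h(3)]] by auto
  obtain b' where b': "\<And>x. x \<in> S \<Longrightarrow> (u x * k x) * sh x - (s x * h x) * uk x = b'"
    using const[OF W[OF duk dsh duk1 dsh1]] by auto
  obtain a' where a': "\<And>x. x \<in> S \<Longrightarrow> (u x * k x) * deriv h x - h x * uk x = a'"
    using const[OF W[OF duk h(2) duk1 h(3)]] by auto
  have w1: "h x * sh x - s x * h x * deriv h x = 1" if "x \<in> S" for x
    using h(4)[OF that] by (simp add: sh_def algebra_simps power2_eq_square)
  have w2: "k x * uk x - u x * k x * deriv k x = 1" if "x \<in> S" for x
    using k(4)[OF that] by (simp add: uk_def algebra_simps power2_eq_square)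
  \<comment> \<open>Cramer's rule in the basis h, s h, whose Wronskian is 1 by
    \<open>w1\<close>.\<close>
  have kx: "k x = h x * (- c' * s x + d')" if x: "x \<in> S" for x
  proof -
    have "h x * (- c' * s x + d') = k x * (h x * sh x - s x * h x * deriv h x)"
      unfolding c'[OF x, symmetric] d'[OF x, symmetric] by (simp add: algebra_simps)
    then show ?thesis using w1[OF x] by simp
  qed
  have ux: "u x * k x = h x * (- a' * s x + b')" if x: "x \<in> S" for x
  proof -
    have "h x * (- a' * s x + b') = u x * k x * (h x * sh x - s x * h x * deriv h x)"
      unfolding a'[OF x, symmetric] b'[OF x, symmetric] by (simp add: algebra_simps)
    then show ?thesis using w1[OF x] by simp
  qed
  obtain x0 where x0: "x0 \<in> S" using S(3) by auto
  \<comment> \<open>The determinant of this change of basis is a product of the two unit Wronskians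
    \<open>w1\<close> and \<open>w2\<close>.\<close>
  have det: "(- a') * d' - b' * (- c') = 1"
  proof -
    have "(- a') * d' - b' * (- c')
      = (k x0 * uk x0 - u x0 * k x0 * deriv k x0) * (h x0 * sh x0 - s x0 * h x0 * deriv h x0)"
      unfolding a'[OF x0, symmetric] b'[OF x0, symmetric] c'[OF x0, symmetric] d'[OF x0, symmetric]
      by (simp add: algebra_simps)
    then show ?thesis using w1[OF x0] w2[OF x0] by simp
  qed
  show ?thesis
  proof (rule that[OF det])
    fix x assume x: "x \<in> S"
    show nz: "- c' * s x + d' \<noteq> 0" using kx[OF x] k(1)[OF x] by auto
    have "u x * (h x * (- c' * s x + d')) = h x * (- a' * s x + b')" using ux[OF x] kx[OF x] by simp
    then have "u x * (- c' * s x + d') = - a' * s x + b'" using h(1)[OF x] by (simp add: mult.left_commute)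
    then show "u x = (- a' * s x + b') / (- c' * s x + d')" using nz by (simp add: nonzero_eq_divide_eq)
  qed
qed

section \<open>Lipschitz summation and Eisenstein series\<close>

text \<open>\<open>polylog_neg k w\<close> is the rational function with Taylor series \<open>\<Sum>r. r ^ k * w ^ r\<close> for \<open>1 \<le> k \<le> 5\<close>;
  for \<open>k = 0\<close> the constant term is dropped.\<close>
definition polylog_neg :: "nat \<Rightarrow> complex \<Rightarrow> complex" where
  "polylog_neg k w = (if k = 0 then w / (1 - w) else if k = 1 then w / (1 - w)^2
     else if k = 2 then w * (1 + w) / (1 - w)^3 else if k = 3 then w * (1 + 4*w + w^2) / (1 - w)^4
     else if k = 4 then w * (1 + 11*w + 11*w^2 + w^3) / (1 - w)^5
     else w * (1 + 26*w + 66*w^2 + 26*w^3 + w^4) / (1 - w)^6)"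

text \<open>The derivative of \<open>polylog_neg k\<close> for k < 5. The numerators are Eulerian
  polynomials.\<close>

definition polylog_neg' :: "nat \<Rightarrow> complex \<Rightarrow> complex" where
  "polylog_neg' k w = (if k = 0 then 1 / (1 - w)^2
     else if k = 1 then (1 + w) / (1 - w)^3 else if k = 2 then (1 + 4*w + w^2) / (1 - w)^4
     else if k = 3 then (1 + 11*w + 11*w^2 + w^3) / (1 - w)^5
     else (1 + 26*w + 66*w^2 + 26*w^3 + w^4) / (1 - w)^6)"

lemma DERIV_power_quotient:
  assumes "(f has_field_derivative f') (at w)" "w \<noteq> 1"
  shows "((\<lambda>w. f w / (1 - w) ^ n) has_field_derivative (f' * (1 - w) + of_nat n * f w) / (1 - w) ^ Suc n) (at (w::complex))"
proof (cases n)
  case 0 then show ?thesis using assms by simp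
next
  case (Suc m)
  have "((\<lambda>w. f w / (1 - w) ^ n) has_field_derivative
     (f' * (1 - w) ^ n - f w * (of_nat n * (1 - w) ^ m * (- 1))) / ((1 - w) ^ n * (1 - w) ^ n)) (at w)"
    by (rule derivative_eq_intros assms(1) refl)+ (use assms in \<open>auto simp: Suc\<close>)
  moreover have "(f' * (1 - w) ^ n - f w * (of_nat n * (1 - w) ^ m * (- 1))) / ((1 - w) ^ n * (1 - w) ^ n)
     = (f' * (1 - w) + of_nat n * f w) / (1 - w) ^ Suc n"
    using assms(2) by (simp add: Suc divide_simps) (simp add: algebra_simps)
  ultimately show ?thesis by simp
qed

lemma polylog_neg_Suc: "k < 5 \<Longrightarrow> polylog_neg (Suc k) w = w * polylog_neg' k w"
  by (simp add: polylog_neg_def polylog_neg'_def)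

lemma DERIV_polylog_neg:
  assumes "k < 5" "w \<noteq> 1"
  shows "(polylog_neg k has_field_derivative polylog_neg' k w) (at w)"
proof -
  have w: "1 - w \<noteq> 0" using assms by simp
  have *: "(f has_field_derivative d) (at w)"
    if "\<And>w. f w = g w / (1 - w) ^ n" "(g has_field_derivative g') (at w)"
      "(g' * (1 - w) + of_nat n * g w) / (1 - w) ^ Suc n = d" for f g g' n d
    using DERIV_power_quotient[OF that(2) assms(2), of n] that(3) by (simp add: that(1)[abs_def])
  consider "k = 0" | "k = 1" | "k = 2" | "k = 3" | "k = 4" using assms by linarith
  then show ?thesis
  proof cases
    case 1
    show ?thesis by (rule *[where g = "\<lambda>w. w" and n = 1])
      (use w in \<open>auto simp: 1 polylog_neg_def polylog_neg'_def eval_nat_numeral algebra_simps intro!: derivative_eq_intros\<close>)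
  next
    case 2
    show ?thesis by (rule *[where g = "\<lambda>w. w" and n = 2])
      (use w in \<open>auto simp: 2 polylog_neg_def polylog_neg'_def eval_nat_numeral algebra_simps intro!: derivative_eq_intros\<close>)
  next
    case 3
    show ?thesis by (rule *[where g = "\<lambda>w. w * (1 + w)" and n = 3 and g' = "1 + 2 * w"])
      (use w in \<open>auto simp: 3 polylog_neg_def polylog_neg'_def eval_nat_numeral algebra_simps intro!: derivative_eq_intros\<close>)
  next
    case 4
    show ?thesis by (rule *[where g = "\<lambda>w. w * (1 + 4*w + w^2)" and n = 4 and g' = "1 + 8 * w + 3 * w^2"])
      (use w in \<open>auto simp: 4 polylog_neg_def polylog_neg'_def eval_nat_numeral algebra_simps intro!: derivative_eq_intros\<close>)
  next
    case 5
    show ?thesis by (rule *[where g = "\<lambda>w. w * (1 + 11*w + 11*w^2 + w^3)" and n = 5 and g' = "1 + 22 * w + 33 * w^2 + 4 * w^3"])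
      (use w in \<open>auto simp: 5 polylog_neg_def polylog_neg'_def eval_nat_numeral algebra_simps intro!: derivative_eq_intros\<close>)
  qed
qed

text \<open>X d/dX carries the power series for k to the one for k + 1. The constant coefficient is
  set to 0 because 0^0 = 1 would otherwise add a term at k = 0.\<close>

lemma polylog_neg_sums:
  assumes "k \<le> 5" "norm w < 1"
  shows "(\<lambda>r. of_nat (Suc r) ^ k * w ^ Suc r) sums polylog_neg k w"
    and "summable (\<lambda>r. norm (of_nat (Suc r) ^ k * w ^ Suc r))"
proof -
  define F where "F = (\<lambda>k. Abs_fps (\<lambda>n. if n = 0 then 0 else of_nat n ^ k) :: complex fps)"
  have R: "fps_conv_radius (F k) \<ge> 1" for k
    unfolding fps_conv_radius_def
  proof (rule conv_radius_geI_ex')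
    fix r :: real assume r: "0 < r" "ereal r < 1"
    have s: "summable (\<lambda>n. real n ^ k * r ^ n)" by (rule summable_power_mult_power[OF r])
    show "summable (\<lambda>n. fps_nth (F k) n * of_real r ^ n)"
      by (rule summable_comparison_test'[OF s]) (use r in \<open>auto simp: F_def norm_mult norm_power\<close>)
  qed
  have ev: "eval_fps (F k) w = polylog_neg k w" if "k \<le> 5" "norm w < 1" for k w
    using that
  proof (induction k arbitrary: w)
    case 0
    have "(\<lambda>n. w * w ^ n) sums (w * (1 / (1 - w)))" by (intro sums_mult geometric_sums 0)
    then have "(\<lambda>n. fps_nth (F 0) (Suc n) * w ^ Suc n) sums (w / (1 - w))" by (simp add: F_def)
    then have "(\<lambda>n. fps_nth (F 0) n * w ^ n) sums (w / (1 - w) + fps_nth (F 0) 0 * w ^ 0)"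
      by (subst (asm) sums_Suc_iff) simp
    then show ?case by (simp add: eval_fps_def sums_iff polylog_neg_def F_def)
  next
    case (Suc k)
    have w1: "w \<noteq> 1" using Suc.prems by auto
    have "F (Suc k) = fps_X * fps_deriv (F k)"
    proof (rule fps_ext)
      fix n show "fps_nth (F (Suc k)) n = fps_nth (fps_X * fps_deriv (F k)) n"
        by (cases n) (auto simp: F_def)
    qed
    moreover have "fps_conv_radius (fps_deriv (F k)) \<ge> 1"
      using order_trans[OF R fps_conv_radius_deriv] .
    ultimately have "eval_fps (F (Suc k)) w = w * eval_fps (fps_deriv (F k)) w"
      using Suc.prems by (simp add: eval_fps_mult less_conv_radius)
    moreover have "eval_fps (fps_deriv (F k)) w = polylog_neg' k w"
    proof (rule DERIV_unique)
      have "(eval_fps (F k) has_field_derivative eval_fps (fps_deriv (F k)) w) (at w)"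
        by (rule has_field_derivative_eval_fps) (intro less_conv_radius Suc.prems R)
      then show "(polylog_neg k has_field_derivative eval_fps (fps_deriv (F k)) w) (at w)"
        by (rule has_field_derivative_transform_within_open[of _ _ _ "ball 0 1"]) (use Suc in auto)
      show "(polylog_neg k has_field_derivative polylog_neg' k w) (at w)"
        using DERIV_polylog_neg w1 Suc.prems by simp
    qed
    ultimately show ?case using Suc.prems by (simp add: polylog_neg_Suc)
  qed
  have n: "summable (\<lambda>n. norm (fps_nth (F k) n * w ^ n))"
    by (rule norm_summable_fps) (intro less_conv_radius assms R)
  then show "summable (\<lambda>r. norm (of_nat (Suc r) ^ k * w ^ Suc r))"
    by (subst (asm) summable_Suc_iff[symmetric]) (simp add: F_def del: power_Suc of_nat_Suc)
  have "(\<lambda>n. fps_nth (F k) n * w ^ n) sums polylog_neg k w"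
    using summable_sums[OF summable_norm_cancel[OF n]] ev[OF assms] by (simp add: eval_fps_def)
  then have "(\<lambda>n. fps_nth (F k) n * w ^ n) sums (polylog_neg k w + fps_nth (F k) 0 * w ^ 0)"
    by (simp add: F_def)
  then have "(\<lambda>n. fps_nth (F k) (Suc n) * w ^ Suc n) sums polylog_neg k w"
    by (rule sums_Suc_iff[THEN iffD2])
  then show "(\<lambda>r. of_nat (Suc r) ^ k * w ^ Suc r) sums polylog_neg k w"
    by (simp add: F_def del: power_Suc of_nat_Suc)
qed

text \<open>Derivative of the reflection formula for \<open>rGamma\<close>, which is entire, divided
  by the nonzero product \<open>rGamma z * rGamma (1 - z)\<close>.\<close>

lemma Digamma_reflection:
  assumes z: "z \<notin> \<int>"
  shows "Digamma (1 - z) - Digamma z = of_real pi * cos (of_real pi * z) / sin (of_real pi * (z::complex))"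
proof -
  have z1: "1 - z \<notin> \<int>" using z Ints_diff[of 1 "1 - z"] by auto
  then have nz: "z \<notin> \<int>\<^sub>\<le>\<^sub>0" "1 - z \<notin> \<int>\<^sub>\<le>\<^sub>0" using z by (auto dest: nonpos_Ints_Int)
  let ?r = "\<lambda>z. rGamma z * rGamma (1 - z :: complex)"
  have "(?r has_field_derivative ?r z * (Digamma (1 - z) - Digamma z)) (at z)"
    using nz by (auto intro!: derivative_eq_intros simp: algebra_simps)
  moreover have "(?r has_field_derivative cos (of_real pi * z)) (at z)"
    unfolding rGamma_reflection_complex by (auto intro!: derivative_eq_intros)
  ultimately have "?r z * (Digamma (1 - z) - Digamma z) = cos (of_real pi * z)" by (rule DERIV_unique)
  moreover have "?r z \<noteq> 0" using nz by (simp add: rGamma_eq_zero_iff)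
  ultimately show ?thesis by (simp add: rGamma_reflection_complex field_simps)
qed

lemma nome_eq_1_iff: "nome z = 1 \<longleftrightarrow> z \<in> \<int>"
proof
  assume "nome z = 1"
  then obtain n :: int where "2 * of_real pi * \<i> * z = of_real (2 * of_int n * pi) * \<i>"
    unfolding nome_def exp_eq_1 by (auto simp: complex_eq_iff)
  then have "2 * of_real pi * \<i> * z = 2 * of_real pi * \<i> * of_int n" by simp
  then have "z = of_int n" by simp
  then show "z \<in> \<int>" by simp
next
  assume "z \<in> \<int>"
  then obtain n where "z = of_int n" by (auto elim: Ints_cases)
  then show "nome z = 1" unfolding nome_def exp_eq_1 by auto
qed

text \<open>In w = nome z, the function -pi cot(pi z) is 2 pi i w/(1 - w) + pi i, which is the case
  k = 0. A derivative in z acts as 2 pi i w d/dw, the step from \<open>polylog_neg k\<close> to the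
  next index, and removes the constant pi i.\<close>

lemma Polygamma_reflection:
  assumes "k \<le> 5" and z: "z \<notin> \<int>"
  shows "Polygamma k z - (-1) ^ k * Polygamma k (1 - z)
    = (2 * pi * \<i>) ^ Suc k * polylog_neg k (nome z) + (if k = 0 then pi * \<i> else 0)"
  using assms
proof (induction k arbitrary: z)
  case 0
  let ?e = "exp (\<i> * (of_real pi * z))"
  have e: "nome z = ?e * ?e" by (simp add: nome_def mult_exp_exp algebra_simps)
  have nz: "1 - nome z \<noteq> 0" using nome_eq_1_iff[of z] 0 by simp
  have "?e \<noteq> 0" by simp
  have c: "cos (of_real pi * z) = (?e + 1 / ?e) / 2" "sin (of_real pi * z) = (?e - 1 / ?e) / (2 * \<i>)"
    by (simp_all add: cos_exp_eq sin_exp_eq exp_minus inverse_eq_divide)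
  have "of_real pi * cos (of_real pi * z) / sin (of_real pi * z) = - (pi * \<i> * (1 + nome z) / (1 - nome z))"
  proof -
    have "(e + 1 / e) / 2 / ((e - 1 / e) / (2 * \<i>)) = - (\<i> * (1 + e * e) / (1 - e * e))"
      if "e \<noteq> 0" "1 - e * e \<noteq> 0" for e :: complex
    proof -
      have "e * e - 1 \<noteq> 0" using that by simp
      have "x / 2 / (y / (2 * \<i>)) = \<i> * (e * x) / (e * y)" for x y
        using that(1) by (cases "y = 0") (simp_all add: field_simps)
      from this[of "e + 1 / e" "e - 1 / e"]
      have "(e + 1 / e) / 2 / ((e - 1 / e) / (2 * \<i>)) = \<i> * (e * e + 1) / (e * e - 1)"
        using that(1) by (simp add: ring_distribs)
      also have "\<dots> = - (\<i> * (1 + e * e) / (1 - e * e))"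
        using that(2) \<open>e * e - 1 \<noteq> 0\<close> by (simp add: divide_simps) (simp add: algebra_simps)
      finally show ?thesis .
    qed
    from this[of ?e] show ?thesis using nz \<open>?e \<noteq> 0\<close> unfolding c e times_divide_eq_right[symmetric] by simp
  qed
  also have "\<dots> = - (2 * pi * \<i> * (nome z / (1 - nome z)) + pi * \<i>)"
    using nz by (simp add: field_simps)
  finally have "Digamma (1 - z) - Digamma z = - (2 * pi * \<i> * (nome z / (1 - nome z)) + pi * \<i>)"
    using Digamma_reflection[OF 0(2)] by simp
  then have "Digamma z - Digamma (1 - z) = 2 * pi * \<i> * (nome z / (1 - nome z)) + pi * \<i>"
    by (metis minus_diff_eq minus_minus)
  then show ?case by (simp add: polylog_neg_def)
next
  case (Suc k)
  have op: "open (- \<int> :: complex set)" using closed_Ints by (simp add: open_Compl)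
  have z1: "1 - z \<notin> \<int>" using Suc.prems Ints_diff[of 1 "1 - z"] by auto
  then have nz: "z \<notin> \<int>\<^sub>\<le>\<^sub>0" "1 - z \<notin> \<int>\<^sub>\<le>\<^sub>0" using Suc.prems by (auto dest: nonpos_Ints_Int)
  have "((\<lambda>z. Polygamma k z - (-1) ^ k * Polygamma k (1 - z)) has_field_derivative
      Polygamma (Suc k) z - (-1) ^ Suc k * Polygamma (Suc k) (1 - z)) (at z)"
    using nz by (auto intro!: derivative_eq_intros)
  moreover have "((\<lambda>z. Polygamma k z - (-1) ^ k * Polygamma k (1 - z)) has_field_derivative
      (2 * pi * \<i>) ^ Suc (Suc k) * polylog_neg (Suc k) (nome z)) (at z)"
  proof (rule has_field_derivative_transform_within_open[OF _ op])
    have "nome z \<noteq> 1" using nome_eq_1_iff Suc.prems by simp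
    then have "((\<lambda>z. polylog_neg k (nome z)) has_field_derivative polylog_neg' k (nome z) * (2 * pi * \<i> * nome z)) (at z)"
      using Suc.prems by (intro DERIV_chain2[OF DERIV_polylog_neg DERIV_nome]) auto
    from DERIV_add[OF DERIV_cmult[OF this, of "(2 * pi * \<i>) ^ Suc k"] DERIV_const[of "if k = 0 then pi * \<i> else 0"]]
    show "((\<lambda>z. (2 * pi * \<i>) ^ Suc k * polylog_neg k (nome z) + (if k = 0 then pi * \<i> else 0)) has_field_derivative
      (2 * pi * \<i>) ^ Suc (Suc k) * polylog_neg (Suc k) (nome z)) (at z)"
      using Suc.prems by (simp add: polylog_neg_Suc algebra_simps)
  qed (use Suc in auto)
  ultimately show ?case by (simp add: DERIV_unique)
qed

lemma summable_norm_inverse_shifted_power: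
  fixes z :: complex
  assumes "p \<ge> 2"
  shows "summable (\<lambda>n. norm (inverse ((z + of_nat n) ^ p)))"
proof (rule summable_comparison_test_ev)
  show "summable (\<lambda>n. 4 * inverse (real n ^ 2))"
    by (intro summable_mult inverse_power_summable) auto
  show "\<forall>\<^sub>F n in sequentially. norm (norm (inverse ((z + of_nat n) ^ p))) \<le> 4 * inverse (real n ^ 2)"
    using eventually_ge_at_top[of "nat \<lceil>2 * norm z + 2\<rceil>"]
  proof eventually_elim
    case (elim n)
    then have n: "real n \<ge> 2 * norm z + 2" by linarith
    have "real n \<le> norm (z + of_nat n) + norm z"
      using norm_triangle_ineq4[of "z + of_nat n" z] by simp
    then have 1: "norm (z + of_nat n) \<ge> real n / 2" "norm (z + of_nat n) \<ge> 1" using n norm_ge_zero[of z] by linarith+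
    have "(real n / 2) ^ 2 \<le> norm (z + of_nat n) ^ 2" using 1 by (intro power_mono) auto
    also have "\<dots> \<le> norm (z + of_nat n) ^ p" using 1 assms by (intro power_increasing) auto
    finally have "inverse (norm (z + of_nat n) ^ p) \<le> inverse ((real n / 2) ^ 2)"
      using n norm_ge_zero[of z] by (intro le_imp_inverse_le) (auto simp del: norm_ge_zero)
    then show ?case by (simp add: norm_inverse norm_power norm_divide power_divide inverse_eq_divide)
  qed
qed

lemma has_sum_int_split:
  fixes f :: "int \<Rightarrow> complex"
  assumes "((\<lambda>n::nat. f (int n)) has_sum a) UNIV" "((\<lambda>n::nat. f (- 1 - int n)) has_sum b) UNIV"
  shows "(f has_sum (a + b)) UNIV"
proof -
  have "(f has_sum a) (range int)"
    using assms(1) by (subst has_sum_reindex) (auto simp: o_def)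
  moreover have "(f has_sum b) (range (\<lambda>n. - 1 - int n))"
    using assms(2) by (subst has_sum_reindex) (auto simp: o_def inj_on_def)
  ultimately have "(f has_sum (a + b)) (range int \<union> range (\<lambda>n. - 1 - int n))"
    by (rule has_sum_Un_disjoint) auto
  moreover have "range int \<union> range (\<lambda>n. - 1 - int n) = UNIV"
  proof (intro equalityI subsetI UNIV_I)
    fix x :: int
    show "x \<in> range int \<union> range (\<lambda>n. - 1 - int n)"
    proof (cases "x \<ge> 0")
      case True then have "x = int (nat x)" by simp
      then show ?thesis by blast
    next
      case False then have "x = - 1 - int (nat (- 1 - x))" by simp
      then show ?thesis by blast
    qed
  qed
  ultimately show ?thesis by simp
qed

lemma Polygamma_has_sum:
  fixes z :: complex
  assumes "z \<noteq> 0" "k \<ge> 1"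
  shows "((\<lambda>n::nat. inverse ((z + of_nat n) ^ Suc k)) has_sum ((-1) ^ Suc k * Polygamma k z / fact k)) (UNIV :: nat set)"
  using assms by (intro norm_summable_imp_has_sum summable_norm_inverse_shifted_power Polygamma_LIMSEQ) auto

text \<open>The two halves of the sum over the integers are polygamma series at z and at 1 - z. For
  odd k the exponent k + 1 is even, and they combine into the left side of the reflection
  formula.\<close>

lemma lipschitz_formula:
  fixes z :: complex
  assumes z: "z \<notin> \<int>" and k: "odd k" "k \<le> 5"
  shows "((\<lambda>n::int. inverse ((z + of_int n) ^ Suc k)) has_sum
     ((2 * pi * \<i>) ^ Suc k / fact k * polylog_neg k (nome z))) UNIV"
proof -
  have z0: "z \<noteq> 0" "1 - z \<noteq> 0" using z by auto
  have k1: "k \<ge> 1" using k by (cases k) auto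
  have "((\<lambda>n::nat. inverse ((z + of_int (- 1 - int n)) ^ Suc k)) has_sum ((-1) ^ Suc k * Polygamma k (1 - z) / fact k)) (UNIV :: nat set)"
  proof -
    have "(z + of_int (- 1 - int n)) ^ Suc k = (1 - z + of_nat n) ^ Suc k" for n
      using power_minus_even[of "Suc k" "1 - z + of_nat n"] k(1) by (simp add: algebra_simps del: power_Suc)
    then show ?thesis using Polygamma_has_sum[OF z0(2) k1] by simp
  qed
  moreover have "((\<lambda>n::nat. inverse ((z + of_int (int n)) ^ Suc k)) has_sum ((-1) ^ Suc k * Polygamma k z / fact k)) (UNIV :: nat set)"
    using Polygamma_has_sum[OF z0(1) k1] by simp
  ultimately have "((\<lambda>n::int. inverse ((z + of_int n) ^ Suc k)) has_sum
     ((-1) ^ Suc k * Polygamma k z / fact k + (-1) ^ Suc k * Polygamma k (1 - z) / fact k)) UNIV"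
    by (intro has_sum_int_split)
  moreover have "(-1) ^ Suc k * Polygamma k z / fact k + (-1) ^ Suc k * Polygamma k (1 - z) / fact k
     = (2 * pi * \<i>) ^ Suc k / fact k * polylog_neg k (nome z)"
    using Polygamma_reflection[OF k(2) z] k k1 by (simp add: field_simps)
  ultimately show ?thesis by simp
qed

lemma half_notin_Ints: "(1/2 :: complex) \<notin> \<int>"
  using fraction_not_in_Ints[where 'a = complex, of 2 1] by simp

text \<open>Splitting the zeta series into odd and even terms gives (2^(k+1) - 1) zeta(k+1) =
  Polygamma k (1/2) / k!, and reflection at the fixed point z = 1/2, where the nome is -1, evaluates
  the right side.\<close>

lemma zeta_even_aux:
  assumes k: "odd k" "k \<le> 5" "k \<ge> 1"
  shows "((\<lambda>n. inverse (of_nat (Suc n) ^ Suc k)) has_sum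
      ((2 * pi * \<i>) ^ Suc k / fact k * polylog_neg k (- 1) / (2 * (2 ^ Suc k - 1)))) (UNIV :: nat set)"
proof -
  let ?H = "(\<lambda>n. inverse ((1/2 + of_nat n :: complex) ^ Suc k))" and ?z = "(\<lambda>n. inverse (of_nat (Suc n) ^ Suc k) :: complex)"
  have n1: "nome (1/2) = - 1"
  proof -
    have "nome (1/2) = exp (\<i> * of_real pi)" by (simp add: nome_def mult.commute)
    then show ?thesis by (simp add: exp_pi_i')
  qed
  have H: "?H sums ((-1) ^ Suc k * Polygamma k (1/2) / fact k)"
    using k by (intro Polygamma_LIMSEQ) auto
  have P: "Polygamma k (1/2 :: complex) = (2 * pi * \<i>) ^ Suc k * polylog_neg k (- 1) / 2"
    using Polygamma_reflection[OF k(2) half_notin_Ints] k n1 by (simp add: field_simps)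
  have sz: "summable (\<lambda>n. norm (?z n))"
    using summable_norm_inverse_shifted_power[of "Suc k" 1] k by (simp add: add.commute)
  have z: "?z sums suminf ?z" using summable_norm_cancel[OF sz] by (rule summable_sums)
  have G: "(\<lambda>n. sum ?z {n * 2..<n * 2 + 2}) sums suminf ?z"
    by (rule sums_group[OF z]) auto
  have G': "sum ?z {n * 2..<n * 2 + 2} = inverse (2 ^ Suc k) * (?H n + ?z n)" for n
  proof -
    have "{n * 2..<n * 2 + 2} = {n * 2, Suc (n * 2)}" by auto
    then have S: "sum ?z {n * 2..<n * 2 + 2}
      = inverse (of_nat (Suc (n * 2)) ^ Suc k) + inverse (of_nat (Suc (Suc (n * 2))) ^ Suc k)" by simp
    have 1: "of_nat (Suc (n * 2)) = 2 * (1/2 + of_nat n :: complex)" by simp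
    have 2: "of_nat (Suc (Suc (n * 2))) = (2 * of_nat (Suc n) :: complex)" by simp
    show ?thesis unfolding S 1 2 power_mult_distrib inverse_mult_distrib by (rule distrib_left[symmetric])
  qed
  have "(\<lambda>n. inverse (2 ^ Suc k) * (?H n + ?z n)) sums suminf ?z" using G unfolding G' .
  moreover have "(\<lambda>n. inverse (2 ^ Suc k) * (?H n + ?z n)) sums
      (inverse (2 ^ Suc k) * ((-1) ^ Suc k * Polygamma k (1/2) / fact k + suminf ?z))"
    by (intro sums_mult sums_add H z)
  ultimately have "suminf ?z = inverse (2 ^ Suc k) * ((-1) ^ Suc k * Polygamma k (1/2) / fact k + suminf ?z)"
    by (rule sums_unique2)
  then have "2 ^ Suc k * suminf ?z = Polygamma k (1/2) / fact k + suminf ?z"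
    using k by (simp add: field_simps)
  then have *: "suminf ?z * (2 ^ Suc k - 1) = Polygamma k (1/2) / fact k" by (simp add: algebra_simps)
  have "(2::complex) ^ Suc k - 1 \<noteq> 0"
  proof -
    have "norm ((2::complex) ^ Suc k) \<noteq> 1" 
      using one_less_power[of "2::real" "Suc k"] unfolding norm_power norm_numeral by linarith
    then have "(2::complex) ^ Suc k \<noteq> 1" by (metis norm_one)
    then show ?thesis by (simp del: power_Suc)
  qed
  then have S: "suminf ?z = Polygamma k (1/2) / fact k / (2 ^ Suc k - 1)"
    using * by (metis nonzero_mult_div_cancel_right)
  have r: "x * y / 2 / f / t = x / f * y / (2 * t)" for x y f t :: complex
    by (simp add: mult_ac)
  have "?z sums ((2 * pi * \<i>) ^ Suc k / fact k * polylog_neg k (- 1) / (2 * (2 ^ Suc k - 1)))"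
    using z unfolding S P r .
  then show ?thesis by (intro norm_summable_imp_has_sum sz)
qed

lemma i_power_even: "\<i> ^ 4 = 1" "\<i> ^ 6 = - 1"
  by (simp_all add: eval_nat_numeral)

lemma zeta_4: "((\<lambda>n. inverse (of_nat (Suc n) ^ 4)) has_sum (of_real pi ^ 4 / 90 :: complex)) UNIV"
  and zeta_6: "((\<lambda>n. inverse (of_nat (Suc n) ^ 6)) has_sum (of_real pi ^ 6 / 945 :: complex)) UNIV"
  using zeta_even_aux[of 3] zeta_even_aux[of 5]
  by (simp_all add: polylog_neg_def fact_numeral power_mult_distrib i_power_even of_nat_Suc[of 0] del: of_nat_Suc)

abbreviation norm_summable_on :: "('a \<Rightarrow> 'b::real_normed_vector) \<Rightarrow> 'a set \<Rightarrow> bool" (infix "norm'_summable'_on" 50) where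
  "f norm_summable_on A \<equiv> (\<lambda>x. norm (f x)) summable_on A"

lemma infsum_int_even:
  fixes f :: "int \<Rightarrow> complex"
  assumes "f summable_on UNIV" "\<And>n. f (- n) = f n"
  shows "infsum f UNIV = f 0 + 2 * infsum (\<lambda>n. f (int n)) {1..}"
proof -
  have s: "f summable_on A" for A using summable_on_subset_banach[OF assms(1)] by auto
  have "bij_betw int {1..} {1..}"
  proof (rule bij_betwI[where g = nat]) qed auto
  then have 1: "infsum (\<lambda>n. f (int n)) {1..} = infsum f {1..}" by (rule infsum_reindex_bij_betw)
  have "bij_betw (\<lambda>n. - int n) {1..} {..-1}"
  proof (rule bij_betwI[where g = "\<lambda>n. nat (- n)"]) qed auto
  then have "infsum (\<lambda>n. f (- int n)) {1..} = infsum f {..-1}" by (rule infsum_reindex_bij_betw)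
  then have 2: "infsum f {..-1} = infsum f {1..}" using 1 assms(2) by simp
  have U: "(UNIV :: int set) = ({0} \<union> {1..}) \<union> {..-1}" by auto
  have "infsum f UNIV = infsum f ({0} \<union> {1..}) + infsum f {..-1}"
    unfolding U by (rule infsum_Un_disjoint) (auto intro: s)
  also have "infsum f ({0} \<union> {1..}) = infsum f {0} + infsum f {1..}"
    by (rule infsum_Un_disjoint) (auto intro: s)
  finally show ?thesis using 1 2 by simp
qed

text \<open>Expanding each term gives a double sum over (m, r), and grouping by N = m r collects r^k
  over the divisors r of N. Absolute summability is checked after grouping, where the inner sums are
  finite.\<close>

lemma lambert_series:
  fixes w :: complex
  assumes w: "norm w < 1" and k: "k \<le> 5"
  shows "infsum (\<lambda>m. polylog_neg k (w ^ m)) {1..} = (\<Sum>n. of_nat (sigma_pow k (Suc n)) * w ^ Suc n)"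
proof -
  let ?D = "Sigma {1::nat..} (\<lambda>N. {d. d dvd N})"
  let ?h = "\<lambda>(m,r). of_nat r ^ k * w ^ (m * r) :: complex" and ?g = "\<lambda>(N,d). of_nat d ^ k * w ^ N :: complex"
  have fin: "finite {d. d dvd N}" if "N \<in> {1..}" for N :: nat using that by simp
  have bij: "bij_betw (\<lambda>(N,d). (N div d, d)) ?D ({1..} \<times> {1..})"
    by (rule bij_betwI[where g = "\<lambda>(m,r). (m * r, r)"])
       (auto simp: Suc_le_eq dest: dvd_pos_nat elim!: dvdE intro!: Nat.gr0I)
  have sigma_norm: "(\<lambda>n. of_nat (sigma_pow k n) * w ^ n) norm_summable_on UNIV"
  proof -
    have "summable (\<lambda>n. norm (fps_nth (sigma_fps k) n * w ^ n))"
      by (rule norm_summable_fps) (intro less_conv_radius w conv_radius_sigma_fps)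
    then show ?thesis by (intro summable_nonneg_imp_summable_on) simp_all
  qed
  have "?g norm_summable_on ?D"
    unfolding Infinite_Sum.abs_summable_on_Sigma_iff
  proof (intro conjI ballI)
    fix N :: nat assume N: "N \<in> {1..}"
    show "(\<lambda>d. ?g (N, d)) norm_summable_on {d. d dvd N}" using fin[OF N] by simp
  next
    have "(\<Sum>\<^sub>\<infinity>d\<in>{d. d dvd N}. norm (?g (N, d))) = norm (of_nat (sigma_pow k N) * w ^ N)" if "N \<in> {1..}" for N
    proof -
      have "(\<Sum>\<^sub>\<infinity>d\<in>{d. d dvd N}. norm (?g (N, d))) = (\<Sum>d\<in>{d. d dvd N}. real d ^ k * norm w ^ N)"
        using fin[OF that] by (simp add: norm_mult norm_power)
      also have "\<dots> = real (sigma_pow k N) * norm w ^ N" by (simp add: sigma_pow_def sum_distrib_right)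
      finally show ?thesis by (simp add: norm_mult norm_power)
    qed
    moreover have "(\<lambda>N. norm (of_nat (sigma_pow k N) * w ^ N)) summable_on {1..}"
      using summable_on_subset_banach[OF sigma_norm] by auto
    ultimately show "(\<lambda>N. \<Sum>\<^sub>\<infinity>d\<in>{d. d dvd N}. norm (?g (N, d))) norm_summable_on {1..}"
      by (subst summable_on_cong[where g = "\<lambda>N. norm (of_nat (sigma_pow k N) * w ^ N)"]) auto
  qed
  then have sg: "?g summable_on ?D" by (rule abs_summable_summable)
  have gh: "?h ((\<lambda>(N,d). (N div d, d)) p) = ?g p" if "p \<in> ?D" for p
    using that by (auto simp: dvd_div_mult_self)
  have "(\<lambda>p. ?h ((\<lambda>(N,d). (N div d, d)) p)) summable_on ?D"
    using sg by (subst summable_on_cong[OF gh]) auto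
  then have sh: "?h summable_on {1..} \<times> {1..}" by (subst (asm) summable_on_reindex_bij_betw[OF bij])
  have row: "infsum (\<lambda>r. ?h (m, r)) {1..} = polylog_neg k (w ^ m)" if m: "m \<in> {1..}" for m
  proof -
    have "norm (w ^ m) < 1" using w m by (simp add: norm_power power_less_one_iff)
    from norm_summable_imp_has_sum[OF polylog_neg_sums(2,1)[OF k this]]
    have "((\<lambda>r. of_nat (Suc r) ^ k * (w ^ m) ^ Suc r) has_sum polylog_neg k (w ^ m)) UNIV" .
    moreover have "bij_betw Suc UNIV {1..}"
      by (rule bij_betwI[where g = "\<lambda>n. n - 1"]) auto
    ultimately have "((\<lambda>r. of_nat r ^ k * (w ^ m) ^ r) has_sum polylog_neg k (w ^ m)) {1..}"
      using has_sum_reindex_bij_betw[of Suc UNIV "{1..}" "\<lambda>r. of_nat r ^ k * (w ^ m) ^ r"] by simp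
    then show ?thesis by (simp add: infsumI power_mult)
  qed
  have "infsum (\<lambda>m. polylog_neg k (w ^ m)) {1..} = infsum (\<lambda>m. infsum (\<lambda>r. ?h (m, r)) {1..}) {1..}"
    by (rule infsum_cong) (rule row[symmetric])
  also have "\<dots> = infsum ?h ({1..} \<times> {1..})" using infsum_Sigma_banach[OF sh] .
  also have "\<dots> = infsum (\<lambda>p. ?h ((\<lambda>(N,d). (N div d, d)) p)) ?D" using infsum_reindex_bij_betw[OF bij, of ?h] by simp
  also have "\<dots> = infsum ?g ?D" by (rule infsum_cong) (rule gh)
  also have "\<dots> = infsum (\<lambda>N. infsum (\<lambda>d. ?g (N, d)) {d. d dvd N}) {1..}"
    using infsum_Sigma_banach[OF sg] by simp
  also have "\<dots> = infsum (\<lambda>N. of_nat (sigma_pow k N) * w ^ N) {1..}"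
    by (rule infsum_cong) (use fin in \<open>auto simp: sigma_pow_def sum_distrib_right\<close>)
  also have "\<dots> = infsum (\<lambda>N. of_nat (sigma_pow k (Suc N)) * w ^ (Suc N)) UNIV"
  proof -
    have "bij_betw Suc UNIV {1..}"
      by (rule bij_betwI[where g = "\<lambda>n. n - 1"]) auto
    from infsum_reindex_bij_betw[OF this, of "\<lambda>N. of_nat (sigma_pow k N) * w ^ N"] show ?thesis by simp
  qed
  also have "\<dots> = (\<Sum>n. of_nat (sigma_pow k (Suc n)) * w ^ Suc n)"
  proof -
    have "(\<lambda>n. of_nat (sigma_pow k (Suc n)) * w ^ Suc n) summable_on UNIV"
    proof -
      have "(\<lambda>n. of_nat (sigma_pow k n) * w ^ n) summable_on range Suc"
        by (rule summable_on_subset_banach[OF abs_summable_summable[OF sigma_norm]]) auto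
      then show ?thesis by (subst (asm) summable_on_reindex) (simp_all add: o_def)
    qed
    from has_sum_imp_sums[OF has_sum_infsum[OF this]] show ?thesis by (simp only: sums_iff)
  qed
  finally show ?thesis .
qed

section \<open>Lattice sums and the modular invariance of \<open>modJ\<close>\<close>

definition lattice :: "(int \<times> int) set" where "lattice = UNIV - {(0, 0)}"

definition eisenstein_G :: "nat \<Rightarrow> complex \<Rightarrow> complex" where
  "eisenstein_G p z = infsum (\<lambda>(m,n). inverse ((of_int m * z + of_int n) ^ p)) lattice"

lemma summable_on_int_inverse_squares: "(\<lambda>n::int. inverse (1 + real_of_int n ^ 2)) summable_on UNIV"
proof -
  have s: "(\<lambda>n::nat. inverse (real (Suc n) ^ 2)) summable_on UNIV"
  proof (rule summable_nonneg_imp_summable_on)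
    show "summable (\<lambda>n. inverse (real (Suc n) ^ 2))"
      using inverse_power_summable[of 2, where 'a = real] by (subst summable_Suc_iff) simp
  qed simp
  have *: "(\<lambda>n::nat. inverse (1 + real n ^ 2)) norm_summable_on UNIV"
  proof (rule Infinite_Sum.abs_summable_on_comparison_test[where g = "\<lambda>n. 2 * inverse (real (Suc n) ^ 2)"])
    show "(\<lambda>n::nat. 2 * inverse (real (Suc n) ^ 2)) norm_summable_on UNIV"
      using summable_on_cmult_right[OF s, of 2] by (simp add: del: of_nat_Suc)
    fix n :: nat
    have "(1 + real n) ^ 2 \<le> 2 * (1 + real n ^ 2)"
      using zero_le_power2[of "real n - 1"] by (simp add: power2_eq_square algebra_simps)
    then have i: "inverse (2 * (1 + real n ^ 2)) \<le> inverse ((1 + real n) ^ 2)" by (intro le_imp_inverse_le) auto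
    have "inverse (1 + real n ^ 2) = 2 * inverse (2 * (1 + real n ^ 2))" by (subst inverse_mult_distrib) simp
    also have "\<dots> \<le> 2 * inverse ((1 + real n) ^ 2)" using i by (intro mult_left_mono) auto
    finally show "norm (inverse (1 + real n ^ 2)) \<le> norm (2 * inverse (real (Suc n) ^ 2))"
      by (simp add: add_nonneg_nonneg)
  qed
  then have s1: "(\<lambda>n::nat. inverse (1 + real n ^ 2)) summable_on UNIV" by (rule abs_summable_summable)
  have "(\<lambda>n::int. inverse (1 + real_of_int n ^ 2)) summable_on (range int \<union> range (\<lambda>n. - int n))"
  proof -
    have "(\<lambda>n::int. inverse (1 + real_of_int n ^ 2)) summable_on range int"
      using s1 by (subst summable_on_reindex) (auto simp: o_def)
    moreover have "(\<lambda>n::int. inverse (1 + real_of_int n ^ 2)) summable_on range (\<lambda>n. - int n)"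
      using s1 by (subst summable_on_reindex) (auto simp: o_def inj_on_def)
    ultimately show ?thesis by (rule summable_on_union)
  qed
  moreover have "range int \<union> range (\<lambda>n. - int n) = UNIV"
  proof (intro equalityI subsetI UNIV_I)
    fix x :: int
    have "x = int (nat x) \<or> x = - int (nat (- x))" by linarith
    then show "x \<in> range int \<union> range (\<lambda>n. - int n)" by blast
  qed
  ultimately show ?thesis by simp
qed

text \<open>The imaginary part controls m, and n = (m z + n) - m z then controls n.\<close>

lemma norm_lattice_ge:
  assumes "Im z > 0"
  obtains C where "C > 0" "\<And>m n :: int. max \<bar>of_int m\<bar> \<bar>of_int n\<bar> \<le> C * norm (of_int m * z + of_int n)"
proof
  let ?C = "max (inverse (Im z)) (1 + norm z * inverse (Im z))"
  show "?C > 0" using assms by (simp add: less_max_iff_disj)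
  fix m n :: int
  let ?N = "norm (of_int m * z + of_int n)"
  have "\<bar>of_int m\<bar> * Im z \<le> ?N"
    using abs_Im_le_cmod[of "of_int m * z + of_int n"] assms by (simp add: abs_mult)
  then have 1: "\<bar>of_int m\<bar> \<le> inverse (Im z) * ?N" using assms by (simp add: field_simps)
  have "\<bar>of_int n\<bar> = norm (of_int m * z + of_int n - of_int m * z)" by simp
  also have "\<dots> \<le> ?N + norm (of_int m * z)" by (rule norm_triangle_ineq4)
  also have "\<dots> = ?N + \<bar>of_int m\<bar> * norm z" by (simp add: norm_mult)
  also have "\<dots> \<le> ?N + (inverse (Im z) * ?N) * norm z" using 1 by (intro add_left_mono mult_right_mono) auto
  finally have 2: "\<bar>of_int n\<bar> \<le> (1 + norm z * inverse (Im z)) * ?N" by (simp add: algebra_simps)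
  have "inverse (Im z) * ?N \<le> ?C * ?N" "(1 + norm z * inverse (Im z)) * ?N \<le> ?C * ?N"
    by (intro mult_right_mono; simp)+
  with 1 2 show "max \<bar>of_int m\<bar> \<bar>of_int n\<bar> \<le> ?C * ?N" by linarith
qed

text \<open>With M = max |m| |n| >= 1 one has (1 + m^2)(1 + n^2) <= 4 M^4, so the terms are
  dominated by a product of two convergent one-variable series.\<close>

lemma summable_on_lattice:
  assumes "Im z > 0" "p \<ge> 4"
  shows "(\<lambda>(m,n). inverse ((of_int m * z + of_int n) ^ p)) norm_summable_on lattice"
proof -
  obtain C where C: "C > 0" "\<And>m n :: int. max \<bar>of_int m\<bar> \<bar>of_int n\<bar> \<le> C * norm (of_int m * z + of_int n)"
    using norm_lattice_ge[OF assms(1)] by metis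
  let ?i = "\<lambda>n::int. inverse (1 + real_of_int n ^ 2)"
  let ?g = "\<lambda>(m,n). 4 * C ^ p * (?i m * ?i n)"
  have "(\<lambda>(m,n). ?i m * ?i n) norm_summable_on UNIV \<times> UNIV"
    unfolding Infinite_Sum.abs_summable_on_Sigma_iff using summable_on_int_inverse_squares
    by (auto simp: infsum_cmult_right' abs_mult intro!: summable_on_cmult_right summable_on_cmult_left)
  then have "(\<lambda>q. 4 * C ^ p * (\<lambda>(m,n). ?i m * ?i n) q) norm_summable_on UNIV \<times> UNIV"
    unfolding norm_mult by (rule summable_on_cmult_right)
  then have g: "?g norm_summable_on UNIV \<times> UNIV" by (simp add: case_prod_unfold)
  have "?g norm_summable_on lattice" by (rule summable_on_subset_banach[OF g]) auto
  then show ?thesis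
  proof (rule Infinite_Sum.abs_summable_on_comparison_test)
    fix q assume "q \<in> lattice"
    then obtain m n where q: "q = (m, n)" "(m, n) \<noteq> (0, 0)" by (cases q) (auto simp: lattice_def)
    define M where "M = max \<bar>real_of_int m\<bar> \<bar>real_of_int n\<bar>"
    have M1: "M \<ge> 1" using q(2) by (auto simp: M_def max_def)
    have "real_of_int m ^ 2 \<le> M ^ 2" "real_of_int n ^ 2 \<le> M ^ 2"
      by (rule iffD1[OF abs_le_square_iff], simp add: M_def)+
    moreover have "1 \<le> M ^ 2" using M1 by (rule one_le_power)
    ultimately have "1 + real_of_int m ^ 2 \<le> 2 * M ^ 2" "1 + real_of_int n ^ 2 \<le> 2 * M ^ 2" by linarith+
    then have "(1 + real_of_int m ^ 2) * (1 + real_of_int n ^ 2) \<le> (2 * M ^ 2) * (2 * M ^ 2)"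
      by (intro mult_mono) auto
    also have "\<dots> = 4 * M ^ 4" by (simp add: eval_nat_numeral)
    also have "\<dots> \<le> 4 * M ^ p" using M1 assms(2) by (intro mult_left_mono power_increasing) auto
    also have "\<dots> \<le> 4 * (C * norm (of_int m * z + of_int n)) ^ p"
      using C(2)[of m n] M1 by (intro mult_left_mono power_mono) (auto simp: M_def)
    finally have *: "(1 + real_of_int m ^ 2) * (1 + real_of_int n ^ 2) \<le> 4 * C ^ p * norm (of_int m * z + of_int n) ^ p"
      by (simp add: power_mult_distrib)
    have N: "norm (of_int m * z + of_int n) > 0" using C(2)[of m n] M1 C(1) unfolding M_def[symmetric]
      by (metis less_le_trans linorder_not_less mult_zero_right norm_ge_zero order_less_le zero_less_one)
    have pos: "(1 + real_of_int m ^ 2) * (1 + real_of_int n ^ 2) > 0" by (intro mult_pos_pos) (auto simp: add_pos_nonneg)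
    have "inverse (norm (of_int m * z + of_int n) ^ p) \<le> 4 * C ^ p * inverse ((1 + real_of_int m ^ 2) * (1 + real_of_int n ^ 2))"
      using * pos N by (simp only: inverse_eq_divide) (simp add: divide_simps mult.commute)
    then show "norm ((\<lambda>(m,n). inverse ((of_int m * z + of_int n) ^ p)) q) \<le> norm (?g q)"
      using C(1) by (simp add: q norm_inverse norm_power abs_mult)
  qed
qed

text \<open>m (a z + b) + n (c z + d) = (m a + n c) z + (m b + n d), and this substitution permutes
  the lattice.\<close>

lemma eisenstein_G_modular:
  assumes z: "Im z > 0" and det: "a * d - b * c = (1::int)"
  shows "eisenstein_G p ((of_int a * z + of_int b) / (of_int c * z + of_int d))
     = (of_int c * z + of_int d) ^ p * eisenstein_G p z"
proof -
  let ?w = "of_int c * z + of_int d"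
  have nz: "?w \<noteq> 0"
  proof
    assume 0: "?w = 0"
    then have "of_int c * Im z = 0" by (simp add: complex_eq_iff)
    then have "c = 0" using z by simp
    with 0 det show False by auto
  qed
  let ?phi = "\<lambda>(m,n). (m * a + n * c, m * b + n * d)"
  have bij: "bij_betw ?phi lattice lattice"
  proof (rule bij_betwI[where g = "\<lambda>(m,n). (m * d - n * c, n * a - m * b)"])
    have inv1: "(m * a + n * c) * d - (m * b + n * d) * c = m" "(m * b + n * d) * a - (m * a + n * c) * b = n" for m n
    proof -
      have "(m * a + n * c) * d - (m * b + n * d) * c = m * (a * d - b * c)" by algebra
      then show "(m * a + n * c) * d - (m * b + n * d) * c = m" using det by simp
      have "(m * b + n * d) * a - (m * a + n * c) * b = n * (a * d - b * c)" by algebra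
      then show "(m * b + n * d) * a - (m * a + n * c) * b = n" using det by simp
    qed
    have inv2: "(m * d - n * c) * a + (n * a - m * b) * c = m" "(m * d - n * c) * b + (n * a - m * b) * d = n" for m n
    proof -
      have "(m * d - n * c) * a + (n * a - m * b) * c = m * (a * d - b * c)" by algebra
      then show "(m * d - n * c) * a + (n * a - m * b) * c = m" using det by simp
      have "(m * d - n * c) * b + (n * a - m * b) * d = n * (a * d - b * c)" by algebra
      then show "(m * d - n * c) * b + (n * a - m * b) * d = n" using det by simp
    qed
    show "?phi \<in> lattice \<rightarrow> lattice"
    proof
      fix q assume "q \<in> lattice"
      then obtain m n where q: "q = (m, n)" "(m, n) \<noteq> (0, 0)" by (cases q) (auto simp: lattice_def)
      have "(m * a + n * c, m * b + n * d) \<noteq> (0, 0)" using inv1[of m n] q(2) by auto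
      then show "?phi q \<in> lattice" by (simp add: q(1) lattice_def)
    qed
    show "(\<lambda>(m,n). (m * d - n * c, n * a - m * b)) \<in> lattice \<rightarrow> lattice"
    proof
      fix q assume "q \<in> lattice"
      then obtain m n where q: "q = (m, n)" "(m, n) \<noteq> (0, 0)" by (cases q) (auto simp: lattice_def)
      have "(m * d - n * c, n * a - m * b) \<noteq> (0, 0)" using inv2[of m n] q(2) by auto
      then show "(\<lambda>(m,n). (m * d - n * c, n * a - m * b)) q \<in> lattice" by (simp add: q(1) lattice_def)
    qed
    fix q :: "int \<times> int"
    obtain m n where q: "q = (m, n)" by (cases q)
    show "(\<lambda>(m,n). (m * d - n * c, n * a - m * b)) (?phi q) = q" using inv1[of m n] by (simp add: q)
    show "?phi ((\<lambda>(m,n). (m * d - n * c, n * a - m * b)) q) = q" using inv2[of m n] by (simp add: q)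
  qed
  have "eisenstein_G p ((of_int a * z + of_int b) / ?w)
     = infsum (\<lambda>q. ?w ^ p * (\<lambda>(m,n). inverse ((of_int m * z + of_int n) ^ p)) (?phi q)) lattice"
    unfolding eisenstein_G_def
  proof (rule infsum_cong)
    fix q :: "int \<times> int"
    obtain m n where q: "q = (m, n)" by (cases q)
    have e: "of_int m * ((of_int a * z + of_int b) / ?w) + of_int n
       = (of_int (m * a + n * c) * z + of_int (m * b + n * d)) / ?w"
      using nz by (simp add: field_simps)
    have r: "inverse ((x / w) ^ p) = w ^ p * inverse (x ^ p)" for x w :: complex
      unfolding power_divide inverse_divide by (rule divide_inverse)
    show "(\<lambda>(m,n). inverse ((of_int m * ((of_int a * z + of_int b) / ?w) + of_int n) ^ p)) q =
      ?w ^ p * (\<lambda>(m,n). inverse ((of_int m * z + of_int n) ^ p)) (?phi q)"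
      by (simp only: q prod.case e r)
  qed
  also have "\<dots> = ?w ^ p * eisenstein_G p z"
    unfolding eisenstein_G_def infsum_cmult_right'
    by (subst infsum_reindex_bij_betw[OF bij]) simp
  finally show ?thesis .
qed

text \<open>Summation by rows: the row m = 0 gives 2 \<zeta>, rows m and -m agree because the
  exponent is even, and a row m > 0 is a Lipschitz sum at m z. Over m these form a Lambert series in
  the nome.\<close>

lemma eisenstein_G_expansion:
  assumes z: "Im z > 0" and k: "odd k" "k \<le> 5" "k \<ge> 3"
    and zeta: "((\<lambda>n. inverse (of_nat (Suc n) ^ Suc k)) has_sum \<zeta>) UNIV"
  shows "eisenstein_G (Suc k) z = 2 * \<zeta> + 2 * ((2 * pi * \<i>) ^ Suc k / fact k)
     * (\<Sum>n. of_nat (sigma_pow k (Suc n)) * nome z ^ Suc n)"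
proof -
  let ?f = "\<lambda>(m,n). inverse ((of_int m * z + of_int n) ^ Suc k)"
  let ?B = "\<lambda>m::int. if m = 0 then UNIV - {0} else UNIV :: int set"
  let ?c = "(2 * pi * \<i>) ^ Suc k / fact k"
  have L: "lattice = Sigma UNIV ?B" by (auto simp: lattice_def split: if_splits)
  have s: "?f summable_on Sigma UNIV ?B"
    using abs_summable_summable[OF summable_on_lattice[OF z, of "Suc k"]] k unfolding L by simp
  define g where "g = (\<lambda>m. infsum (\<lambda>n. ?f (m, n)) (?B m))"
  have even: "(- x) ^ Suc k = x ^ Suc k" for x :: complex
    using power_minus_even[of "Suc k" x] k by simp
  have g0: "g 0 = 2 * \<zeta>"
  proof -
    have b: "bij_betw (\<lambda>n. (0::int, n::int)) (UNIV - {0}) ({0} \<times> (UNIV - {0}))"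
      by (rule bij_betwI[where g = snd]) auto
    have "?f summable_on {0} \<times> (UNIV - {0})"
      by (rule summable_on_subset_banach[OF s]) (auto split: if_splits)
    then have "(\<lambda>n. ?f (0, n)) summable_on UNIV - {0}"
      by (subst summable_on_reindex_bij_betw[OF b])
    then have "(\<lambda>n::int. inverse (of_int n ^ Suc k) :: complex) summable_on UNIV - {0}"
      by simp
    then have s0: "(\<lambda>n::int. if n = 0 then 0 else inverse (of_int n ^ Suc k) :: complex) summable_on UNIV"
      by (subst summable_on_cong_neutral[where T = "UNIV - {0}" and g = "\<lambda>n. inverse (of_int n ^ Suc k)"]) auto
    have "g 0 = infsum (\<lambda>n::int. if n = 0 then 0 else inverse (of_int n ^ Suc k)) UNIV"
      unfolding g_def by (rule infsum_cong_neutral) auto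
    also have "\<dots> = 2 * infsum (\<lambda>n::nat. if int n = 0 then 0 else inverse (of_int (int n) ^ Suc k)) {1..}"
      by (subst infsum_int_even[OF s0]) (auto simp: even simp del: power_Suc)
    also have "infsum (\<lambda>n::nat. if int n = 0 then 0 else inverse (of_int (int n) ^ Suc k) :: complex) {1..}
       = infsum (\<lambda>n. inverse (of_nat n ^ Suc k)) {1..}"
      by (rule infsum_cong) auto
    also have "\<dots> = infsum (\<lambda>n. inverse (of_nat (Suc n) ^ Suc k)) UNIV"
    proof -
      have "bij_betw Suc UNIV {1..}"
        by (rule bij_betwI[where g = "\<lambda>n. n - 1"]) auto
      from infsum_reindex_bij_betw[OF this, of "\<lambda>n. inverse (of_nat n ^ Suc k) :: complex"] show ?thesis by simp
    qed
    finally show ?thesis using infsumI[OF zeta] by simp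
  qed
  have gm: "g (int m) = ?c * polylog_neg k (nome z ^ m)" if "m \<in> {1..}" for m
  proof -
    have "of_int (int m) * z \<notin> \<int>"
    proof
      assume "of_int (int m) * z \<in> \<int>"
      then obtain i where i: "of_int (int m) * z = of_int i" by (auto elim: Ints_cases)
      from arg_cong[OF i, of Im] have "real m * Im z = 0" by simp
      then show False using that z by auto
    qed
    from infsumI[OF lipschitz_formula[OF this k(1,2)]]
    have "g (int m) = ?c * polylog_neg k (nome (of_nat m * z))" using that by (simp add: g_def)
    also have "nome (of_nat m * z) = nome z ^ m"
      by (simp add: nome_def exp_of_nat_mult[symmetric] algebra_simps)
    finally show ?thesis .
  qed
  have gminus: "g (- m) = g m" for m
  proof -
    have b: "bij_betw uminus (?B m) (?B (- m))" by (rule bij_betwI[where g = uminus]) auto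
    have "infsum (\<lambda>n. ?f (- m, - n)) (?B m) = g (- m)"
      unfolding g_def using infsum_reindex_bij_betw[OF b, of "\<lambda>n. ?f (- m, n)"] .
    moreover have "?f (- m, - n) = ?f (m, n)" for n
    proof -
      have "of_int (- m) * z + of_int (- n) = - (of_int m * z + of_int n)" by simp
      then show ?thesis by (simp only: prod.case even)
    qed
    ultimately show ?thesis by (simp add: g_def)
  qed
  have sgm: "g summable_on UNIV"
    using summable_on_Sigma_banach[of "\<lambda>m n. ?f (m, n)" UNIV ?B] s by (simp add: g_def case_prod_unfold)
  have "eisenstein_G (Suc k) z = infsum g UNIV"
    unfolding eisenstein_G_def L g_def using infsum_Sigma_banach[OF s] by simp
  also have "\<dots> = g 0 + 2 * infsum (\<lambda>m. g (int m)) {1..}" by (rule infsum_int_even[OF sgm gminus])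
  also have "infsum (\<lambda>m. g (int m)) {1..} = infsum (\<lambda>m. ?c * polylog_neg k (nome z ^ m)) {1..}"
    by (rule infsum_cong) (rule gm)
  also have "\<dots> = ?c * infsum (\<lambda>m. polylog_neg k (nome z ^ m)) {1..}" by (rule infsum_cmult_right')
  also have "infsum (\<lambda>m. polylog_neg k (nome z ^ m)) {1..} = (\<Sum>n. of_nat (sigma_pow k (Suc n)) * nome z ^ Suc n)"
    by (rule lambert_series[OF norm_nome_less[OF z] k(2)])
  finally show ?thesis unfolding g0 by simp
qed

text \<open>The factors are 2 zeta(4) and 2 zeta(6). Dividing the Lipschitz factors 2 (2 pi i)^4/3!
  and 2 (2 pi i)^6/5! by them produces the constants 240 and -504.\<close>

lemma eisenstein_G_eq:
  assumes "Im z > 0"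
  shows "eisenstein_G 4 z = pi ^ 4 / 45 * E4 z" "eisenstein_G 6 z = 2 * pi ^ 6 / 945 * E6 z"
  using eisenstein_G_expansion[OF assms, of 3] zeta_4 eisenstein_G_expansion[OF assms, of 5] zeta_6
  by (simp_all add: E4_def E6_def fact_numeral power_mult_distrib i_power_even ring_distribs of_nat_Suc[of 0]
     del: of_nat_Suc power_Suc)

lemma modJ_modular:
  assumes z: "Im z > 0" and det: "a * d - b * c = (1::int)"
  shows "modJ ((of_int a * z + of_int b) / (of_int c * z + of_int d)) = modJ z"
    and "Im ((of_int a * z + of_int b) / (of_int c * z + of_int d)) > 0"
    and "of_int c * z + of_int d \<noteq> 0"
proof -
  let ?w = "of_int c * z + of_int d" and ?y = "(of_int a * z + of_int b) / (of_int c * z + of_int d)"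
  show nz: "?w \<noteq> 0"
  proof
    assume 0: "?w = 0"
    then have "of_int c * Im z = 0" by (simp add: complex_eq_iff)
    then have "c = 0" using z by simp
    with 0 det show False by auto
  qed
  have "Im ?y = Im z * (of_int (a * d - b * c)) / norm ?w ^ 2"
    by (simp add: Im_divide cmod_power2 algebra_simps)
  then show y: "Im ?y > 0" using z nz det by simp
  have "E4 ?y = ?w ^ 4 * E4 z" "E6 ?y = ?w ^ 6 * E6 z"
    using eisenstein_G_modular[OF z det, of 4] eisenstein_G_modular[OF z det, of 6]
      eisenstein_G_eq[OF z] eisenstein_G_eq[OF y] by simp_all
  then have "modJ ?y = (?w ^ 12 * E4 z ^ 3) / (?w ^ 12 * (E4 z ^ 3 - E6 z ^ 2))"
    by (simp add: modJ_def power_mult_distrib right_diff_distrib flip: power_mult)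
  then show "modJ ?y = modJ z" using nz by (simp add: modJ_def)
qed

section \<open>The modular group\<close>

definition SL2Z :: "(int \<times> int \<times> int \<times> int) set" where
  "SL2Z = {(a, b, c, d). a * d - b * c = 1}"

definition act :: "int \<times> int \<times> int \<times> int \<Rightarrow> complex \<Rightarrow> complex" where
  "act = (\<lambda>(a, b, c, d) z. (of_int a * z + of_int b) / (of_int c * z + of_int d))"

lemma
  assumes "g \<in> SL2Z" "Im z > 0"
  shows Im_act: "Im (act g z) > 0" and modJ_act: "modJ (act g z) = modJ z"
  using assms modJ_modular[OF assms(2)] by (auto simp: SL2Z_def act_def)

lemma holomorphic_act: "g \<in> SL2Z \<Longrightarrow> act g holomorphic_on uhp"
  using modJ_modular(3) by (auto simp: SL2Z_def act_def intro!: holomorphic_intros)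

text \<open>Where the outer denominator vanishes, both sides are 0 because x / 0 = 0.\<close>

lemma moebius_compose:
  fixes z :: complex
  assumes "g * z + h \<noteq> 0"
  shows "(a * ((e * z + f) / (g * z + h)) + b) / (c * ((e * z + f) / (g * z + h)) + d)
    = ((a * e + b * g) * z + (a * f + b * h)) / ((c * e + d * g) * z + (c * f + d * h))"
proof -
  let ?w = "g * z + h"
  have "a * ((e * z + f) / ?w) + b = ((a * e + b * g) * z + (a * f + b * h)) / ?w"
    "c * ((e * z + f) / ?w) + d = ((c * e + d * g) * z + (c * f + d * h)) / ?w"
    using assms by (simp_all add: field_simps)
  then show ?thesis using assms by simp
qed

lemma act_mult:
  assumes "(e, f, r, s) \<in> SL2Z" "Im z > 0"
  shows "act (a, b, c, d) (act (e, f, r, s) z) = act (a * e + b * r, a * f + b * s, c * e + d * r, c * f + d * s) z"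
  using moebius_compose[of "of_int r" z "of_int s" "of_int a" "of_int e" "of_int f" "of_int b" "of_int c" "of_int d"]
    modJ_modular(3)[OF assms(2), of e s f r] assms(1) by (simp add: act_def SL2Z_def)

lemma act_compose:
  assumes "g \<in> SL2Z" "h \<in> SL2Z"
  obtains k where "k \<in> SL2Z" "\<forall>z. Im z > 0 \<longrightarrow> act g (act h z) = act k z"
proof -
  obtain a b c d where g: "g = (a, b, c, d)" by (cases g)
  obtain e f r s where h: "h = (e, f, r, s)" by (cases h)
  let ?k = "(a * e + b * r, a * f + b * s, c * e + d * r, c * f + d * s)"
  have "(a * e + b * r) * (c * f + d * s) - (a * f + b * s) * (c * e + d * r) = (a * d - b * c) * (e * s - f * r)"
    by algebra
  then have "?k \<in> SL2Z" using assms by (simp add: g h SL2Z_def)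
  moreover have "act g (act h z) = act ?k z" if "Im z > 0" for z
    using act_mult[of e f r s z a b c d] that assms(2) by (simp add: g h)
  ultimately show ?thesis using that by blast
qed

lemma act_inverse:
  assumes "g \<in> SL2Z"
  obtains h where "h \<in> SL2Z" "\<forall>z. Im z > 0 \<longrightarrow> act h (act g z) = z" "\<forall>z. Im z > 0 \<longrightarrow> act g (act h z) = z"
proof -
  obtain a b c d where g: "g = (a, b, c, d)" by (cases g)
  have det: "a * d - b * c = 1" using assms by (simp add: g SL2Z_def)
  have cdet: "of_int a * of_int d - of_int b * of_int c = (1 :: complex)"
    using arg_cong[OF det, of of_int] by simp
  let ?h = "(d, - b, - c, a)"
  have h: "?h \<in> SL2Z" using det by (simp add: SL2Z_def algebra_simps)
  have "act ?h (act g z) = z" if "Im z > 0" for z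
  proof -
    have *: "of_int d * of_int a - of_int b * of_int c = (1::complex)" "of_int a * of_int d - of_int c * of_int b = (1::complex)"
      using cdet by (simp_all add: mult.commute)
    have "of_int a * of_int d \<noteq> (of_int b * of_int c :: complex)" using cdet by auto
    then show ?thesis
      using moebius_compose[of "of_int c" z "of_int d" "of_int d" "of_int a" "of_int b" "- of_int b" "- of_int c" "of_int a"]
        modJ_modular(3)[OF that det] * by (simp add: act_def g mult.commute)
  qed
  moreover have "act g (act ?h z) = z" if "Im z > 0" for z
  proof -
    have *: "of_int d * of_int a - of_int b * of_int c = (1::complex)" "of_int a * of_int d - of_int c * of_int b = (1::complex)"
      using cdet by (simp_all add: mult.commute)
    have "of_int (- c) * z + of_int a \<noteq> 0" using modJ_modular(3)[OF that, of d a "- b" "- c"] det by (simp add: algebra_simps)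
    moreover have "of_int a * of_int d \<noteq> (of_int b * of_int c :: complex)" using cdet by auto
    ultimately show ?thesis
      using moebius_compose[of "- of_int c" z "of_int a" "of_int a" "of_int d" "- of_int b" "of_int b" "of_int c" "of_int d"]
        * by (simp add: act_def g mult.commute)
  qed
  ultimately show ?thesis using that[OF h] by blast
qed

lemma act_translate: "(1, k, 0, 1) \<in> SL2Z" "act (1, k, 0, 1) z = z + of_int k"
  by (simp_all add: SL2Z_def act_def)

lemma act_invert: "(0, - 1, 1, 0) \<in> SL2Z" "act (0, - 1, 1, 0) z = - 1 / z"
  by (simp_all add: SL2Z_def act_def)

lemma countable_SL2Z: "countable A" for A :: "(int \<times> int \<times> int \<times> int) set"
  by (rule countableI_type)

text \<open>If a translate into the strip has height below \<open>1/2\<close>, its inversion has at least twice that height.\<close>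
lemma act_fundamental_aux:
  assumes "Im z \<ge> (1/2) ^ Suc n"
  shows "\<exists>g\<in>SL2Z. \<bar>Re (act g z)\<bar> \<le> 1/2 \<and> Im (act g z) \<ge> 1/2"
  using assms
proof (induction n arbitrary: z)
  case 0
  show ?case
    by (rule bexI[OF _ act_translate(1)[of "- round (Re z)"]])
       (use 0 of_int_round_abs_le[of "Re z"] in \<open>auto simp: act_translate abs_minus_commute\<close>)
next
  case (Suc n)
  let ?t = "(1, - round (Re z), 0, 1)" 
  define w where "w = act ?t z"
  have pos: "Im z > 0" using Suc.prems by (rule less_le_trans[rotated]) simp
  have w: "\<bar>Re w\<bar> \<le> 1/2" "Im w = Im z"
    using of_int_round_abs_le[of "Re z"] by (auto simp: w_def act_translate abs_minus_commute)
  show ?case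
  proof (cases "Im z \<ge> 1/2")
    case True
    then show ?thesis using w act_translate(1)[of "- round (Re z)"] by (auto simp: w_def)
  next
    case False
    have "Re w ^ 2 \<le> (1/2) ^ 2" using w(1) by (subst abs_le_square_iff[symmetric]) simp
    moreover have "Im w ^ 2 \<le> (1/2) ^ 2" using False w(2) pos by (intro power_mono) auto
    ultimately have n: "Re w ^ 2 + Im w ^ 2 \<le> 1/2" by (simp add: power2_eq_square)
    have p: "Re w ^ 2 + Im w ^ 2 > 0" using w(2) pos by (simp add: sum_power2_gt_zero_iff)
    have "Im (- 1 / w) = Im w / (Re w ^ 2 + Im w ^ 2)" by (simp add: Im_divide)
    also have "\<dots> \<ge> Im w / (1/2)" using n p w(2) pos by (intro divide_left_mono) auto
    finally have "Im (- 1 / w) \<ge> (1/2) ^ Suc n" using Suc.prems w(2) by simp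
    from Suc.IH[OF this] obtain g where g: "g \<in> SL2Z" "\<bar>Re (act g (- 1 / w))\<bar> \<le> 1/2" "Im (act g (- 1 / w)) \<ge> 1/2"
      by blast
    obtain h where h: "h \<in> SL2Z" "\<forall>z. Im z > 0 \<longrightarrow> act g (act (0, - 1, 1, 0) z) = act h z"
      by (rule act_compose[OF g(1) act_invert(1)])
    obtain k where k: "k \<in> SL2Z" "\<forall>z. Im z > 0 \<longrightarrow> act h (act ?t z) = act k z"
      by (rule act_compose[OF h(1) act_translate(1)])
    have "act k z = act g (- 1 / w)"
      using h(2) k(2) pos w(2) by (metis act_invert(2) w_def)
    then show ?thesis using g(2,3) by (intro bexI[OF _ k(1)]) (simp only: simp_thms)
  qed
qed

section \<open>Reduction into the strip; properness, surjectivity and automorphisms of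
  \<open>modJ\<close>\<close>

lemma act_fundamental:
  assumes "Im z > 0"
  shows "\<exists>g\<in>SL2Z. \<bar>Re (act g z)\<bar> \<le> 1/2 \<and> Im (act g z) \<ge> 1/2"
proof -
  obtain n where "(1/2) ^ n < Im z" using real_arch_pow_inv[OF assms, of "1/2"] by auto
  moreover have "(1/2 :: real) ^ Suc n \<le> (1/2) ^ n" by simp
  ultimately show ?thesis by (intro act_fundamental_aux[of n]) linarith
qed

lemma compact_fundamental: "compact {z. \<bar>Re z\<bar> \<le> 1/2 \<and> 1/2 \<le> Im z \<and> Im z \<le> Y}"
proof -
  have "{z. \<bar>Re z\<bar> \<le> 1/2 \<and> 1/2 \<le> Im z \<and> Im z \<le> Y} = cbox (Complex (- 1/2) (1/2)) (Complex (1/2) Y)"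
    by (auto simp: in_cbox_complex_iff abs_le_iff)
  then show ?thesis by simp
qed

text \<open>Properness modulo the group: since \<open>modJ\<close> tends to infinity at the cusp, a
  bound on \<open>modJ\<close> bounds the height of a representative in the strip. It serves both
  for surjectivity and for the closedness of the curve.\<close>

lemma modJ_bounded_compact:
  obtains K where "compact K" "K \<subseteq> uhp"
    "\<forall>z. Im z > 0 \<longrightarrow> norm (modJ z) \<le> B \<longrightarrow> (\<exists>g\<in>SL2Z. act g z \<in> K)"
proof -
  obtain Y where Y: "\<And>x. Im x > Y \<Longrightarrow> norm (modJ x) > B" by (rule modJ_at_cusp[of B]) blast
  show ?thesis
  proof (rule that[OF compact_fundamental[of Y]])
    show "{z. \<bar>Re z\<bar> \<le> 1/2 \<and> 1/2 \<le> Im z \<and> Im z \<le> Y} \<subseteq> uhp" by auto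
    show "\<forall>z. Im z > 0 \<longrightarrow> norm (modJ z) \<le> B \<longrightarrow> (\<exists>g\<in>SL2Z. act g z \<in> {z. \<bar>Re z\<bar> \<le> 1/2 \<and> 1/2 \<le> Im z \<and> Im z \<le> Y})"
    proof (intro allI impI)
      fix z assume z: "Im z > 0" "norm (modJ z) \<le> B"
      obtain g where g: "g \<in> SL2Z" "\<bar>Re (act g z)\<bar> \<le> 1/2" "Im (act g z) \<ge> 1/2"
        using act_fundamental[OF z(1)] by blast
      have "\<not> Im (act g z) > Y" using Y[of "act g z"] modJ_act[OF g(1) z(1)] z(2) by auto
      then show "\<exists>g\<in>SL2Z. act g z \<in> {z. \<bar>Re z\<bar> \<le> 1/2 \<and> 1/2 \<le> Im z \<and> Im z \<le> Y}" using g by auto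
    qed
  qed
qed

lemma modJ_nonconstant: "\<not> modJ constant_on uhp"
proof
  assume "modJ constant_on uhp"
  then obtain c where c: "\<And>z. Im z > 0 \<Longrightarrow> modJ z = c" by (auto simp: constant_on_def)
  obtain Y where Y: "\<And>x. Im x > Y \<Longrightarrow> norm (modJ x) > norm c" by (rule modJ_at_cusp[of "norm c"]) blast
  have "Y < \<bar>Y\<bar> + 1" "0 < \<bar>Y\<bar> + 1" by linarith+
  then show False using Y[of "Complex 0 (\<bar>Y\<bar> + 1)"] c[of "Complex 0 (\<bar>Y\<bar> + 1)"] by simp
qed

text \<open>The image is open by the open mapping theorem and closed by properness, and the plane is
  connected.\<close>

lemma modJ_surj: "modJ ` uhp = UNIV"
proof -
  have o: "open (modJ ` uhp)"
    by (rule open_mapping_thm[OF holomorphic_modJ open_uhp connected_uhp open_uhp order_refl modJ_nonconstant])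
  have "closed (modJ ` uhp)"
    unfolding closed_def open_contains_ball
  proof
    fix c assume c: "c \<in> - modJ ` uhp"
    obtain K where K: "compact K" "K \<subseteq> uhp"
      "\<forall>z. Im z > 0 \<longrightarrow> norm (modJ z) \<le> norm c + 1 \<longrightarrow> (\<exists>g\<in>SL2Z. act g z \<in> K)"
      by (rule modJ_bounded_compact)
    have "compact (modJ ` K)"
      by (intro compact_continuous_image[OF _ K(1)] holomorphic_on_imp_continuous_on holomorphic_on_subset[OF holomorphic_modJ K(2)])
    then have "open (- modJ ` K)" by (simp add: compact_imp_closed open_Compl)
    moreover have "c \<in> - modJ ` K" using c K(2) by auto
    ultimately obtain e where e: "e > 0" "ball c e \<subseteq> - modJ ` K" by (meson open_contains_ball)
    have "ball c (min e 1) \<subseteq> - modJ ` uhp"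
    proof
      fix x assume x: "x \<in> ball c (min e 1)"
      show "x \<in> - modJ ` uhp"
      proof
        assume "x \<in> modJ ` uhp"
        then obtain z where z: "Im z > 0" "x = modJ z" by auto
        have "norm x \<le> norm c + 1" using x norm_triangle_ineq2[of x c] by (simp add: dist_norm norm_minus_commute)
        then obtain g where "g \<in> SL2Z" "act g z \<in> K" using K(3) z by auto
        then have "x \<in> modJ ` K" using modJ_act[of g z] z by (intro image_eqI[of _ _ "act g z"]) auto
        then show False using e(2) x by auto
      qed
    qed
    then show "\<exists>e>0. ball c e \<subseteq> - modJ ` uhp" using e(1) by (intro exI[of _ "min e 1"]) auto
  qed
  then have "closed (modJ ` uhp) \<and> open (modJ ` uhp)" using o by (rule conjI)
  then have "modJ ` uhp = {} \<or> modJ ` uhp = UNIV" by (rule iffD1[OF clopen])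
  moreover have "modJ \<i> \<in> modJ ` uhp" by (rule imageI) simp
  ultimately show ?thesis by (metis emptyE)
qed

lemma open_imp_fsigma:
  fixes S :: "complex set"
  assumes "open S" shows "fsigma S"
proof -
  obtain C where "\<And>n. compact (C n)" "\<And>n. C n \<subseteq> S" "\<And>n. C n \<subseteq> interior (C (Suc n))" "\<Union> (range C) = S"
    by (rule open_Union_compact_subsets[OF assms]) (rule that)
  then show ?thesis unfolding fsigma_Union_compact by (intro exI[of _ C]) auto
qed

text \<open>Countably many coincidence sets cover an uncountable set, so one of them is uncountable,
  and holomorphic functions that agree on an uncountable subset of a domain coincide.\<close>

lemma holomorphic_eq_countable_family:
  assumes S: "open S" "connected S" and f: "f holomorphic_on S" and I: "countable I"
    and h: "\<And>i. i \<in> I \<Longrightarrow> h i holomorphic_on S"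
    and A: "uncountable A" "A \<subseteq> S" "\<And>z. z \<in> A \<Longrightarrow> \<exists>i\<in>I. f z = h i z"
  shows "\<exists>i\<in>I. \<forall>z\<in>S. f z = h i z"
proof -
  have "A \<subseteq> (\<Union>i\<in>I. {z \<in> S. f z = h i z})" using A by blast
  then have "\<not> (\<forall>i\<in>I. countable {z \<in> S. f z = h i z})" using A(1) I by (meson countable_UN countable_subset)
  then obtain i where i: "i \<in> I" "uncountable {z \<in> S. f z = h i z}" by blast
  have "S \<subseteq> {z \<in> S. f z = h i z}"
    by (rule holomorphic_countable_equal[OF f h[OF i(1)] S open_imp_fsigma[OF S(1)] i(2)])
  then show ?thesis using i(1) by blast
qed

text \<open>Near the cusp \<open>modJ\<close> is injective up to translation, so an automorphism preserving \<open>modJ\<close>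
  agrees on a ray of the imaginary axis with elements of the countable group \<open>SL2Z\<close>.\<close>
lemma modJ_automorphism:
  assumes f: "f holomorphic_on uhp" "f ` uhp \<subseteq> uhp" and J: "\<And>z. Im z > 0 \<Longrightarrow> modJ (f z) = modJ z"
  shows "\<exists>g\<in>SL2Z. \<forall>z\<in>uhp. f z = act g z"
proof -
  obtain Y where Y: "\<And>x y. Im x > Y \<Longrightarrow> Im y > Y \<Longrightarrow> modJ x = modJ y \<Longrightarrow> \<exists>k::int. x = y + of_int k"
    by (rule modJ_cusp_inj) blast
  let ?K = "{z. \<bar>Re z\<bar> \<le> 1/2 \<and> 1/2 \<le> Im z \<and> Im z \<le> Y}"
  have "compact (modJ ` ?K)"
    by (intro compact_continuous_image compact_fundamental holomorphic_on_imp_continuous_on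
        holomorphic_on_subset[OF holomorphic_modJ]) auto
  then obtain M where M: "\<And>z. z \<in> ?K \<Longrightarrow> norm (modJ z) \<le> M"
    by (meson bounded_iff compact_imp_bounded imageI)
  obtain Y2 where Y2: "\<And>x. Im x > Y2 \<Longrightarrow> norm (modJ x) > M" by (rule modJ_at_cusp[of M]) blast
  define R where "R = max 0 (max Y Y2)"
  let ?A = "(\<lambda>y. Complex 0 y) ` {R<..<R + 1}"
  have key: "\<exists>g\<in>SL2Z. f z = act g z" if "z \<in> ?A" for z
  proof -
    have z: "Im z > Y" "Im z > Y2" "Im z > 0" using that by (auto simp: R_def)
    have fz: "Im (f z) > 0" using f(2) z(3) by auto
    obtain g where g: "g \<in> SL2Z" "\<bar>Re (act g (f z))\<bar> \<le> 1/2" "Im (act g (f z)) \<ge> 1/2"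
      using act_fundamental[OF fz] by blast
    have e: "modJ (act g (f z)) = modJ z" using modJ_act[OF g(1) fz] J[OF z(3)] by simp
    \<comment> \<open>At z the modulus of \<open>modJ\<close> exceeds its bound M on the low
      rectangle. The representative of f z therefore lies above Y, where \<open>modJ\<close> is
      injective up to translation.\<close>
    then have "act g (f z) \<notin> ?K" using M Y2[OF z(2)] by (metis not_less)
    then have "Im (act g (f z)) > Y" using g by auto
    from Y[OF this z(1) e] obtain k :: int where k: "act g (f z) = z + of_int k" by blast
    obtain h where h: "h \<in> SL2Z" "\<forall>z. Im z > 0 \<longrightarrow> act h (act g z) = z" by (rule act_inverse[OF g(1)])
    obtain l where l: "l \<in> SL2Z" "\<forall>z. Im z > 0 \<longrightarrow> act h (act (1, k, 0, 1) z) = act l z"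
      by (rule act_compose[OF h(1) act_translate(1)])
    have "f z = act l z" using h(2) l(2) k z(3) fz by (metis act_translate(2))
    then show ?thesis using l(1) by blast
  qed
  show ?thesis
  proof (rule holomorphic_eq_countable_family[OF open_uhp connected_uhp f(1) countable_SL2Z holomorphic_act _ _ key])
    have "inj_on (\<lambda>y. Complex 0 y) {R<..<R + 1}" by (auto simp: inj_on_def)
    then show "uncountable ?A" by (simp add: countable_image_inj_eq uncountable_open_interval)
    show "?A \<subseteq> uhp" by (auto simp: R_def)
  qed
qed

section \<open>Integer matrices and the modular curves\<close>

text \<open>Bezout for the first column: (p, r) = g (p', r') with u p' + v r' = 1 completes (p', r')
  to a unimodular matrix. Adding k times its first column to the second reduces b modulo d.\<close>

lemma hermite_normal_form:
  fixes p q r s :: int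
  assumes n: "p * s - q * r > 0"
  obtains \<alpha> \<beta> \<gamma> \<delta> a b d where "(\<alpha>, \<beta>, \<gamma>, \<delta>) \<in> SL2Z" "a > 0" "d > 0" "a * d = p * s - q * r" "0 \<le> b" "b < d"
    "p = \<alpha> * a" "q = \<alpha> * b + \<beta> * d" "r = \<gamma> * a" "s = \<gamma> * b + \<delta> * d"
proof -
  define g where "g = gcd p r"
  have "p \<noteq> 0 \<or> r \<noteq> 0" using n by auto
  then have g: "g > 0" by (simp add: g_def)
  obtain u v where "u * p + v * r = g" using bezout_int[of p r] by (auto simp: g_def)
  moreover obtain p' r' where pr: "p = p' * g" "r = r' * g" by (metis g_def gcd_dvd1 gcd_dvd2 dvdE mult.commute)
  ultimately have "(u * p' + v * r') * g = 1 * g" by (simp add: algebra_simps)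
  then have uv: "u * p' + v * r' = 1" using g by simp
  define d where "d = p' * s - r' * q"
  define b0 where "b0 = u * q + v * s"
  have gd: "g * d = p * s - q * r" by (simp add: d_def pr algebra_simps)
  have d: "d > 0" using gd n g by (metis zero_less_mult_pos)
  define b k where "b = b0 mod d" and "k = b0 div d"
  have b0: "b0 = b + k * d" by (simp add: b_def k_def)
  show ?thesis
  proof (rule that[of p' "k * p' - v" r' "k * r' + u" g d b])
    show "(p', k * p' - v, r', k * r' + u) \<in> SL2Z" using uv by (simp add: SL2Z_def algebra_simps)
    have "p' * b + (k * p' - v) * d = p' * b0 - v * d" unfolding b0 by (simp add: algebra_simps)
    also have "\<dots> = q * (u * p' + v * r')" unfolding b0_def d_def by (simp add: algebra_simps)
    finally show "q = p' * b + (k * p' - v) * d" using uv by simp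
    have "r' * b + (k * r' + u) * d = r' * b0 + u * d" unfolding b0 by (simp add: algebra_simps)
    also have "\<dots> = s * (u * p' + v * r')" unfolding b0_def d_def by (simp add: algebra_simps)
    finally show "s = r' * b + (k * r' + u) * d" using uv by simp
  qed (use g d gd pr in \<open>auto simp: b_def\<close>)
qed

text \<open>Take v to be the product of the primes of a that do not divide b. A prime of a dividing
  b divides neither v nor d; one not dividing b divides v. In both cases it does not divide b + v
  d.\<close>

lemma coprime_shift_exists:
  fixes a b d :: int
  assumes a: "a > 0" and gcd: "gcd a (gcd b d) = 1"
  shows "\<exists>v. coprime a (b + v * d)"
proof -
  define v where "v = \<Prod>{p \<in> prime_factors a. \<not> p dvd b}"
  have "coprime a (b + v * d)"
  proof (rule ccontr)
    assume "\<not> coprime a (b + v * d)"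
    then have "\<not> is_unit (gcd a (b + v * d))" by (simp add: coprime_iff_gcd_eq_1)
    then obtain p where "p dvd gcd a (b + v * d)" "prime p"
      using prime_divisor_exists[of "gcd a (b + v * d)"] a by auto
    then have p: "prime p" "p dvd a" "p dvd b + v * d" by auto
    have pa: "p \<in> prime_factors a" using p a by (simp add: in_prime_factors_iff)
    have "is_unit p"
    proof (cases "p dvd b")
      case True
      then have "p dvd v * d" using p(3) dvd_add_right_iff by blast
      then have "p dvd v \<or> p dvd d" using p(1) by (simp add: prime_dvd_mult_iff)
      then show ?thesis
      proof
        assume "p dvd v"
        then obtain l where l: "l \<in> {p \<in> prime_factors a. \<not> p dvd b}" "p dvd l"
          using prime_dvd_prod_iff[of "{p \<in> prime_factors a. \<not> p dvd b}" p "\<lambda>x. x"] p(1) unfolding v_def by auto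
        then have "p = l" using p(1) by (auto simp: in_prime_factors_iff intro: primes_dvd_imp_eq)
        then show ?thesis using l True by simp
      next
        assume "p dvd d"
        then have "p dvd gcd a (gcd b d)" using p True by simp
        then show ?thesis using gcd by simp
      qed
    next
      case False
      then have "p dvd v" unfolding v_def using pa by (intro dvd_prodI) auto
      then have "p dvd b" using p(3) by (metis dvd_add_left_iff dvd_mult2)
      then show ?thesis using False by simp
    qed
    then show False using p(1) not_prime_unit by blast
  qed
  then show ?thesis by blast
qed

text \<open>Primitivity passes to the Hermite form (a, b; 0, d), where a shift makes b + v d coprime
  to a, so that (a, b + v d) is the bottom row of a unimodular matrix.\<close>

lemma smith_normal_form_act:
  fixes p q r s :: int
  assumes n: "p * s - q * r = int n" "n > 0" and prim: "gcd (gcd p q) (gcd r s) = 1"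
  obtains g h where "g \<in> SL2Z" "h \<in> SL2Z"
    "\<forall>z. Im z > 0 \<longrightarrow> (of_int p * z + of_int q) / (of_int r * z + of_int s) = act g (of_nat n * act h z)"
proof -
  obtain \<alpha> \<beta> \<gamma> \<delta> a b d where H: "(\<alpha>, \<beta>, \<gamma>, \<delta>) \<in> SL2Z" "a > 0" "d > 0" "a * d = p * s - q * r" "0 \<le> b" "b < d"
    "p = \<alpha> * a" "q = \<alpha> * b + \<beta> * d" "r = \<gamma> * a" "s = \<gamma> * b + \<delta> * d"
    by (rule hermite_normal_form[of p s q r]) (use n in simp)
  have "gcd a (gcd b d) dvd gcd (gcd p q) (gcd r s)"
    unfolding H(7-10) by (intro gcd_greatest) (auto intro!: dvd_add intro: dvd_mult dvd_trans[OF gcd_dvd2])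
  then have "gcd a (gcd b d) = 1" using prim by (simp add: is_unit_gcd_iff)
  from coprime_shift_exists[OF H(2) this] obtain v where "coprime a (b + v * d)" ..
  moreover obtain x' y' where "x' * (b + v * d) + y' * a = gcd (b + v * d) a" using bezout_int by blast
  ultimately have xy0: "x' * (b + v * d) + y' * a = 1" by (simp add: coprime_iff_gcd_eq_1 gcd.commute)
  define x y where "x = x'" and "y = - y'"
  have xy: "x * (b + v * d) - y * a = 1" using xy0 by (simp add: x_def y_def)
  \<comment> \<open>Chosen so that U diag(n, 1) V = (a, b; 0, d): U is the triangular matrix times
    the inverse of V, with first column divided by n = a d.\<close>
  let ?V = "(x, y, a, b + v * d)" and ?U = "(v, x * b - a * y, - 1, d * x)"
  have V: "?V \<in> SL2Z" using xy by (simp add: SL2Z_def)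
  have U: "?U \<in> SL2Z" using xy by (simp add: SL2Z_def algebra_simps)
  obtain g where g: "g \<in> SL2Z" "\<forall>z. Im z > 0 \<longrightarrow> act (\<alpha>, \<beta>, \<gamma>, \<delta>) (act ?U z) = act g z"
    by (rule act_compose[OF H(1) U])
  have nad: "int n = a * d" using H n by simp
  have "(of_int p * z + of_int q) / (of_int r * z + of_int s) = act g (of_nat n * act ?V z)" if z: "Im z > 0" for z
  proof -
    have dn: "of_int a * z + of_int (b + v * d) \<noteq> 0" using modJ_modular(3)[OF z, of x "b + v * d" y a] xy by simp
    have e1: "of_nat n * act ?V z = (of_int (int n * x) * z + of_int (int n * y)) / (of_int a * z + of_int (b + v * d))"
      by (simp add: act_def algebra_simps add_divide_distrib)
    have i1: "v * (int n * x) + (x * b - a * y) * a = a" "v * (int n * y) + (x * b - a * y) * (b + v * d) = b"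
      "- 1 * (int n * x) + d * x * a = 0" "- 1 * (int n * y) + d * x * (b + v * d) = d"
    proof -
      have "v * (int n * x) + (x * b - a * y) * a = a * (x * (b + v * d) - y * a)" unfolding nad by algebra
      then show "v * (int n * x) + (x * b - a * y) * a = a" using xy by simp
      have "v * (int n * y) + (x * b - a * y) * (b + v * d) = b * (x * (b + v * d) - y * a)" unfolding nad by algebra
      then show "v * (int n * y) + (x * b - a * y) * (b + v * d) = b" using xy by simp
      show "- 1 * (int n * x) + d * x * a = 0" unfolding nad by algebra
      have "- 1 * (int n * y) + d * x * (b + v * d) = d * (x * (b + v * d) - y * a)" unfolding nad by algebra
      then show "- 1 * (int n * y) + d * x * (b + v * d) = d" using xy by simp
    qed
    have U0: "act ?U W = (of_int v * W + of_int (x * b - a * y)) / (of_int (- 1) * W + of_int (d * x))" for W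
      by (simp only: act_def prod.case)
    have "act ?U (of_nat n * act ?V z) = (of_int (v * (int n * x) + (x * b - a * y) * a) * z + of_int (v * (int n * y) + (x * b - a * y) * (b + v * d)))
       / (of_int (- 1 * (int n * x) + d * x * a) * z + of_int (- 1 * (int n * y) + d * x * (b + v * d)))"
      unfolding U0 e1 of_int_add[of "_ * _"] of_int_mult[of _ "int n * _"] of_int_mult[of _ "b + v * d"]
        of_int_mult[of _ a]
      by (rule moebius_compose[OF dn])
    then have U1: "act ?U (of_nat n * act ?V z) = (of_int a * z + of_int b) / of_int d" unfolding i1 by simp
    have "0 * z + of_int d \<noteq> 0" using H(3) by simp
    from moebius_compose[OF this, of "of_int \<alpha>" "of_int a" "of_int b" "of_int \<beta>" "of_int \<gamma>" "of_int \<delta>"]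
    have "(of_int p * z + of_int q) / (of_int r * z + of_int s) = act (\<alpha>, \<beta>, \<gamma>, \<delta>) ((of_int a * z + of_int b) / of_int d)"
      by (simp add: act_def H(7-10))
    moreover have "Im (of_nat n * act ?V z) > 0" using Im_act[OF V z] n(2) by simp
    ultimately show ?thesis using g(2) U1 by metis
  qed
  then show ?thesis using that[OF g(1) V] by blast
qed

text \<open>As g varies, z -> modJ (n g z) takes only finitely many forms, indexed by triangular
  matrices of determinant n. This finiteness is what makes the image of the half-plane
  closed.\<close>

lemma modJ_nact_hermite:
  assumes g: "g \<in> SL2Z" and n: "n \<ge> 1"
  shows "\<exists>a\<in>{1..int n}. \<exists>b\<in>{0..int n}. \<exists>d\<in>{1..int n}. \<forall>z. Im z > 0 \<longrightarrow>
    modJ ((of_int a * z + of_int b) / of_int d) = modJ (of_nat n * act g z)"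
proof -
  obtain p q r s where g': "g = (p, q, r, s)" by (cases g)
  have det: "p * s - q * r = 1" using g by (simp add: g' SL2Z_def)
  have n': "(int n * p) * s - (int n * q) * r = int n"
  proof -
    have "(int n * p) * s - (int n * q) * r = int n * (p * s - q * r)" by algebra
    then show ?thesis using det by simp
  qed
  obtain \<alpha> \<beta> \<gamma> \<delta> a b d where H: "(\<alpha>, \<beta>, \<gamma>, \<delta>) \<in> SL2Z" "a > 0" "d > 0" "a * d = (int n * p) * s - (int n * q) * r" "0 \<le> b" "b < d"
    "int n * p = \<alpha> * a" "int n * q = \<alpha> * b + \<beta> * d" "r = \<gamma> * a" "s = \<gamma> * b + \<delta> * d"
    by (rule hermite_normal_form[of "int n * p" s "int n * q" r]) (use n n' in simp)
  have ad: "a * d = int n" using H(4) n' by simp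
  have "a dvd int n" "d dvd int n" using dvd_triv_left[of a d] dvd_triv_right[of d a] unfolding ad by simp_all
  then have le: "a \<le> int n" "d \<le> int n" using n by (auto intro!: zdvd_imp_le)
  have "modJ ((of_int a * z + of_int b) / of_int d) = modJ (of_nat n * act g z)" if z: "Im z > 0" for z
  proof -
    have "0 * z + of_int d \<noteq> 0" using H(3) by simp
    from moebius_compose[OF this, of "of_int \<alpha>" "of_int a" "of_int b" "of_int \<beta>" "of_int \<gamma>" "of_int \<delta>"]
    have "act (\<alpha>, \<beta>, \<gamma>, \<delta>) ((of_int a * z + of_int b) / of_int d)
       = (of_int (\<alpha> * a) * z + of_int (\<alpha> * b + \<beta> * d)) / (of_int (\<gamma> * a) * z + of_int (\<gamma> * b + \<delta> * d))"
      by (simp add: act_def)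
    also have "\<dots> = of_nat n * act g z"
      unfolding H(7-10)[symmetric] by (simp add: act_def g' algebra_simps add_divide_distrib)
    finally have "act (\<alpha>, \<beta>, \<gamma>, \<delta>) ((of_int a * z + of_int b) / of_int d) = of_nat n * act g z" .
    moreover have "Im ((of_int a * z + of_int b) / of_int d) > 0"
    proof -
      have "(of_int a * z + of_int b) / of_int d = (of_int a * z + of_int b) / of_real (of_int d)" by simp
      then have "Im ((of_int a * z + of_int b) / of_int d) = of_int a * Im z / of_int d" by (simp only: Im_divide_of_real) simp
      then show ?thesis using H z by simp
    qed
    ultimately show ?thesis using modJ_act[OF H(1)] by metis
  qed
  then show ?thesis using H le by (intro bexI[of _ a] bexI[of _ b] bexI[of _ d]) auto
qed

text \<open>The image is already closed: by the Hermite normal form, finitely many maps on one compact set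
  give all its points whose first coordinate is bounded.\<close>
lemma X0_affine_eq:
  assumes n: "n \<ge> 1"
  shows "X0_affine n = (\<lambda>\<tau>. (modJ \<tau>, modJ (of_nat n * \<tau>))) ` uhp"
proof
  let ?F = "\<lambda>\<tau>. (modJ \<tau>, modJ (of_nat n * \<tau>))"
  show "?F ` uhp \<subseteq> X0_affine n" unfolding X0_affine_def by (rule closure_subset)
  show "X0_affine n \<subseteq> ?F ` uhp"
  proof
    fix P assume P: "P \<in> X0_affine n"
    obtain x y where xy: "P = (x, y)" by (cases P)
    obtain K where K: "compact K" "K \<subseteq> uhp"
      "\<forall>z. Im z > 0 \<longrightarrow> norm (modJ z) \<le> norm x + 1 \<longrightarrow> (\<exists>g\<in>SL2Z. act g z \<in> K)"
      by (rule modJ_bounded_compact)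
    define T where "T = {t \<in> {1..int n} \<times> {0..int n} \<times> {1..int n}. \<exists>g\<in>SL2Z. \<forall>z. Im z > 0 \<longrightarrow>
       modJ ((of_int (fst t) * z + of_int (fst (snd t))) / of_int (snd (snd t))) = modJ (of_nat n * act g z)}"
    define H where "H = (\<lambda>t z. modJ ((of_int (fst t) * z + of_int (fst (snd t))) / of_int (snd (snd t))) :: complex)"
    define C where "C = (\<Union>t\<in>T. (\<lambda>z. (modJ z, H t z)) ` K)"
    have finT: "finite T" unfolding T_def by (rule finite_subset[of _ "{1..int n} \<times> {0..int n} \<times> {1..int n}"]) auto
    have "compact ((\<lambda>z. (modJ z, H t z)) ` K)" if t: "t \<in> T" for t
    proof (rule compact_continuous_image[OF _ K(1)])
      obtain a b d where abd: "t = (a, b, d)" by (cases t)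
      have pos: "a > 0" "d > 0" using t by (auto simp: abd T_def)
      have im: "(of_int a * z + of_int b) / of_int d \<in> uhp" if "z \<in> uhp" for z
      proof -
        have "(of_int a * z + of_int b) / of_int d = (of_int a * z + of_int b) / of_real (of_int d)" by simp
        then have "Im ((of_int a * z + of_int b) / of_int d) = of_int a * Im z / of_int d" by (simp only: Im_divide_of_real) simp
        then show ?thesis using pos that by simp
      qed
      have "(modJ \<circ> (\<lambda>z. (of_int a * z + of_int b) / of_int d)) holomorphic_on uhp"
        by (rule holomorphic_on_compose_gen[OF _ holomorphic_modJ]) (use im pos in \<open>auto intro!: holomorphic_intros\<close>)
      then have "continuous_on uhp (H t)"
        by (simp add: H_def abd o_def holomorphic_on_imp_continuous_on)
      then show "continuous_on K (\<lambda>z. (modJ z, H t z))"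
        using K(2) holomorphic_on_imp_continuous_on[OF holomorphic_modJ]
        by (intro continuous_on_Pair) (auto intro: continuous_on_subset)
    qed
    then have C: "closed C" unfolding C_def using finT by (intro compact_imp_closed compact_UN) auto
    \<comment> \<open>On this neighbourhood of P the first coordinate has modulus at most |x| + 1,
      so the parameter can be moved into the compact set \<open>K\<close>.\<close>
    define O' where "O' = ball x 1 \<times> (UNIV :: complex set)"
    have "open O'" unfolding O'_def by (intro open_Times) auto
    moreover have "P \<in> O'" by (simp add: O'_def xy)
    moreover have "O' \<inter> ?F ` uhp \<subseteq> C"
    proof
      fix p assume "p \<in> O' \<inter> ?F ` uhp"
      then obtain z where z: "Im z > 0" "p = ?F z" "dist x (modJ z) < 1" by (auto simp: O'_def)
      have "norm (modJ z) \<le> norm x + 1" using z(3) norm_triangle_ineq2[of "modJ z" x] by (simp add: dist_norm norm_minus_commute)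
      then obtain g where g: "g \<in> SL2Z" "act g z \<in> K" using K(3) z(1) by auto
      obtain h where h: "h \<in> SL2Z" "\<forall>z. Im z > 0 \<longrightarrow> act h (act g z) = z" by (rule act_inverse[OF g(1)])
      obtain a b d where abd: "a \<in> {1..int n}" "b \<in> {0..int n}" "d \<in> {1..int n}"
        "\<forall>z. Im z > 0 \<longrightarrow> modJ ((of_int a * z + of_int b) / of_int d) = modJ (of_nat n * act h z)"
        using modJ_nact_hermite[OF h(1) n] by blast
      have "(a, b, d) \<in> T" unfolding T_def using abd h(1) by (auto intro!: bexI[of _ h])
      moreover have "p = (modJ (act g z), H (a, b, d) (act g z))"
        using z abd(4) h(2) modJ_act[OF g(1) z(1)] Im_act[OF g(1) z(1)] by (simp add: H_def)
      ultimately show "p \<in> C" unfolding C_def using g(2) by blast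
    qed
    ultimately have "P \<in> closure C"
      using P open_Int_closure_subset[of O' "?F ` uhp"] closure_mono[of "O' \<inter> ?F ` uhp" C] unfolding X0_affine_def by blast
    then have "P \<in> C" using C by simp
    then obtain t z where tz: "t \<in> T" "z \<in> K" "P = (modJ z, H t z)" unfolding C_def by auto
    have z: "Im z > 0" using tz(2) K(2) by auto
    obtain g where g: "g \<in> SL2Z" "\<forall>z. Im z > 0 \<longrightarrow> H t z = modJ (of_nat n * act g z)"
      using tz(1) by (auto simp: T_def H_def)
    have "P = ?F (act g z)" using tz(3) g z modJ_act[OF g(1) z] by simp
    then show "P \<in> ?F ` uhp" using Im_act[OF g(1) z] by blast
  qed
qed

section \<open>Algebraic dependence\<close>

lemma homogeneous_system_nontrivial:
  fixes f :: "'i \<Rightarrow> nat \<Rightarrow> 'a::field"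
  assumes "finite I" "m < card I"
  shows "\<exists>c. (\<exists>i\<in>I. c i \<noteq> 0) \<and> (\<forall>k<m. (\<Sum>i\<in>I. c i * f i k) = 0)"
  using assms
proof (induction m arbitrary: I f)
  case 0
  then obtain i where "i \<in> I" by (metis card.empty ex_in_conv less_irrefl)
  then show ?case by (intro exI[of _ "\<lambda>_. 1"]) auto
next
  case (Suc m)
  show ?case
  proof (cases "\<forall>i\<in>I. f i m = 0")
    case True
    obtain c where c: "\<exists>i\<in>I. c i \<noteq> 0" "\<forall>k<m. (\<Sum>i\<in>I. c i * f i k) = 0"
      using Suc.IH[of I f] Suc.prems by auto
    have "(\<Sum>i\<in>I. c i * f i m) = 0" using True by simp
    with c show ?thesis by (intro exI[of _ c]) (auto simp: less_Suc_eq)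
  next
    case False
    then obtain j where j: "j \<in> I" "f j m \<noteq> 0" by auto
    define g where "g = (\<lambda>i k. f i k - f i m / f j m * f j k)"
    obtain c where c: "\<exists>i\<in>I - {j}. c i \<noteq> 0" "\<forall>k<m. (\<Sum>i\<in>I - {j}. c i * g i k) = 0"
      using Suc.IH[of "I - {j}" g] Suc.prems j card_Diff_singleton[OF j(1)] by fastforce
    define c' where "c' = c(j := - (\<Sum>i\<in>I - {j}. c i * f i m / f j m))"
    have s: "(\<Sum>i\<in>I. c' i * f i k) = (\<Sum>i\<in>I - {j}. c i * g i k)" for k
    proof -
      have "(\<Sum>i\<in>I. c' i * f i k) = c' j * f j k + (\<Sum>i\<in>I - {j}. c' i * f i k)"
        using Suc.prems j by (simp add: sum.remove)
      also have "(\<Sum>i\<in>I - {j}. c' i * f i k) = (\<Sum>i\<in>I - {j}. c i * f i k)"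
        by (rule sum.cong) (auto simp: c'_def)
      finally show ?thesis
        by (simp add: g_def c'_def algebra_simps sum_subtractf sum_distrib_left sum_distrib_right)
    qed
    have "g i m = 0" for i using j by (simp add: g_def)
    then have "(\<Sum>i\<in>I. c' i * f i k) = 0" if "k < Suc m" for k
      unfolding s using c(2) that by (cases "k = m") auto
    moreover have "\<exists>i\<in>I. c' i \<noteq> 0" using c(1) by (auto simp: c'_def)
    ultimately show ?thesis by blast
  qed
qed

lemma uncountable_open: "open S \<Longrightarrow> S \<noteq> {} \<Longrightarrow> uncountable S" for S :: "complex set"
  using uncountable_ball by (metis countable_subset ex_in_conv open_contains_ball)

lemma monomials_reduce:
  fixes y1 y2 d :: "complex \<Rightarrow> complex" and A B D :: "complex poly"
  assumes "\<And>t. t \<in> V \<Longrightarrow> y1 t ^ 2 = poly A t * y1 t - poly B t" "\<And>t. t \<in> V \<Longrightarrow> y2 t = poly A t - y1 t"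
    and M: "degree A \<le> M" "degree B \<le> M" "degree D \<le> M"
  shows "\<exists>u v. degree u \<le> M * (a + b + e) \<and> degree v \<le> M * (a + b + e) \<and>
     (\<forall>t\<in>V. y1 t ^ a * y2 t ^ b * poly D t ^ e = poly u t + poly v t * y1 t)"
proof -
  define R where "R = (\<lambda>k F. \<exists>u v :: complex poly. degree u \<le> M * k \<and> degree v \<le> M * k \<and> (\<forall>t\<in>V. F t = poly u t + poly v t * y1 t))"
  have deg_mult: "degree (p * q) \<le> M * Suc k" if "degree p \<le> M * k" "degree q \<le> M" for p q :: "complex poly" and k
    using degree_mult_le[of p q] that by simp
  have deg_mono: "degree p \<le> M * Suc k" if "degree p \<le> M * k" for p :: "complex poly" and k
    using that by simp
  have R1: "R (Suc k) (\<lambda>t. F t * y1 t)" if "R k F" for k F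
  proof -
    from that obtain u v where uv: "degree u \<le> M * k" "degree v \<le> M * k" "\<forall>t\<in>V. F t = poly u t + poly v t * y1 t"
      by (auto simp: R_def)
    have "F t * y1 t = poly (- (v * B)) t + poly (u + v * A) t * y1 t" if "t \<in> V" for t
    proof -
      have "F t * y1 t = poly u t * y1 t + poly v t * y1 t ^ 2"
        using uv(3) that by (simp add: algebra_simps power2_eq_square)
      then show ?thesis using assms(1)[OF that] by (simp add: algebra_simps)
    qed
    moreover have "degree (v * B) \<le> M * Suc k" "degree (v * A) \<le> M * Suc k" "degree u \<le> M * Suc k"
      using deg_mult[OF uv(2) M(2)] deg_mult[OF uv(2) M(1)] deg_mono[OF uv(1)] .
    ultimately show ?thesis unfolding R_def
      by (rule_tac exI[of _ "- (v * B)"], rule_tac exI[of _ "u + v * A"]) (auto intro!: degree_add_le simp del: mult_Suc_right)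
  qed
  have R2: "R (Suc k) (\<lambda>t. F t * y2 t)" if "R k F" for k F
  proof -
    from that obtain u v where uv: "degree u \<le> M * k" "degree v \<le> M * k" "\<forall>t\<in>V. F t = poly u t + poly v t * y1 t"
      by (auto simp: R_def)
    have "F t * y2 t = poly (u * A + v * B) t + poly (- u) t * y1 t" if "t \<in> V" for t
    proof -
      have "F t * y2 t = poly u t * poly A t + poly v t * poly A t * y1 t - poly u t * y1 t - poly v t * y1 t ^ 2"
        unfolding uv(3)[rule_format, OF that] assms(2)[OF that] by (simp add: algebra_simps power2_eq_square)
      then show ?thesis using assms(1)[OF that] by (simp add: algebra_simps)
    qed
    moreover have "degree (v * B) \<le> M * Suc k" "degree (u * A) \<le> M * Suc k" "degree u \<le> M * Suc k"
      using deg_mult[OF uv(2) M(2)] deg_mult[OF uv(1) M(1)] deg_mono[OF uv(1)] .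
    ultimately show ?thesis unfolding R_def
      by (rule_tac exI[of _ "u * A + v * B"], rule_tac exI[of _ "- u"]) (auto intro!: degree_add_le simp del: mult_Suc_right)
  qed
  have R3: "R (Suc k) (\<lambda>t. F t * poly D t)" if "R k F" for k F
  proof -
    from that obtain u v where uv: "degree u \<le> M * k" "degree v \<le> M * k" "\<forall>t\<in>V. F t = poly u t + poly v t * y1 t"
      by (auto simp: R_def)
    have F: "\<forall>t\<in>V. F t * poly D t = poly (u * D) t + poly (v * D) t * y1 t"
      using uv(3) by (simp add: algebra_simps)
    show ?thesis unfolding R_def
      by (rule exI, rule exI, intro conjI) (rule deg_mult[OF uv(1) M(3)] deg_mult[OF uv(2) M(3)] F)+
  qed
  have "R 0 (\<lambda>t. 1)" unfolding R_def by (rule_tac exI[of _ 1], rule_tac exI[of _ 0]) auto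
  then have A: "R a (\<lambda>t. y1 t ^ a)"
  proof (induction a)
    case (Suc a)
    show ?case using R1[OF Suc.IH[OF Suc.prems]] by (simp add: mult.commute)
  qed simp
  have B: "R (a + b) (\<lambda>t. y1 t ^ a * y2 t ^ b)"
  proof (induction b)
    case (Suc b)
    show ?case using R2[OF Suc.IH] by (simp add: mult_ac)
  qed (simp add: A)
  have "R (a + b + e) (\<lambda>t. y1 t ^ a * y2 t ^ b * poly D t ^ e)"
  proof (induction e)
    case (Suc e)
    show ?case using R3[OF Suc.IH] by (simp add: mult_ac)
  qed (simp add: B)
  then show ?thesis by (simp add: R_def)
qed

text \<open>A dimension count: multiplied by D^(2N), the (N + 1)^2 monomials lie among the functions
  u + v y1 with deg u, deg v <= K = 2 M N, a family with 2 (K + 1) coefficients.\<close>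

lemma algebraic_relation:
  fixes j1 j2 :: "complex \<Rightarrow> complex"
  assumes U: "open U" "connected U" "U \<noteq> {}" and hol: "j1 holomorphic_on U" "j2 holomorphic_on U"
    and rat: "rational_on U (\<lambda>t. j1 t + j2 t)" "rational_on U (\<lambda>t. j1 t * j2 t)"
  obtains N :: nat and c :: "nat \<times> nat \<Rightarrow> complex" where "\<exists>i\<in>{..N}\<times>{..N}. c i \<noteq> 0"
    "\<forall>t\<in>U. (\<Sum>i\<in>{..N}\<times>{..N}. c i * (j1 t ^ fst i * j2 t ^ snd i)) = 0"
proof -
  obtain p1 q1 where 1: "q1 \<noteq> 0" "\<And>t. t \<in> U \<Longrightarrow> poly q1 t \<noteq> 0 \<Longrightarrow> j1 t + j2 t = poly p1 t / poly q1 t"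
    using rat(1) by (auto simp: rational_on_def)
  obtain p2 q2 where 2: "q2 \<noteq> 0" "\<And>t. t \<in> U \<Longrightarrow> poly q2 t \<noteq> 0 \<Longrightarrow> j1 t * j2 t = poly p2 t / poly q2 t"
    using rat(2) by (auto simp: rational_on_def)
  \<comment> \<open>With D = q1 q2, the functions D j1 and D j2 have the polynomial sum A and the
    polynomial product B.\<close>
  define D A B where "D = q1 * q2" and "A = p1 * q2" and "B = p2 * q1 * D"
  define V where "V = {t \<in> U. poly D t \<noteq> 0}"
  define M where "M = max (degree A) (max (degree B) (degree D))"
  \<comment> \<open>For this N the number of monomials is 4 M N + 3 N + 1, which exceeds 2 (2 M N +
    1).\<close>
  define N where "N = 4 * M + 1"
  define y1 y2 where "y1 = (\<lambda>t. poly D t * j1 t)" and "y2 = (\<lambda>t. poly D t * j2 t)"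
  have V: "poly q1 t \<noteq> 0" "poly q2 t \<noteq> 0" "poly D t \<noteq> 0" "t \<in> U" if "t \<in> V" for t using that by (auto simp: V_def D_def)
  have s: "y2 t = poly A t - y1 t" if "t \<in> V" for t
  proof -
    have "y1 t + y2 t = poly D t * (j1 t + j2 t)" by (simp add: y1_def y2_def algebra_simps)
    also have "\<dots> = poly A t" using 1(2) V[OF that] by (simp add: A_def D_def)
    finally show ?thesis by (simp add: algebra_simps)
  qed
  have p: "y1 t * y2 t = poly B t" if "t \<in> V" for t
  proof -
    have "y1 t * y2 t = poly D t * poly D t * (j1 t * j2 t)" by (simp add: y1_def y2_def algebra_simps)
    also have "\<dots> = poly B t" using 2(2) V[OF that] by (simp add: B_def D_def)
    finally show ?thesis .
  qed
  have q: "y1 t ^ 2 = poly A t * y1 t - poly B t" if "t \<in> V" for t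
    using p[OF that] s[OF that] by (simp add: algebra_simps power2_eq_square)
  have "\<forall>i. \<exists>u v. fst i + snd i \<le> 2 * N \<longrightarrow> degree u \<le> M * (2 * N) \<and> degree v \<le> M * (2 * N) \<and>
     (\<forall>t\<in>V. poly D t ^ (2 * N) * (j1 t ^ fst i * j2 t ^ snd i) = poly u t + poly v t * y1 t)"
  proof
    fix i :: "nat \<times> nat"
    obtain a b where i: "i = (a, b)" by (cases i)
    show "\<exists>u v. fst i + snd i \<le> 2 * N \<longrightarrow> degree u \<le> M * (2 * N) \<and> degree v \<le> M * (2 * N) \<and>
     (\<forall>t\<in>V. poly D t ^ (2 * N) * (j1 t ^ fst i * j2 t ^ snd i) = poly u t + poly v t * y1 t)"
    proof (cases "a + b \<le> 2 * N")
      case True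
      define e where "e = 2 * N - (a + b)"
      have e: "a + b + e = 2 * N" using True by (simp add: e_def)
      have "poly D t ^ (2 * N) * (j1 t ^ a * j2 t ^ b) = y1 t ^ a * y2 t ^ b * poly D t ^ e" for t
        unfolding e[symmetric] y1_def y2_def by (simp add: power_add power_mult_distrib)
      then show ?thesis
        using monomials_reduce[OF q s, of V M D a b e] unfolding e i M_def by simp
    qed (simp add: i)
  qed
  then obtain u v where uv: "\<And>i. fst i + snd i \<le> 2 * N \<Longrightarrow> degree (u i) \<le> M * (2 * N) \<and> degree (v i) \<le> M * (2 * N) \<and>
     (\<forall>t\<in>V. poly D t ^ (2 * N) * (j1 t ^ fst i * j2 t ^ snd i) = poly (u i) t + poly (v i) t * y1 t)"
    by metis
  define K where "K = M * (2 * N)"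
  let ?I = "{..N} \<times> {..N}"
  have card: "2 * Suc K < card ?I"
    by (simp add: K_def N_def algebra_simps)
  define f where "f = (\<lambda>i k. if k \<le> K then coeff (u i) k else coeff (v i) (k - Suc K))"
  have "\<exists>c. (\<exists>i\<in>?I. c i \<noteq> 0) \<and> (\<forall>k<2 * Suc K. (\<Sum>i\<in>?I. c i * f i k) = 0)"
    by (rule homogeneous_system_nontrivial[OF _ card]) simp
  then obtain c where c: "\<exists>i\<in>?I. c i \<noteq> 0" "\<forall>k<2 * Suc K. (\<Sum>i\<in>?I. c i * f i k) = 0" by (elim exE conjE)
  have le: "fst i + snd i \<le> 2 * N" if "i \<in> ?I" for i using that by auto
  have "(\<Sum>i\<in>?I. smult (c i) (u i)) = 0"
  proof (rule poly_eqI)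
    fix k show "coeff (\<Sum>i\<in>?I. smult (c i) (u i)) k = coeff 0 k"
    proof (cases "k \<le> K")
      case True then show ?thesis using c(2)[rule_format, of k] by (simp add: coeff_sum f_def)
    next
      case False
      then have "coeff (u i) k = 0" if "i \<in> ?I" for i using uv[OF le[OF that]] by (intro coeff_eq_0) (auto simp: K_def)
      then show ?thesis by (simp add: coeff_sum)
    qed
  qed
  then have su: "(\<Sum>i\<in>?I. c i * poly (u i) t) = 0" for t
    by (metis (no_types, lifting) poly_0 poly_smult poly_sum sum.cong)
  have "(\<Sum>i\<in>?I. smult (c i) (v i)) = 0"
  proof (rule poly_eqI)
    fix k show "coeff (\<Sum>i\<in>?I. smult (c i) (v i)) k = coeff 0 k"
    proof (cases "k \<le> K")
      case True then show ?thesis using c(2)[rule_format, of "k + Suc K"] by (simp add: coeff_sum f_def)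
    next
      case False
      then have "coeff (v i) k = 0" if "i \<in> ?I" for i using uv[OF le[OF that]] by (intro coeff_eq_0) (auto simp: K_def)
      then show ?thesis by (simp add: coeff_sum)
    qed
  qed
  then have sv: "(\<Sum>i\<in>?I. c i * poly (v i) t) = 0" for t
    by (metis (no_types, lifting) poly_0 poly_smult poly_sum sum.cong)
  let ?F = "\<lambda>t. \<Sum>i\<in>?I. c i * (j1 t ^ fst i * j2 t ^ snd i)"
  have FV: "?F t = 0" if t: "t \<in> V" for t
  proof -
    have "poly D t ^ (2 * N) * ?F t = (\<Sum>i\<in>?I. c i * (poly D t ^ (2 * N) * (j1 t ^ fst i * j2 t ^ snd i)))"
      by (simp add: sum_distrib_left mult_ac)
    also have "\<dots> = (\<Sum>i\<in>?I. c i * poly (u i) t + c i * poly (v i) t * y1 t)"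
    proof (rule sum.cong)
      fix i assume "i \<in> ?I"
      then show "c i * (poly D t ^ (2 * N) * (j1 t ^ fst i * j2 t ^ snd i)) = c i * poly (u i) t + c i * poly (v i) t * y1 t"
        using uv[OF le] t by (simp add: algebra_simps)
    qed simp
    also have "\<dots> = 0" using su sv by (simp add: sum.distrib flip: sum_distrib_right)
    finally show ?thesis using V(3)[OF t] by simp
  qed
  have fin: "finite {t. poly D t = 0}" using 1(1) 2(1) by (intro poly_roots_finite) (simp add: D_def)
  have "U \<subseteq> {t \<in> U. ?F t = 0}"
  proof (rule holomorphic_countable_equal[OF _ _ U(1,2) open_imp_fsigma[OF U(1)]])
    have "uncountable (U - {t. poly D t = 0})"
      using uncountable_open[OF U(1,3)] fin by (simp add: uncountable_minus_countable countable_finite)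
    moreover have "U - {t. poly D t = 0} \<subseteq> {t \<in> U. ?F t = 0}" using FV by (auto simp: V_def)
    ultimately show "uncountable {t \<in> U. ?F t = 0}" using countable_subset by blast
  qed (intro holomorphic_intros hol)+
  then show ?thesis using c(1) by (intro that[of N c]) blast+
qed

section \<open>The natural boundary\<close>

definition bipoly :: "nat \<Rightarrow> (nat \<times> nat \<Rightarrow> complex) \<Rightarrow> complex \<Rightarrow> complex \<Rightarrow> complex" where
  "bipoly N k x y = (\<Sum>i\<in>{..N}\<times>{..N}. k i * (x ^ fst i * y ^ snd i))"

lemma bipoly_alt: "bipoly N k x y = (\<Sum>a\<le>N. (\<Sum>b\<le>N. k (a, b) * y ^ b) * x ^ a)"
proof -
  have "(\<Sum>a\<le>N. (\<Sum>b\<le>N. k (a, b) * y ^ b) * x ^ a) = (\<Sum>a\<le>N. \<Sum>b\<le>N. k (a, b) * (x ^ a * y ^ b))"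
    by (simp add: sum_distrib_right sum_distrib_left mult_ac)
  then show ?thesis unfolding bipoly_def by (simp add: sum.cartesian_product case_prod_unfold)
qed

lemma bipoly_swap: "bipoly N (\<lambda>(a, b). k (b, a)) x y = bipoly N k y x"
proof -
  have "bipoly N k y x = (\<Sum>i\<in>{..N}\<times>{..N}. k (snd i, fst i) * (y ^ snd i * x ^ fst i))"
    unfolding bipoly_def
    by (rule sum.reindex_bij_witness[where i = "\<lambda>(a,b). (b,a)" and j = "\<lambda>(a,b). (b,a)"]) auto
  then show ?thesis unfolding bipoly_def by (simp add: case_prod_unfold mult.commute)
qed

lemma polyfun_zero:
  fixes e :: "nat \<Rightarrow> complex"
  assumes "\<And>x. (\<Sum>a\<le>N. e a * x ^ a) = 0" "a \<le> N"
  shows "e a = 0"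
proof -
  define p where "p = (\<Sum>a\<le>N. monom (e a) a)"
  have "poly p x = 0" for x using assms(1)[of x] by (simp add: p_def poly_sum poly_monom)
  then have "p = 0" by (simp add: poly_all_0_iff_0[symmetric])
  then have "coeff p a = 0" by simp
  then show ?thesis using assms(2) by (simp add: p_def coeff_sum sum.delta)
qed

lemma holomorphic_eq_0_of_uncountable:
  assumes "f holomorphic_on S" "open S" "connected S" "uncountable A" "A \<subseteq> S" "\<And>z. z \<in> A \<Longrightarrow> f z = 0" "z \<in> S"
  shows "f z = (0 :: complex)"
proof -
  have "A \<subseteq> {z \<in> S. f z = 0}" using assms by auto
  then have "uncountable {z \<in> S. f z = 0}" using assms(4) countable_subset by blast
  then have "S \<subseteq> {z \<in> S. f z = 0}"
    by (intro holomorphic_countable_equal[OF assms(1) _ assms(2,3) open_imp_fsigma[OF assms(2)]]) auto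
  then show ?thesis using assms(7) by blast
qed

text \<open>\<open>modJ\<close> takes every complex value, so a polynomial relation satisfied by
  \<open>modJ\<close> alone is an identically vanishing polynomial.\<close>

lemma modJ_polyfun_zero:
  assumes "uncountable A" "A \<subseteq> uhp" "\<And>z. z \<in> A \<Longrightarrow> (\<Sum>a\<le>N. e a * modJ z ^ a) = 0" "a \<le> N"
  shows "e a = 0"
proof (rule polyfun_zero[OF _ assms(4)])
  fix x
  have "x \<in> modJ ` uhp" using modJ_surj by simp
  then obtain z where z: "z \<in> uhp" "x = modJ z" by blast
  have "(\<lambda>z. \<Sum>a\<le>N. e a * modJ z ^ a) holomorphic_on uhp" by (intro holomorphic_intros holomorphic_modJ)
  from holomorphic_eq_0_of_uncountable[OF this open_uhp connected_uhp assms(1-3) z(1)]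
  show "(\<Sum>a\<le>N. e a * x ^ a) = 0" by (simp add: z(2))
qed

lemma holomorphic_bipoly_modJ:
  assumes "f holomorphic_on S" "f ` S \<subseteq> uhp" "g holomorphic_on S" "g ` S \<subseteq> uhp"
  shows "(\<lambda>z. bipoly N k (modJ (f z)) (modJ (g z))) holomorphic_on S"
proof -
  have "(modJ \<circ> f) holomorphic_on S" "(modJ \<circ> g) holomorphic_on S"
    using assms by (auto intro: holomorphic_on_compose_gen[OF _ holomorphic_modJ])
  then show ?thesis unfolding bipoly_def o_def by (intro holomorphic_intros)
qed

text \<open>A group element with first column (p, q) sends infinity to p/q. It is applied to the
  translates s + m, which tend to infinity while \<open>modJ\<close> keeps its value.\<close>

lemma orbit_tendsto_rational:
  assumes "r \<in> \<rat>" "Im s > 0"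
  obtains w where "\<And>m. Im (w m) > 0" "\<And>m. modJ (w m) = modJ s" "w \<longlonglongrightarrow> of_real r"
proof -
  obtain p q :: int where pq: "q > 0" "coprime p q" "r = of_int p / of_int q"
    using Rats_cases'[OF assms(1)] by metis
  obtain u v where "u * p + v * q = 1" using bezout_int[of p q] pq(2) by (auto simp: coprime_iff_gcd_eq_1)
  then have g: "(p, - v, q, u) \<in> SL2Z" by (simp add: SL2Z_def algebra_simps)
  define w where "w = (\<lambda>m::nat. act (p, - v, q, u) (s + of_nat m))"
  have i: "Im (s + of_nat m) > 0" for m using assms(2) by simp
  have T: "modJ (s + of_nat m) = modJ s" for m
    using modJ_act[OF act_translate(1)[of "int m"] assms(2)] by (simp add: act_translate)
  show ?thesis
  proof (rule that[of w])
    show "Im (w m) > 0" for m unfolding w_def by (rule Im_act[OF g i])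
    show "modJ (w m) = modJ s" for m unfolding w_def by (simp add: modJ_act[OF g i] T)
    have inv: "(\<lambda>m. inverse (s + of_nat m)) \<longlonglongrightarrow> 0"
    proof (rule Lim_null_comparison)
      show "\<forall>\<^sub>F m in sequentially. norm (inverse (s + of_nat m)) \<le> inverse (Re s + real m)"
        using eventually_gt_at_top[of "nat \<lceil>\<bar>Re s\<bar>\<rceil>"]
      proof eventually_elim
        case (elim m)
        then have pos: "Re s + real m > 0" by linarith
        have "Re s + real m \<le> norm (s + of_nat m)" using complex_Re_le_cmod[of "s + of_nat m"] by simp
        then show ?case using pos by (simp add: norm_inverse le_imp_inverse_le)
      qed
      show "(\<lambda>m. inverse (Re s + real m)) \<longlonglongrightarrow> 0"
        by (intro tendsto_inverse_0_at_top filterlim_tendsto_add_at_top[OF tendsto_const] filterlim_real_sequentially)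
    qed
    have "(\<lambda>m. (of_int p + of_int (- v) * inverse (s + of_nat m)) / (of_int q + of_int u * inverse (s + of_nat m)))
       \<longlonglongrightarrow> (of_int p + of_int (- v) * 0) / (of_int q + of_int u * 0)"
      by (intro tendsto_intros inv) (use pq in auto)
    moreover have "(of_int p + of_int (- v) * inverse (s + of_nat m)) / (of_int q + of_int u * inverse (s + of_nat m)) = w m" for m
    proof -
      have "s + of_nat m \<noteq> 0" using i[of m] by (metis less_irrefl zero_complex.sel(2))
      then have "(of_int p + of_int (- v) * inverse (s + of_nat m)) = (of_int p * (s + of_nat m) + of_int (- v)) / (s + of_nat m)"
        "(of_int q + of_int u * inverse (s + of_nat m)) = (of_int q * (s + of_nat m) + of_int u) / (s + of_nat m)"
        by (simp_all add: field_simps)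
      then show ?thesis using \<open>s + of_nat m \<noteq> 0\<close> by (simp add: w_def act_def)
    qed
    ultimately show "w \<longlonglongrightarrow> of_real r" by (simp add: pq(3))
  qed
qed

text \<open>An orbit on which \<open>modJ\<close> has any prescribed value accumulates at each rational boundary point,
  so the relation persists there with its first argument arbitrary.\<close>
lemma natural_boundary:
  assumes W: "open W" "convex W" and f: "f holomorphic_on W" "f ` W \<subseteq> uhp" "inj_on f W"
    and V: "open V" "V \<noteq> {}" "V \<subseteq> W \<inter> uhp" "\<And>z. z \<in> V \<Longrightarrow> bipoly N k (modJ z) (modJ (f z)) = 0"
    and x: "of_real x \<in> W" and ab: "a \<le> N" "b \<le> N"
  shows "k (a, b) = 0"
proof -
  have Wu: "open (W \<inter> uhp)" "connected (W \<inter> uhp)"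
    using W open_uhp convex_uhp by (auto intro: convex_connected convex_Int)
  have F0: "bipoly N k (modJ z) (modJ (f z)) = 0" if "z \<in> W \<inter> uhp" for z
  proof (rule holomorphic_eq_0_of_uncountable[OF _ Wu uncountable_open[OF V(1,2)] V(3,4) that])
    show "(\<lambda>z. bipoly N k (modJ z) (modJ (f z))) holomorphic_on W \<inter> uhp"
      using f by (intro holomorphic_bipoly_modJ) (auto intro: holomorphic_on_subset)
  qed
  have Jf: "(\<lambda>z. modJ (f z)) holomorphic_on W"
    using holomorphic_on_compose_gen[OF f(1) holomorphic_modJ f(2)] by (simp add: o_def)
  \<comment> \<open>In the limit the second argument is fixed at modJ (f r) and the first is an
    arbitrary c0, so every coefficient in the first variable vanishes.\<close>
  have rat: "(\<Sum>b\<le>N. k (a, b) * modJ (f (of_real r)) ^ b) = 0" if r: "r \<in> \<rat>" "of_real r \<in> W" "a \<le> N" for r a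
  proof (rule polyfun_zero[OF _ r(3)])
    fix c0 :: complex
    have "c0 \<in> modJ ` uhp" using modJ_surj by simp
    then obtain s where s: "Im s > 0" "c0 = modJ s" by blast
    obtain w where w: "\<And>m. Im (w m) > 0" "\<And>m. modJ (w m) = modJ s" "w \<longlonglongrightarrow> of_real r"
      using orbit_tendsto_rational[OF r(1) s(1)] by metis
    have "isCont (\<lambda>z. modJ (f z)) (of_real r)"
      using holomorphic_on_imp_continuous_on[OF Jf] W(1) r(2) by (simp add: continuous_on_eq_continuous_at)
    then have lim: "(\<lambda>m. modJ (f (w m))) \<longlonglongrightarrow> modJ (f (of_real r))"
      by (rule isCont_tendsto_compose[OF _ w(3)])
    have "(\<lambda>m. bipoly N k c0 (modJ (f (w m)))) \<longlonglongrightarrow> bipoly N k c0 (modJ (f (of_real r)))"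
      unfolding bipoly_def by (intro tendsto_intros lim)
    moreover have "\<forall>\<^sub>F m in sequentially. bipoly N k c0 (modJ (f (w m))) = 0"
    proof -
      have "\<forall>\<^sub>F m in sequentially. w m \<in> W" using topological_tendstoD[OF w(3) W(1) r(2)] .
      then show ?thesis
      proof eventually_elim
        case (elim m)
        then show ?case using F0[of "w m"] w(1,2)[of m] s by simp
      qed
    qed
    ultimately have "bipoly N k c0 (modJ (f (of_real r))) = 0"
      using tendsto_unique[OF sequentially_bot] tendsto_eventually by metis
    then show "(\<Sum>a\<le>N. (\<Sum>b\<le>N. k (a, b) * modJ (f (of_real r)) ^ b) * c0 ^ a) = 0" by (simp add: bipoly_alt)
  qed
  \<comment> \<open>Rational points accumulate at x inside W, so the coefficients vanish on all of
    W; there f takes uncountably many values, which makes \<open>modJ_polyfun_zero\<close>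
    applicable.\<close>
  have G0: "(\<Sum>b\<le>N. k (a, b) * modJ (f z) ^ b) = 0" if z: "z \<in> W" for z
  proof (rule analytic_continuation[of "\<lambda>z. \<Sum>b\<le>N. k (a, b) * modJ (f z) ^ b" W "{z \<in> W. \<exists>r\<in>\<rat>. z = of_real r}" "of_real x"])
    show "(\<lambda>z. \<Sum>b\<le>N. k (a, b) * modJ (f z) ^ b) holomorphic_on W" by (intro holomorphic_intros Jf)
    obtain e where e: "e > 0" "ball (of_real x) e \<subseteq> W" using W(1) x open_contains_ball by blast
    show "complex_of_real x islimpt {z \<in> W. \<exists>r\<in>\<rat>. z = of_real r}"
      unfolding islimpt_approachable
    proof (intro allI impI)
      fix d :: real assume d: "d > 0"
      obtain r where r: "r \<in> \<rat>" "x < r" "r < x + min d e" using Rats_dense_in_real[of x "x + min d e"] d e(1) by auto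
      have dist: "dist (complex_of_real r) (of_real x) < min d e"
      proof -
        have "0 < r - x" "r - x < min d e" using r(2,3) by linarith+
        then show ?thesis by (simp add: dist_norm flip: of_real_diff)
      qed
      then have "of_real r \<in> W" using e(2) by (auto simp: dist_commute subset_iff)
      then show "\<exists>x'\<in>{z \<in> W. \<exists>r\<in>\<rat>. z = of_real r}. x' \<noteq> complex_of_real x \<and> dist x' (complex_of_real x) < d"
        using r dist by (intro bexI[of _ "of_real r"]) auto
    qed
  qed (use W x z rat ab convex_connected in auto)
  have "uncountable (f ` W)"
    using f(3) uncountable_open[OF W(1)] x by (auto simp: countable_image_inj_eq)
  from modJ_polyfun_zero[OF this f(2), where e = "\<lambda>b. k (a, b)" and N = N and a = b] G0 ab
  show ?thesis by auto
qed

section \<open>Moebius transformations and the upper half-plane\<close>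

definition moeb :: "complex \<Rightarrow> complex \<Rightarrow> complex \<Rightarrow> complex \<Rightarrow> complex \<Rightarrow> complex" where
  "moeb a b c d z = (a * z + b) / (c * z + d)"

text \<open>The numerator of the imaginary part: \<open>Im (moeb a b c d z) = moeb_im a b c d z / (norm (c * z + d))\<^sup>2\<close>.\<close>
definition moeb_im :: "complex \<Rightarrow> complex \<Rightarrow> complex \<Rightarrow> complex \<Rightarrow> complex \<Rightarrow> real" where
  "moeb_im a b c d z = Im ((a * z + b) * cnj (c * z + d))"

lemma Im_moeb: "Im (moeb a b c d z) = moeb_im a b c d z / norm (c * z + d) ^ 2"
proof -
  have "moeb a b c d z = (a * z + b) * cnj (c * z + d) / of_real (norm (c * z + d) ^ 2)"
    unfolding moeb_def by (rule complex_div_cnj)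
  then show ?thesis unfolding moeb_im_def by (simp only: Im_divide_of_real)
qed

lemma Im_moeb_pos_iff: "c * z + d \<noteq> 0 \<Longrightarrow> Im (moeb a b c d z) > 0 \<longleftrightarrow> moeb_im a b c d z > 0"
  unfolding Im_moeb by (simp add: zero_less_divide_iff)

lemma moeb_im_nonzero: "moeb_im a b c d z > 0 \<Longrightarrow> c * z + d \<noteq> 0"
proof
  assume p: "moeb_im a b c d z > 0" and 0: "c * z + d = 0"
  have "moeb_im a b c d z = 0" unfolding moeb_im_def 0 by simp
  with p show False by simp
qed

lemma moeb_im_expand:
  "moeb_im a b c d z = Im (a * cnj c) * (Re z ^ 2 + Im z ^ 2) + Im (a * cnj d + b * cnj c) * Re z
     + Re (a * cnj d - b * cnj c) * Im z + Im (b * cnj d)"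
  by (simp add: moeb_im_def power2_eq_square algebra_simps)

lemma inj_on_moeb:
  assumes "a * d - b * c = 1" "\<And>z. z \<in> S \<Longrightarrow> c * z + d \<noteq> 0"
  shows "inj_on (moeb a b c d) S"
proof (rule inj_onI)
  fix x y assume xy: "x \<in> S" "y \<in> S" "moeb a b c d x = moeb a b c d y"
  then have "(a * x + b) * (c * y + d) = (a * y + b) * (c * x + d)"
    using assms(2)[OF xy(1)] assms(2)[OF xy(2)] by (simp add: moeb_def frac_eq_eq)
  then have "(a * d - b * c) * (x - y) = 0" by (simp add: algebra_simps)
  then show "x = y" using assms(1) by simp
qed

lemma holomorphic_moeb: "(\<And>z. z \<in> S \<Longrightarrow> c * z + d \<noteq> 0) \<Longrightarrow> moeb a b c d holomorphic_on S"
  unfolding moeb_def[abs_def] by (intro holomorphic_intros)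

lemma open_moeb_im_pos: "open {z. moeb_im a b c d z > 0}"
  unfolding moeb_im_expand by (intro open_Collect_less continuous_intros)

text \<open>The region where \<open>moeb_im\<close> is positive is a disc, a half-plane or the
  exterior of a circle, according to the sign of the coefficient A of |z|^2. For A <= 0 it is
  convex; for A > 0 it contains the half-plane where a tangent plane of the graph is positive. A
  convex part that contains a point of V and a real point contradicts
  \<open>natural_boundary\<close>.\<close>

lemma natural_boundary_moeb:
  assumes det: "a * d - b * c = 1"
    and V: "open V" "s \<in> V" "V \<subseteq> uhp" "\<And>z. z \<in> V \<Longrightarrow> bipoly N k (modJ z) (modJ (moeb a b c d z)) = 0"
    and s: "moeb_im a b c d s > 0" and k: "\<exists>i\<in>{..N}\<times>{..N}. k i \<noteq> 0"
  shows "Im (a * cnj c) \<le> 0" and "moeb_im a b c d (of_real x) \<le> 0"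
proof -
  obtain i j where ij: "i \<le> N" "j \<le> N" "k (i, j) \<noteq> 0" using k by auto
  let ?Q = "moeb_im a b c d" and ?f = "moeb a b c d"
  define A where "A = Im (a * cnj c)"
  define \<kappa> where "\<kappa> = Im (a * cnj d + b * cnj c)"
  define \<rho> where "\<rho> = Re (a * cnj d - b * cnj c)"
  define D where "D = Im (b * cnj d)"
  have Q: "?Q z = A * (Re z ^ 2 + Im z ^ 2) + \<kappa> * Re z + \<rho> * Im z + D" for z
    unfolding A_def \<kappa>_def \<rho>_def D_def by (rule moeb_im_expand)
  have nb: False if W: "open W" "convex W" "\<And>z. z \<in> W \<Longrightarrow> ?Q z > 0" "s1 \<in> W" "s1 \<in> V" "of_real x \<in> W" for W x s1
  proof -
    have nz: "c * z + d \<noteq> 0" if "z \<in> W" for z using moeb_im_nonzero W(3)[OF that] .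
    have im: "?f ` W \<subseteq> uhp" using Im_moeb_pos_iff[OF nz] W(3) by auto
    have "k (i, j) = 0"
      by (rule natural_boundary[OF W(1,2) holomorphic_moeb[OF nz] im inj_on_moeb[OF det nz], of "V \<inter> W" N k x i j])
         (use W V ij in auto)
    then show False using ij(3) by simp
  qed
  show A0: "Im (a * cnj c) \<le> 0"
  proof (rule ccontr)
    assume "\<not> Im (a * cnj c) \<le> 0"
    then have A: "A > 0" by (simp add: A_def)
    have "open (V \<inter> {z. ?Q z > 0})" using V(1) open_moeb_im_pos by auto
    moreover have "s \<in> V \<inter> {z. ?Q z > 0}" using V s by auto
    ultimately obtain e where e: "e > 0" "ball s e \<subseteq> V \<inter> {z. ?Q z > 0}" by (meson open_contains_ball)
    \<comment> \<open>The perturbation makes p nonzero: the tangent half-plane is then not bounded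
      by a horizontal line, so it meets the real axis.\<close>
    obtain s1 where s1: "s1 \<in> ball s e" "2 * A * Re s1 + \<kappa> \<noteq> 0"
    proof (cases "2 * A * Re s + \<kappa> = 0")
      case True
      show ?thesis
      proof (rule that[of "s + of_real (e / 2)"])
        show "s + of_real (e / 2) \<in> ball s e" using e(1) by (simp add: dist_norm)
        have "2 * A * Re (s + of_real (e / 2)) + \<kappa> = A * e" using True by (simp add: algebra_simps)
        then show "2 * A * Re (s + of_real (e / 2)) + \<kappa> \<noteq> 0" using A e(1) by simp
      qed
    qed (use e(1) that[of s] in auto)
    define p q where "p = 2 * A * Re s1 + \<kappa>" and "q = 2 * A * Im s1 + \<rho>"
    \<comment> \<open>the tangent half-plane at \<open>s1\<close>, on which the convex function \<open>?Q\<close> is positive\<close>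
    define T where "T = (\<lambda>z. ?Q s1 + p * (Re z - Re s1) + q * (Im z - Im s1))"
    have QT: "?Q z = T z + A * ((Re z - Re s1) ^ 2 + (Im z - Im s1) ^ 2)" for z
      unfolding T_def Q p_def q_def by (simp add: power2_eq_square algebra_simps)
    have s1': "?Q s1 > 0" "s1 \<in> V" using s1 e(2) by auto
    have "{z. T z > 0} = {z. inner (Complex p q) z > p * Re s1 + q * Im s1 - ?Q s1}"
      by (auto simp: T_def inner_complex_def algebra_simps)
    then have "open {z. T z > 0}" "convex {z. T z > 0}"
      by (simp_all add: open_halfspace_gt convex_halfspace_gt)
    moreover have "?Q z > 0" if "z \<in> {z. T z > 0}" for z
    proof -
      have "A * ((Re z - Re s1) ^ 2 + (Im z - Im s1) ^ 2) \<ge> 0" using A by simp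
      then show ?thesis using QT[of z] that by simp
    qed
    moreover have "s1 \<in> {z. T z > 0}" using s1' by (simp add: T_def)
    \<comment> \<open>At this real point the two linear terms of \<open>T\<close> cancel, leaving
      its value at s1.\<close>
    moreover have "of_real (Re s1 + (q * Im s1) / p) \<in> {z. T z > 0}"
      using s1 s1' by (simp add: T_def p_def)
    ultimately show False by (rule nb[OF _ _ _ _ s1'(2)])
  qed
  show "?Q (of_real x) \<le> 0"
  proof (rule ccontr)
    assume "\<not> ?Q (of_real x) \<le> 0"
    then have x: "of_real x \<in> {z. ?Q z > 0}" by simp
    have A: "A \<le> 0" using A0 by (simp add: A_def)
    have "convex {z. ?Q z > 0}"
    proof (rule convexI)
      fix y z :: complex and u v :: real
      assume yz: "y \<in> {z. ?Q z > 0}" "z \<in> {z. ?Q z > 0}" and uv: "0 \<le> u" "0 \<le> v" "u + v = 1"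
      have v: "v = 1 - u" using uv by simp
      \<comment> \<open>Concavity in exact form: the defect is -A u v |y - z|^2, nonnegative for A
        <= 0.\<close>
      have "?Q (u *\<^sub>R y + v *\<^sub>R z) = u * ?Q y + v * ?Q z + (- A) * (u * v) * ((Re y - Re z) ^ 2 + (Im y - Im z) ^ 2)"
        unfolding Q v by (simp add: power2_eq_square algebra_simps)
      moreover have "(- A) * (u * v) * ((Re y - Re z) ^ 2 + (Im y - Im z) ^ 2) \<ge> 0" using A uv by (intro mult_nonneg_nonneg) auto
      moreover have "u * ?Q y + v * ?Q z > 0"
      proof (cases "u = 0")
        case False
        then have "u * ?Q y > 0" using uv yz by simp
        moreover have "v * ?Q z \<ge> 0" using uv yz by simp
        ultimately show ?thesis by linarith
      qed (use uv yz in auto)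
      ultimately show "u *\<^sub>R y + v *\<^sub>R z \<in> {z. ?Q z > 0}" by simp
    qed
    then show False by (rule nb[OF open_moeb_im_pos _ _ _ V(2) x]) (use s in simp_all)
  qed
qed

lemma moeb_inverse:
  assumes "a * d - b * c = 1" "c * z + d \<noteq> 0"
  shows "- c * moeb a b c d z + a = 1 / (c * z + d)" "moeb d (- b) (- c) a (moeb a b c d z) = z"
proof -
  have n: "- c * (a * z + b) + a * (c * z + d) = 1" "d * (a * z + b) + - b * (c * z + d) = z"
    using assms(1) by algebra+
  have "- c * moeb a b c d z + a = (- c * (a * z + b) + a * (c * z + d)) / (c * z + d)"
    using assms(2) by (simp add: moeb_def field_simps)
  then show 1: "- c * moeb a b c d z + a = 1 / (c * z + d)" unfolding n .
  have "d * moeb a b c d z + - b = (d * (a * z + b) + - b * (c * z + d)) / (c * z + d)"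
    using assms(2) by (simp add: moeb_def field_simps)
  then have "d * moeb a b c d z + - b = z / (c * z + d)" unfolding n .
  then show "moeb d (- b) (- c) a (moeb a b c d z) = z"
    using 1 assms(2) unfolding moeb_def[of d] by simp
qed

text \<open>The two boundary inequalities, for the transformation and its inverse, force it to preserve the half-plane.\<close>
lemma moeb_preserves_uhp_aux:
  assumes det: "a * d - b * c = 1" and s: "Im s > 0" "moeb_im a b c d s > 0"
    and Q: "Im (a * cnj c) \<le> 0" "\<And>x. moeb_im a b c d (of_real x) \<le> 0"
    and Q': "Im (d * cnj (- c)) \<le> 0" "\<And>x. moeb_im d (- b) (- c) a (of_real x) \<le> 0"
    and z: "Im z > 0"
  shows "c * z + d \<noteq> 0 \<and> Im (moeb a b c d z) > 0"
proof -
  \<comment> \<open>The coefficient of Im z, which is the same for the transformation and for its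
    inverse.\<close>
  define \<rho> where "\<rho> = Re (a * cnj d - b * cnj c)"
  have split: "moeb_im a b c d z = Im (a * cnj c) * Im z ^ 2 + moeb_im a b c d (of_real (Re z)) + \<rho> * Im z" for z
    unfolding moeb_im_expand \<rho>_def by (simp add: algebra_simps)
  have split': "moeb_im d (- b) (- c) a z = Im (d * cnj (- c)) * Im z ^ 2 + moeb_im d (- b) (- c) a (of_real (Re z)) + \<rho> * Im z" for z
    unfolding moeb_im_expand \<rho>_def by (simp add: algebra_simps)
  have le: "moeb_im a b c d z \<le> \<rho> * Im z" for z
    using split[of z] Q(2)[of "Re z"] mult_nonpos_nonneg[OF Q(1), of "Im z ^ 2"] by simp
  have le': "moeb_im d (- b) (- c) a z \<le> \<rho> * Im z" for z
    using split'[of z] Q'(2)[of "Re z"] mult_nonpos_nonneg[OF Q'(1), of "Im z ^ 2"] by simp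
  have \<rho>: "\<rho> > 0" using le[of s] s by (smt (verit) mult_nonpos_nonneg)
  \<comment> \<open>The upper bound \<open>le'\<close> for the inverse at the image point,
    transported back, becomes a lower bound for the transformation.\<close>
  have ge: "Im z \<le> \<rho> * moeb_im a b c d z" if nz: "c * z + d \<noteq> 0" for z
  proof -
    let ?w = "moeb a b c d z"
    note inv = moeb_inverse[OF det nz]
    have n: "norm (c * z + d) ^ 2 > 0" using nz by simp
    have "Im z = moeb_im d (- b) (- c) a ?w / norm (- c * ?w + a) ^ 2"
      using Im_moeb[of d "- b" "- c" a ?w] inv(2) by simp
    then have "Im z = moeb_im d (- b) (- c) a ?w * norm (c * z + d) ^ 2"
      unfolding inv(1) by (simp add: norm_divide power_divide)
    also have "\<dots> \<le> \<rho> * Im ?w * norm (c * z + d) ^ 2" using le'[of ?w] n by (intro mult_right_mono) auto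
    also have "\<dots> = \<rho> * moeb_im a b c d z" using nz by (simp add: Im_moeb)
    finally show ?thesis .
  qed
  have nz: "c * z + d \<noteq> 0"
  proof
    assume 0: "c * z + d = 0"
    have "c \<noteq> 0"
    proof
      assume "c = 0"
      then have "d = 0" using 0 by simp
      then show False using det \<open>c = 0\<close> by simp
    qed
    \<comment> \<open>Next to a pole z, the values of \<open>moeb_im\<close> at z + 1 and z - 1 add
      up to 2 Im (a cnj c) <= 0, whereas \<open>ge\<close> makes both positive.\<close>
    have e: "c * (z + 1) + d = c" "c * (z - 1) + d = - c" using 0 by (simp_all add: algebra_simps)
    have E: "moeb_im a b c d (z + 1) + moeb_im a b c d (z - 1) = 2 * Im (a * cnj c)"
      unfolding moeb_im_def e by (simp add: algebra_simps)
    have "Im (z + 1) \<le> \<rho> * moeb_im a b c d (z + 1)" "Im (z - 1) \<le> \<rho> * moeb_im a b c d (z - 1)"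
      by (rule ge, simp only: e, use \<open>c \<noteq> 0\<close> in simp)+
    then have "2 * Im z \<le> \<rho> * moeb_im a b c d (z + 1) + \<rho> * moeb_im a b c d (z - 1)" by simp
    then have "2 * Im z \<le> \<rho> * (2 * Im (a * cnj c))" unfolding E[symmetric] distrib_left .
    also have "\<dots> \<le> 0" using \<rho> Q(1) by (simp add: mult_le_0_iff)
    finally show False using z by simp
  qed
  have "\<rho> * moeb_im a b c d z > 0" using ge[OF nz] z by linarith
  then have "moeb_im a b c d z > 0" using \<rho> by (simp add: zero_less_mult_iff)
  then show ?thesis using nz Im_moeb_pos_iff by blast
qed

text \<open>On the image of V the inverse satisfies the relation with the two variables exchanged,
  so the boundary inequalities are available in both directions.\<close>

lemma moeb_preserves_uhp:
  assumes det: "a * d - b * c = 1" and k: "\<exists>i\<in>{..N}\<times>{..N}. k i \<noteq> 0"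
    and V: "open V" "V \<noteq> {}" "V \<subseteq> uhp"
    and rel: "\<And>z. z \<in> V \<Longrightarrow> c * z + d \<noteq> 0 \<and> Im (moeb a b c d z) > 0 \<and> bipoly N k (modJ z) (modJ (moeb a b c d z)) = 0"
  shows "\<And>z. Im z > 0 \<Longrightarrow> c * z + d \<noteq> 0 \<and> Im (moeb a b c d z) > 0"
    and "\<And>z. Im z > 0 \<Longrightarrow> - c * z + a \<noteq> 0 \<and> Im (moeb d (- b) (- c) a z) > 0"
proof -
  obtain s where s: "s \<in> V" using V(2) by auto
  let ?f = "moeb a b c d" and ?g = "moeb d (- b) (- c) a"
  have s0: "Im s > 0" "c * s + d \<noteq> 0" "moeb_im a b c d s > 0"
    using V(3) s rel[OF s] Im_moeb_pos_iff[of c s d a b] by auto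
  have Q: "Im (a * cnj c) \<le> 0" "moeb_im a b c d (of_real x) \<le> 0" for x
    using natural_boundary_moeb[OF det V(1) s V(3) _ s0(3) k] rel by auto
  have det': "d * a - (- b) * (- c) = 1" using det by (simp add: mult.commute)
  define w where "w = ?f s"
  have holf: "?f holomorphic_on V" by (rule holomorphic_moeb) (use rel in auto)
  have injf: "inj_on ?f V" by (rule inj_on_moeb[OF det]) (use rel in auto)
  have O: "open (?f ` V)" by (rule open_mapping_thm3[OF holf V(1) injf])
  have O': "w \<in> ?f ` V" "?f ` V \<subseteq> uhp" using s rel by (auto simp: w_def)
  have rel': "bipoly N (\<lambda>(a, b). k (b, a)) (modJ y) (modJ (?g y)) = 0" if y: "y \<in> ?f ` V" for y
  proof -
    obtain z where z: "z \<in> V" "y = ?f z" using y by auto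
    then have "?g y = z" using moeb_inverse(2)[OF det] rel by auto
    then show ?thesis using rel[OF z(1)] z by (simp add: bipoly_swap)
  qed
  have pos: "moeb_im d (- b) (- c) a w > 0"
  proof -
    have "- c * w + a \<noteq> 0" unfolding w_def moeb_inverse(1)[OF det s0(2)] using s0(2) by simp
    moreover have "Im (?g w) > 0" using moeb_inverse(2)[OF det s0(2)] s0(1) by (simp add: w_def)
    ultimately show ?thesis using Im_moeb_pos_iff by blast
  qed
  have k': "\<exists>i\<in>{..N}\<times>{..N}. (\<lambda>(a, b). k (b, a)) i \<noteq> 0"
  proof -
    obtain i j where "i \<le> N" "j \<le> N" "k (i, j) \<noteq> 0" using k by auto
    then show ?thesis by (intro bexI[of _ "(j, i)"]) auto
  qed
  have Q': "Im (d * cnj (- c)) \<le> 0" "moeb_im d (- b) (- c) a (of_real x) \<le> 0" for x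
    using natural_boundary_moeb[OF det' O O' rel' pos k'] by auto
  show "c * z + d \<noteq> 0 \<and> Im (?f z) > 0" if "Im z > 0" for z
    by (rule moeb_preserves_uhp_aux[OF det s0(1,3) Q Q' that])
  have w: "Im w > 0" "moeb_im d (- b) (- c) a w > 0"
    using rel[OF s] pos by (auto simp: w_def)
  show "- c * z + a \<noteq> 0 \<and> Im (?g z) > 0" if "Im z > 0" for z
    by (rule moeb_preserves_uhp_aux[OF det' w Q' _ _ that]) (use Q in auto)
qed

section \<open>Rationality of algebraic Moebius relations\<close>

lemma bipoly_alt': "bipoly N k x y = (\<Sum>b\<le>N. (\<Sum>a\<le>N. k (a, b) * x ^ a) * y ^ b)"
  using bipoly_alt[of N "\<lambda>(a, b). k (b, a)" y x] by (simp add: bipoly_swap)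

text \<open>Since modJ (M_m z) = modJ z, the values modJ (f (M_m z)) are roots of one nonzero
  polynomial of degree at most N, so two of the indices 0..N give the same value. There are
  countably many pairs of indices, hence one pair works for all z.\<close>

lemma bipoly_pigeonhole:
  assumes k: "\<exists>i\<in>{..N}\<times>{..N}. k i \<noteq> 0"
    and f: "f holomorphic_on uhp" "f ` uhp \<subseteq> uhp"
    and rel: "\<And>z. Im z > 0 \<Longrightarrow> bipoly N k (modJ z) (modJ (f z)) = 0"
    and M: "\<And>m::nat. M m \<in> SL2Z"
  shows "\<exists>m l. m < l \<and> (\<forall>z. Im z > 0 \<longrightarrow> modJ (f (act (M m) z)) = modJ (f (act (M l) z)))"
proof -
  obtain i j where ij: "i \<le> N" "j \<le> N" "k (i, j) \<noteq> 0" using k by auto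
  define y where "y = (\<lambda>m z. modJ (f (act (M m) z)))"
  have y: "y m holomorphic_on uhp" for m
  proof -
    have "act (M m) holomorphic_on uhp" "act (M m) ` uhp \<subseteq> uhp" using holomorphic_act[OF M] Im_act[OF M] by auto
    then have "(f \<circ> act (M m)) holomorphic_on uhp" "(f \<circ> act (M m)) ` uhp \<subseteq> uhp"
      using f by (auto intro: holomorphic_on_compose_gen)
    from holomorphic_on_compose_gen[OF this(1) holomorphic_modJ this(2)] show ?thesis by (simp add: y_def o_def)
  qed
  \<comment> \<open>Here the coefficient of the j-th power of the second variable vanishes, and the
    polynomial could degenerate to zero.\<close>
  define Bad where "Bad = {z \<in> uhp. (\<Sum>a\<le>N. k (a, j) * modJ z ^ a) = 0}"
  have "countable Bad"
  proof (rule ccontr)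
    assume u: "uncountable Bad"
    have "k (i, j) = 0"
      by (rule modJ_polyfun_zero[where A = Bad and e = "\<lambda>a. k (a, j)" and N = N and a = i, OF u _ _ ij(1)])
         (auto simp: Bad_def)
    then show False using ij by simp
  qed
  moreover have "uncountable uhp" by (rule uncountable_open[OF open_uhp]) (metis empty_iff image_empty modJ_surj UNIV_I)
  ultimately have unc: "uncountable (uhp - Bad)" by (rule uncountable_minus_countable[rotated])
  have ex: "\<exists>p\<in>{(m, l). m < l}. 0 = y (fst p) z - y (snd p) z" if z: "z \<in> uhp - Bad" for z
  proof -
    define p where "p = (\<Sum>b\<le>N. monom (\<Sum>a\<le>N. k (a, b) * modJ z ^ a) b)"
    have "coeff p j \<noteq> 0" using z ij by (simp add: p_def coeff_sum Bad_def)
    then have p0: "p \<noteq> 0" by auto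
    have "degree p \<le> N" unfolding p_def by (intro degree_sum_le) (auto intro: order_trans[OF degree_monom_le])
    have "poly p (y m z) = 0" for m
    proof -
      have "Im (act (M m) z) > 0" using z Im_act[OF M] by simp
      from rel[OF this] have "bipoly N k (modJ z) (y m z) = 0" using z by (simp add: modJ_act[OF M] y_def)
      then show ?thesis by (simp add: bipoly_alt' p_def poly_sum poly_monom)
    qed
    then have "(\<lambda>m. y m z) ` {..N} \<subseteq> {x. poly p x = 0}" by auto
    then have "card ((\<lambda>m. y m z) ` {..N}) \<le> card {x. poly p x = 0}" by (intro card_mono poly_roots_finite p0)
    also have "\<dots> \<le> N" using card_poly_roots_bound[OF p0] \<open>degree p \<le> N\<close> by linarith
    finally have "\<not> inj_on (\<lambda>m. y m z) {..N}" using card_image[of "\<lambda>m. y m z" "{..N}"] by auto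
    then obtain m l where ml: "y m z = y l z" "m \<noteq> l" by (auto simp: inj_on_def)
    show ?thesis
    proof (cases "m < l")
      case True then show ?thesis using ml by (intro bexI[of _ "(m, l)"]) auto
    next
      case False then show ?thesis using ml by (intro bexI[of _ "(l, m)"]) auto
    qed
  qed
  have "\<exists>p\<in>{(m, l). m < l}. \<forall>z\<in>uhp. 0 = y (fst p) z - y (snd p) z"
    by (rule holomorphic_eq_countable_family[OF open_uhp connected_uhp _ _ _ unc _ ex])
       (auto intro!: holomorphic_intros y)
  then show ?thesis by (auto simp: y_def)
qed

text \<open>Matrices of determinant 1 that induce the same map agree up to sign.\<close>

lemma moeb_eq_act_imp_Ints:
  assumes det: "p * s - q * r = 1" and g: "g \<in> SL2Z"
    and eq: "\<And>z. Im z > 0 \<Longrightarrow> r * z + s \<noteq> 0 \<and> moeb p q r s z = act g z"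
  shows "p \<in> \<int>" "q \<in> \<int>" "r \<in> \<int>" "s \<in> \<int>"
proof -
  obtain a b c d where abcd: "g = (a, b, c, d)" by (cases g)
  have "a * d - b * c = 1" using g by (simp add: abcd SL2Z_def)
  from arg_cong[OF this, of of_int] have dg: "of_int a * of_int d - of_int b * of_int c = (1 :: complex)" by simp
  define a' b' c' d' where g': "a' = complex_of_int a" "b' = complex_of_int b" "c' = complex_of_int c" "d' = complex_of_int d"
  have dg: "a' * d' - b' * c' = 1" using dg by (simp add: g')
  have e: "(p * z + q) * (c' * z + d') = (a' * z + b') * (r * z + s)" if "Im z > 0" for z
  proof -
    have "c' * z + d' \<noteq> 0" using modJ_modular(3)[OF that, of a d b c] g by (simp add: abcd g' SL2Z_def)
    moreover have "(p * z + q) / (r * z + s) = (a' * z + b') / (c' * z + d')" "r * z + s \<noteq> 0"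
      using eq[OF that] by (simp_all add: abcd act_def moeb_def g')
    ultimately show ?thesis using frac_eq_eq by metis
  qed
  define A B C where ABC: "A = p * c' - a' * r" "B = p * d' + q * c' - a' * s - b' * r" "C = q * d' - b' * s"
  have quad: "A * z ^ 2 + B * z + C = 0" if "Im z > 0" for z
    using e[OF that] by (simp add: ABC power2_eq_square algebra_simps)
  \<comment> \<open>The cross-multiplied identity is a quadratic polynomial vanishing on the
    half-plane; its values at i, 2i, 3i already force all coefficients to be 0.\<close>
  have v: "- A + B * \<i> + C = 0" "- 4 * A + 2 * B * \<i> + C = 0" "- 9 * A + 3 * B * \<i> + C = 0"
    using quad[of \<i>] quad[of "2 * \<i>"] quad[of "3 * \<i>"] by (simp_all add: power_mult_distrib mult_ac)
  have "2 * A = 2 * (- 4 * A + 2 * B * \<i> + C) - (- A + B * \<i> + C) - (- 9 * A + 3 * B * \<i> + C)" by (simp add: algebra_simps)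
  then have A0: "A = 0" unfolding v by simp
  have "B * \<i> = (- 4 * A + 2 * B * \<i> + C) - (- A + B * \<i> + C) + 3 * A" by (simp add: algebra_simps)
  then have B0: "B = 0" unfolding v using A0 by simp
  have C0: "C = 0" using v A0 B0 by simp
  have X: "p * c' = a' * r" "p * d' + q * c' = a' * s + b' * r" "q * d' = b' * s"
    using A0 B0 C0 by (simp_all add: ABC algebra_simps)
  have "p ^ 2 = a' ^ 2" "q ^ 2 = b' ^ 2" "r ^ 2 = c' ^ 2" "s ^ 2 = d' ^ 2"
    using X det dg by algebra+
  then show "p \<in> \<int>" "q \<in> \<int>" "r \<in> \<int>" "s \<in> \<int>"
    unfolding power2_eq_iff by (auto simp: g')
qed

text \<open>The integral matrices found here are \<open>A T\<^sup>n A\<^sup>-\<^sup>1\<close> for \<open>A = (a, b; c, d)\<close> and \<open>T\<close> the standard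
  upper and lower unipotent matrices.\<close>
lemma square_products_rational:
  assumes det: "a * d - b * c = (1 :: complex)"
    and pos: "\<And>z. Im z > 0 \<Longrightarrow> c * z + d \<noteq> 0 \<and> Im (moeb a b c d z) > 0"
      "\<And>z. Im z > 0 \<Longrightarrow> - c * z + a \<noteq> 0 \<and> Im (moeb d (- b) (- c) a z) > 0"
    and k: "\<exists>i\<in>{..N}\<times>{..N}. k i \<noteq> 0"
    and rel: "\<And>z. Im z > 0 \<Longrightarrow> bipoly N k (modJ z) (modJ (moeb a b c d z)) = 0"
  shows "a ^ 2 \<in> \<rat>" "a * c \<in> \<rat>" "c ^ 2 \<in> \<rat>" "b ^ 2 \<in> \<rat>" "b * d \<in> \<rat>" "d ^ 2 \<in> \<rat>"
proof -
  let ?f = "moeb a b c d" and ?g = "moeb d (- b) (- c) a"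
  have f: "?f holomorphic_on uhp" "?f ` uhp \<subseteq> uhp" using pos by (auto intro!: holomorphic_moeb)
  have fg: "?f (?g w) = w" if "Im w > 0" for w
    using moeb_inverse(2)[of d a "- b" "- c" w] det pos(2)[OF that] by (simp add: mult.commute)
  have g: "?g holomorphic_on uhp" "?g ` uhp \<subseteq> uhp" using pos by (auto intro!: holomorphic_moeb)
  have RatsI: "x \<in> \<rat>" if "of_nat m * x \<in> \<int>" "m > 0" for x :: complex and m
  proof -
    obtain n where "of_nat m * x = of_int n" using \<open>of_nat m * x \<in> \<int>\<close> by (auto elim: Ints_cases)
    then have "x = of_int n / of_nat m" using \<open>m > 0\<close> by (simp add: field_simps)
    then show ?thesis by simp
  qed
  \<comment> \<open>The conjugate of h by the transformation preserves \<open>modJ\<close>, so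
    \<open>modJ_automorphism\<close> places it in the modular group and its entries, normalized to
    determinant 1, are integers.\<close>
  have core: "p \<in> \<int> \<and> q \<in> \<int> \<and> r \<in> \<int> \<and> s \<in> \<int>"
    if h: "h \<in> SL2Z" and pq: "p * s - q * r = 1" and eq: "\<And>w. Im w > 0 \<Longrightarrow> moeb p q r s w = ?f (act h (?g w))"
      and J: "\<And>z. Im z > 0 \<Longrightarrow> modJ (?f (act h z)) = modJ (?f z)" for h p q r s
  proof -
    have im: "Im (?f (act h (?g w))) > 0" if "Im w > 0" for w
      using pos Im_act[OF h] that by blast
    have nz: "r * w + s \<noteq> 0" if "Im w > 0" for w
      using im[OF that] eq[OF that] by (auto simp: moeb_def)
    have hol: "moeb p q r s holomorphic_on uhp" using nz by (auto intro!: holomorphic_moeb)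
    have "modJ (moeb p q r s w) = modJ w" if "Im w > 0" for w
      using eq[OF that] J[of "?g w"] pos(2)[OF that] fg[OF that] by simp
    then obtain g' where g': "g' \<in> SL2Z" "\<forall>z\<in>uhp. moeb p q r s z = act g' z"
      using modJ_automorphism[OF hol] im eq by (metis (no_types, lifting) image_subsetI mem_Collect_eq)
    show "p \<in> \<int> \<and> q \<in> \<int> \<and> r \<in> \<int> \<and> s \<in> \<int>"
      using moeb_eq_act_imp_Ints[OF pq g'(1)] nz g'(2) by auto
  qed
  have gd: "- c * w + a \<noteq> 0" if "Im w > 0" for w using pos(2)[OF that] by simp
  define T where "T = (\<lambda>m::nat. (1::int, int m, 0::int, 1::int))"
  have T: "T m \<in> SL2Z" for m by (simp add: T_def SL2Z_def)
  obtain m l where ml: "m < l" "\<And>z. Im z > 0 \<Longrightarrow> modJ (?f (act (T m) z)) = modJ (?f (act (T l) z))"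
    using bipoly_pigeonhole[of N k ?f T, OF k f rel T] by blast
  \<comment> \<open>Composing with the inverse of T^m turns the coincidence for m and l into
    invariance under T^n with n > 0.\<close>
  define n where "n = l - m"
  have n: "n > 0" "int l = int n + int m" using ml(1) by (auto simp: n_def)
  have Tn: "modJ (?f (act (T n) z)) = modJ (?f z)" if z: "Im z > 0" for z
  proof -
    have i: "(1, - int m, 0, 1) \<in> SL2Z" by (simp add: SL2Z_def)
    have "act (T m) (act (1, - int m, 0, 1) z) = z" "act (T l) (act (1, - int m, 0, 1) z) = act (T n) z"
      unfolding T_def by (subst act_mult[OF i z], simp add: n act_def)+
    then show ?thesis using ml(2)[OF Im_act[OF i z]] by simp
  qed
  have "1 - of_nat n * (a * c) \<in> \<int> \<and> of_nat n * a ^ 2 \<in> \<int> \<and> - of_nat n * c ^ 2 \<in> \<int> \<and> 1 + of_nat n * (a * c) \<in> \<int>"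
  proof (rule core[OF T _ _ Tn])
    show "(1 - of_nat n * (a * c)) * (1 + of_nat n * (a * c)) - of_nat n * a\<^sup>2 * (- of_nat n * c\<^sup>2) = 1"
      by algebra
    fix w assume w: "Im w > 0"
    have "act (T n) (?g w) = ((d - of_nat n * c) * w + (- b + of_nat n * a)) / (- c * w + a)"
      unfolding T_def act_def moeb_def using gd[OF w] by (simp add: field_simps)
    then have "?f (act (T n) (?g w)) = ((a * (d - of_nat n * c) + b * (- c)) * w + (a * (- b + of_nat n * a) + b * a))
       / ((c * (d - of_nat n * c) + d * (- c)) * w + (c * (- b + of_nat n * a) + d * a))"
      unfolding moeb_def[of a b c d] using moebius_compose[OF gd[OF w]] by metis
    moreover have "a * (d - of_nat n * c) + b * (- c) = 1 - of_nat n * (a * c)" "a * (- b + of_nat n * a) + b * a = of_nat n * a\<^sup>2"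
      "c * (d - of_nat n * c) + d * (- c) = - of_nat n * c\<^sup>2" "c * (- b + of_nat n * a) + d * a = 1 + of_nat n * (a * c)"
      using det by algebra+
    ultimately show "moeb (1 - of_nat n * (a * c)) (of_nat n * a\<^sup>2) (- of_nat n * c\<^sup>2) (1 + of_nat n * (a * c)) w = ?f (act (T n) (?g w))"
      by (simp only: moeb_def)
  qed
  then have "of_nat n * (a * c) \<in> \<int>" "of_nat n * a ^ 2 \<in> \<int>" "of_nat n * c ^ 2 \<in> \<int>"
    using Ints_diff[of "1 + of_nat n * (a * c)" 1] Ints_minus[of "- of_nat n * c ^ 2"] by simp_all
  then show "a ^ 2 \<in> \<rat>" "a * c \<in> \<rat>" "c ^ 2 \<in> \<rat>" using RatsI n(1) by blast+
  define L where "L = (\<lambda>m::nat. (1::int, 0::int, int m, 1::int))"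
  have L: "L m \<in> SL2Z" for m by (simp add: L_def SL2Z_def)
  obtain m' l' where ml': "m' < l'" "\<And>z. Im z > 0 \<Longrightarrow> modJ (?f (act (L m') z)) = modJ (?f (act (L l') z))"
    using bipoly_pigeonhole[of N k ?f L, OF k f rel L] by blast
  define n' where "n' = l' - m'"
  have n': "n' > 0" "int l' = int n' + int m'" using ml'(1) by (auto simp: n'_def)
  have Ln: "modJ (?f (act (L n') z)) = modJ (?f z)" if z: "Im z > 0" for z
  proof -
    have i: "(1, 0, - int m', 1) \<in> SL2Z" by (simp add: SL2Z_def)
    have "act (L m') (act (1, 0, - int m', 1) z) = z" "act (L l') (act (1, 0, - int m', 1) z) = act (L n') z"
      unfolding L_def by (subst act_mult[OF i z], simp add: n' act_def)+
    then show ?thesis using ml'(2)[OF Im_act[OF i z]] by simp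
  qed
  have "1 + of_nat n' * (b * d) \<in> \<int> \<and> - of_nat n' * b ^ 2 \<in> \<int> \<and> of_nat n' * d ^ 2 \<in> \<int> \<and> 1 - of_nat n' * (b * d) \<in> \<int>"
  proof (rule core[OF L _ _ Ln])
    show "(1 + of_nat n' * (b * d)) * (1 - of_nat n' * (b * d)) - (- of_nat n' * b\<^sup>2) * (of_nat n' * d\<^sup>2) = 1"
      by algebra
    fix w assume w: "Im w > 0"
    have gw: "Im (?g w) > 0" using pos(2)[OF w] by simp
    have e: "act (L n') (?g w) = (d * w + - b) / ((of_nat n' * d - c) * w + (a - of_nat n' * b))"
      using moebius_compose[OF gd[OF w], of 1 d "- b" 0 "of_nat n'" 1] by (simp add: L_def act_def moeb_def algebra_simps)
    have "Im (act (L n') (?g w)) > 0" by (rule Im_act[OF L gw])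
    then have nz: "(of_nat n' * d - c) * w + (a - of_nat n' * b) \<noteq> 0" unfolding e by auto
    have "?f (act (L n') (?g w)) = ((a * d + b * (of_nat n' * d - c)) * w + (a * (- b) + b * (a - of_nat n' * b)))
       / ((c * d + d * (of_nat n' * d - c)) * w + (c * (- b) + d * (a - of_nat n' * b)))"
      unfolding e moeb_def[of a b c d] by (rule moebius_compose[OF nz])
    moreover have "a * d + b * (of_nat n' * d - c) = 1 + of_nat n' * (b * d)" "a * (- b) + b * (a - of_nat n' * b) = - of_nat n' * b\<^sup>2"
      "c * d + d * (of_nat n' * d - c) = of_nat n' * d\<^sup>2" "c * (- b) + d * (a - of_nat n' * b) = 1 - of_nat n' * (b * d)"
      using det by algebra+
    ultimately show "moeb (1 + of_nat n' * (b * d)) (- of_nat n' * b\<^sup>2) (of_nat n' * d\<^sup>2) (1 - of_nat n' * (b * d)) w = ?f (act (L n') (?g w))"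
      by (simp only: moeb_def)
  qed
  then have "of_nat n' * (b * d) \<in> \<int>" "of_nat n' * b ^ 2 \<in> \<int>" "of_nat n' * d ^ 2 \<in> \<int>"
    using Ints_diff[of "1 + of_nat n' * (b * d)" 1] Ints_minus[of "- of_nat n' * b ^ 2"] by simp_all
  then show "b ^ 2 \<in> \<rat>" "b * d \<in> \<rat>" "d ^ 2 \<in> \<rat>" using RatsI n'(1) by blast+
qed

text \<open>Multiplying by a, or by c when a = 0, replaces each entry by a product of two entries,
  and these products are rational. For b c this follows from a^2 d^2 - b^2 c^2 = a d + b c = 1 + 2 b
  c.\<close>

lemma rational_scaling:
  assumes det: "a * d - b * c = (1 :: complex)"
    and R: "a ^ 2 \<in> \<rat>" "a * c \<in> \<rat>" "c ^ 2 \<in> \<rat>" "b ^ 2 \<in> \<rat>" "b * d \<in> \<rat>" "d ^ 2 \<in> \<rat>"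
  shows "\<exists>l. l \<noteq> 0 \<and> l * a \<in> \<rat> \<and> l * b \<in> \<rat> \<and> l * c \<in> \<rat> \<and> l * d \<in> \<rat>"
proof -
  have "b * c = (a ^ 2 * d ^ 2 - b ^ 2 * c ^ 2 - 1) / 2"
  proof -
    have "a ^ 2 * d ^ 2 - b ^ 2 * c ^ 2 = 2 * (b * c) + 1" using det by algebra
    then show ?thesis by simp
  qed
  moreover have "(a ^ 2 * d ^ 2 - b ^ 2 * c ^ 2 - 1) / 2 \<in> \<rat>"
    using R by (intro Rats_divide Rats_diff Rats_mult) auto
  ultimately have bc: "b * c \<in> \<rat>" by (simp only:)
  have ad: "a * d = 1 + b * c" using det by (simp add: algebra_simps)
  then have adR: "a * d \<in> \<rat>" using bc by simp
  show ?thesis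
  proof (cases "a = 0")
    case True
    then have "1 + b * c = 0" using ad by simp
    then have "b * c = - 1" by (simp add: add_eq_0_iff)
    then have bc0: "b \<noteq> 0" "c \<noteq> 0" by auto
    then have "c * d = (b * c) * (b * d) / b ^ 2" by (simp add: field_simps power2_eq_square)
    then have "c * d \<in> \<rat>" using R bc by simp
    then show ?thesis using bc0 True R bc by (intro exI[of _ c]) (auto simp: power2_eq_square mult.commute)
  next
    case False
    have "a * b \<in> \<rat>"
    proof (cases "d = 0")
      case True
      then have "1 + b * c = 0" using ad by simp
      then have "b * c = - 1" by (simp add: add_eq_0_iff)
      then have "c \<noteq> 0" by auto
      then have "a * b = (a * c) * (b * c) / c ^ 2" by (simp add: field_simps power2_eq_square)
      then show ?thesis using R bc by simp
    next
      case False
      then have "a * b = (a * d) * (b * d) / d ^ 2" by (simp add: field_simps power2_eq_square)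
      then show ?thesis using R adR by simp
    qed
    then show ?thesis using False R adR by (intro exI[of _ a]) (auto simp: power2_eq_square)
  qed
qed

lemma primitive_integer_scaling:
  fixes a b c d :: complex
  assumes R: "a \<in> \<rat>" "b \<in> \<rat>" "c \<in> \<rat>" "d \<in> \<rat>" and nz: "a \<noteq> 0 \<or> b \<noteq> 0"
  obtains l :: complex and p q r s :: int where "l \<noteq> 0" "l * a = of_int p" "l * b = of_int q" "l * c = of_int r" "l * d = of_int s"
    "gcd (gcd p q) (gcd r s) = 1"
proof -
  have ex: "\<exists>n m :: int. m \<noteq> 0 \<and> x = of_int n / of_int m" if "x \<in> \<rat>" for x :: complex
    using Rats_cases'[OF that] by (metis less_irrefl)
  obtain a1 a2 b1 b2 c1 c2 d1 d2 :: int where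
    e: "a2 \<noteq> 0" "a = of_int a1 / of_int a2" "b2 \<noteq> 0" "b = of_int b1 / of_int b2"
      "c2 \<noteq> 0" "c = of_int c1 / of_int c2" "d2 \<noteq> 0" "d = of_int d1 / of_int d2"
    using ex[OF R(1)] ex[OF R(2)] ex[OF R(3)] ex[OF R(4)] by blast
  define P Q R' S where PQRS: "P = a1 * b2 * c2 * d2" "Q = b1 * a2 * c2 * d2" "R' = c1 * a2 * b2 * d2" "S = d1 * a2 * b2 * c2"
  define m where "m = complex_of_int (a2 * b2 * c2 * d2)"
  have m: "m \<noteq> 0" "m * a = of_int P" "m * b = of_int Q" "m * c = of_int R'" "m * d = of_int S"
    using e(1,3,5,7) by (simp_all add: m_def PQRS e(2,4,6,8))
  define G where "G = gcd (gcd P Q) (gcd R' S)"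
  have "P \<noteq> 0 \<or> Q \<noteq> 0" using nz m by (metis mult_eq_0_iff of_int_0)
  then have G: "G > 0" by (auto simp: G_def)
  have dv: "G dvd P" "G dvd Q" "G dvd R'" "G dvd S" unfolding G_def by (meson dvd_trans gcd_dvd1 gcd_dvd2)+
  then obtain p q r s where pq: "P = G * p" "Q = G * q" "R' = G * r" "S = G * s" by (auto simp: dvd_def)
  have "G * gcd (gcd p q) (gcd r s) = G"
  proof -
    have "G * gcd (gcd p q) (gcd r s) = gcd (gcd (G * p) (G * q)) (gcd (G * r) (G * s))"
      using G by (simp flip: gcd_mult_distrib_int)
    then show ?thesis unfolding pq[symmetric] G_def[symmetric] .
  qed
  then have g1: "gcd (gcd p q) (gcd r s) = 1" using G by simp
  show ?thesis
    by (rule that[of "m / of_int G" p q r s]) (use m G g1 pq in auto)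
qed

theorem algebraic_moeb_is_modular:
  assumes det: "a * d - b * c = 1" and k: "\<exists>i\<in>{..N}\<times>{..N}. k i \<noteq> 0"
    and V: "open V" "V \<noteq> {}" "V \<subseteq> uhp"
    and rel: "\<And>z. z \<in> V \<Longrightarrow> c * z + d \<noteq> 0 \<and> Im (moeb a b c d z) > 0 \<and> bipoly N k (modJ z) (modJ (moeb a b c d z)) = 0"
  obtains n h where "n \<ge> 1" "h \<in> SL2Z" "\<forall>z. Im z > 0 \<longrightarrow> modJ (moeb a b c d z) = modJ (of_nat n * act h z)"
proof -
  let ?f = "moeb a b c d"
  note pos = moeb_preserves_uhp[OF det k V rel]
  have f: "?f holomorphic_on uhp" "?f ` uhp \<subseteq> uhp" using pos(1) by (auto intro!: holomorphic_moeb)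
  have rel': "bipoly N k (modJ z) (modJ (?f z)) = 0" if "Im z > 0" for z
  proof (rule holomorphic_eq_0_of_uncountable[where f = "\<lambda>z. bipoly N k (modJ z) (modJ (?f z))", OF _ open_uhp connected_uhp uncountable_open[OF V(1,2)] V(3)])
    show "(\<lambda>z. bipoly N k (modJ z) (modJ (?f z))) holomorphic_on uhp"
      by (rule holomorphic_bipoly_modJ[of "\<lambda>z. z", OF _ _ f]) auto
  qed (use rel that in auto)
  obtain l where l: "l \<noteq> 0" "l * a \<in> \<rat>" "l * b \<in> \<rat>" "l * c \<in> \<rat>" "l * d \<in> \<rat>"
    using rational_scaling[OF det square_products_rational[OF det pos k rel']] by blast
  have "l * a \<noteq> 0 \<or> l * b \<noteq> 0" using det l(1) by auto
  then obtain l' p q r s where pq: "l' \<noteq> 0" "l' * (l * a) = of_int p" "l' * (l * b) = of_int q" "l' * (l * c) = of_int r"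
    "l' * (l * d) = of_int s" "gcd (gcd p q) (gcd r s) = 1"
    using primitive_integer_scaling[OF l(2-5)] by metis
  define m where "m = l' * l"
  have m: "m \<noteq> 0" "of_int p = m * a" "of_int q = m * b" "of_int r = m * c" "of_int s = m * d"
    using pq l by (simp_all add: m_def mult.assoc)
  have f_eq: "?f z = (of_int p * z + of_int q) / (of_int r * z + of_int s)" for z
  proof -
    have "(of_int p * z + of_int q) = m * (a * z + b)" "(of_int r * z + of_int s) = m * (c * z + d)"
      by (simp_all add: m algebra_simps)
    then show ?thesis using m(1) by (simp add: moeb_def)
  qed
  \<comment> \<open>For real entries the value at i is the determinant, whose positivity the normal
    form requires.\<close>
  have "moeb_im (of_int p) (of_int q) (of_int r) (of_int s) \<i> > 0"
  proof -
    have "of_int r * \<i> + of_int s = m * (c * \<i> + d)" by (simp add: m algebra_simps)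
    then have "of_int r * \<i> + of_int s \<noteq> 0" using m(1) pos(1)[of \<i>] by simp
    moreover have "Im (moeb (of_int p) (of_int q) (of_int r) (of_int s) \<i>) > 0"
      using pos(1)[of \<i>] f_eq[of \<i>] by (simp add: moeb_def)
    ultimately show ?thesis using Im_moeb_pos_iff by blast
  qed
  then have "real_of_int (p * s - q * r) > 0" by (simp add: moeb_im_expand)
  then have "p * s - q * r > 0" by (simp only: of_int_0_less_iff)
  then obtain n where n: "n > 0" "p * s - q * r = int n" by (metis zero_less_imp_eq_int)
  obtain g h where gh: "g \<in> SL2Z" "h \<in> SL2Z"
    "\<forall>z. Im z > 0 \<longrightarrow> (of_int p * z + of_int q) / (of_int r * z + of_int s) = act g (of_nat n * act h z)"
    by (rule smith_normal_form_act[OF n(2,1) pq(6)])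
  show ?thesis
  proof (rule that[OF _ gh(2)])
    show "n \<ge> 1" using n by simp
    show "\<forall>z. Im z > 0 \<longrightarrow> modJ (?f z) = modJ (of_nat n * act h z)"
    proof (intro allI impI)
      fix z :: complex assume z: "Im z > 0"
      have "Im (of_nat n * act h z) > 0" using Im_act[OF gh(2) z] n by simp
      then show "modJ (?f z) = modJ (of_nat n * act h z)"
        using gh(3) z f_eq[of z] modJ_act[OF gh(1)] by simp
    qed
  qed
qed

section \<open>Local parametrizations\<close>

lemma image_uhpD: "f ` A \<subseteq> uhp \<Longrightarrow> x \<in> A \<Longrightarrow> Im (f x) > 0"
  by auto

text \<open>j is composed with a local inverse of \<open>modJ\<close>, which exists off the values 0
  and 1. The starting value y can be prescribed; \<open>modJ_eq_imp_orbit\<close> relies on this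
  choice.\<close>

lemma modJ_lift:
  assumes U: "open U" "t0 \<in> U" and j: "j holomorphic_on U" and y: "Im y > 0" "modJ y = j t0" "modJ y \<notin> {0, 1}"
  obtains r s where "r > 0" "ball t0 r \<subseteq> U" "s holomorphic_on ball t0 r" "s ` ball t0 r \<subseteq> uhp" "s t0 = y"
    "\<forall>t\<in>ball t0 r. modJ (s t) = j t"
proof -
  have "y \<in> uhp" using y(1) by simp
  then obtain e where e: "e > 0" "ball y e \<subseteq> uhp" "open (modJ ` ball y e)" "inj_on modJ (ball y e)"
    using has_complex_derivative_locally_invertible[OF holomorphic_modJ _ open_uhp deriv_modJ_nonzero[OF y(1,3)]] by metis
  obtain g where g: "g holomorphic_on (modJ ` ball y e)" "\<And>z. z \<in> ball y e \<Longrightarrow> g (modJ z) = z"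
    using holomorphic_has_inverse[OF holomorphic_on_subset[OF holomorphic_modJ e(2)] open_ball e(4)] by metis
  have "open (U \<inter> j -` (modJ ` ball y e))"
    by (rule continuous_open_preimage[OF holomorphic_on_imp_continuous_on[OF j] U(1) e(3)])
  moreover have "t0 \<in> U \<inter> j -` (modJ ` ball y e)" using U(2) y(2) e(1) by (auto intro!: image_eqI[of _ _ y])
  ultimately obtain r where r: "r > 0" "ball t0 r \<subseteq> U \<inter> j -` (modJ ` ball y e)" by (meson open_contains_ball)
  have im: "j t \<in> modJ ` ball y e" if "t \<in> ball t0 r" for t using r(2) that by auto
  show ?thesis
  proof (rule that[of r "g \<circ> j"])
    show "r > 0" "ball t0 r \<subseteq> U" using r by auto
    show "(g \<circ> j) holomorphic_on ball t0 r"
      by (rule holomorphic_on_compose_gen[OF holomorphic_on_subset[OF j] g(1)]) (use r im in auto)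
    show "(g \<circ> j) ` ball t0 r \<subseteq> uhp"
    proof
      fix w assume "w \<in> (g \<circ> j) ` ball t0 r"
      then obtain t where t: "t \<in> ball t0 r" "w = g (j t)" by auto
      then obtain z where "z \<in> ball y e" "j t = modJ z" using im by blast
      then show "w \<in> uhp" using t g(2) e(2) by auto
    qed
    show "(g \<circ> j) t0 = y" using g(2)[of y] e(1) y(2) by simp
    show "\<forall>t\<in>ball t0 r. modJ ((g \<circ> j) t) = j t"
    proof
      fix t assume "t \<in> ball t0 r"
      then obtain z where "z \<in> ball y e" "j t = modJ z" using im by blast
      then show "modJ ((g \<circ> j) t) = j t" using g(2) by simp
    qed
  qed
qed

lemma lifts_moebius_related:
  assumes B: "open B" "convex B" "B \<noteq> {}"
    and s: "s holomorphic_on B" "s ` B \<subseteq> uhp" "\<forall>t\<in>B. modJ (s t) = j1 t"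
    and u: "u holomorphic_on B" "u ` B \<subseteq> uhp" "\<forall>t\<in>B. modJ (u t) = j2 t"
    and gen: "\<And>t. t \<in> B \<Longrightarrow> j1 t \<notin> {0, 1} \<and> j2 t \<notin> {0, 1} \<and> deriv j1 t \<noteq> 0 \<and> deriv j2 t \<noteq> 0 \<and> Box j1 t = Box j2 t"
  obtains a b c d where "a * d - b * c = 1" "\<And>t. t \<in> B \<Longrightarrow> c * s t + d \<noteq> 0" "\<And>t. t \<in> B \<Longrightarrow> u t = moeb a b c d (s t)"
proof -
  have 1: "deriv s t \<noteq> 0" "Box j1 t = schwarzian s t / 2" if t: "t \<in> B" for t
    using Box_compose_modJ[OF B(1) t s(1,2), of j1] s(3) gen[OF t] t by auto
  have 2: "deriv u t \<noteq> 0" "Box j2 t = schwarzian u t / 2" if t: "t \<in> B" for t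
    using Box_compose_modJ[OF B(1) t u(1,2), of j2] u(3) gen[OF t] t by auto
  have "schwarzian s t = schwarzian u t" if t: "t \<in> B" for t using 1(2)[OF t] 2(2)[OF t] gen[OF t] by simp
  from equal_schwarzian_imp_moebius[OF B s(1) 1(1) u(1) 2(1) this] show ?thesis
    using that unfolding moeb_def by metis
qed

lemma open_generic:
  assumes U: "open U" and j: "j holomorphic_on U"
  shows "open {t \<in> U. j t \<notin> {0, 1} \<and> deriv j t \<noteq> 0}"
proof -
  have "open (U \<inter> j -` (- {0, 1}))"
    by (rule continuous_open_preimage[OF holomorphic_on_imp_continuous_on[OF j] U]) (simp add: open_Compl)
  moreover have "open (U \<inter> deriv j -` (- {0}))"
    by (rule continuous_open_preimage[OF holomorphic_on_imp_continuous_on[OF holomorphic_deriv[OF j U]] U]) auto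
  ultimately have "open ((U \<inter> j -` (- {0, 1})) \<inter> (U \<inter> deriv j -` (- {0})))" by (rule open_Int)
  moreover have "(U \<inter> j -` (- {0, 1})) \<inter> (U \<inter> deriv j -` (- {0})) = {t \<in> U. j t \<notin> {0, 1} \<and> deriv j t \<noteq> 0}" by auto
  ultimately show ?thesis by simp
qed

text \<open>Lifting \<open>modJ\<close> near x with starting value y gives u with modJ (u t) = modJ
  t. The identity and u are lifts of the same function, hence Moebius related, and the relation X -
  Y = 0 makes the transformation an automorphism of the half-plane preserving
  \<open>modJ\<close>.\<close>

lemma modJ_eq_imp_orbit:
  assumes x: "Im x > 0" "Im y > 0" "modJ x = modJ y" "modJ x \<notin> {0, 1}"
  shows "\<exists>g\<in>SL2Z. y = act g x"
proof -
  define U where "U = {t \<in> uhp. modJ t \<notin> {0, 1} \<and> deriv modJ t \<noteq> 0}"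
  have U: "open U" "x \<in> U" using open_generic[OF open_uhp holomorphic_modJ] x deriv_modJ_nonzero[OF x(1,4)] by (auto simp: U_def)
  have hol: "modJ holomorphic_on U" by (rule holomorphic_on_subset[OF holomorphic_modJ]) (auto simp: U_def)
  obtain r u where u: "r > 0" "ball x r \<subseteq> U" "u holomorphic_on ball x r" "u ` ball x r \<subseteq> uhp" "u x = y"
    "\<forall>t\<in>ball x r. modJ (u t) = modJ t"
    by (rule modJ_lift[OF U hol x(2)]) (use x in auto)
  have sub: "ball x r \<subseteq> uhp" using u(2) by (auto simp: U_def)
  obtain a b c d where A: "a * d - b * c = 1" "\<And>t. t \<in> ball x r \<Longrightarrow> c * t + d \<noteq> 0" "\<And>t. t \<in> ball x r \<Longrightarrow> u t = moeb a b c d t"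
    by (rule lifts_moebius_related[of "ball x r" "\<lambda>t. t" modJ u modJ]) (use u sub in \<open>auto simp: U_def\<close>)
  \<comment> \<open>Coefficients of the polynomial X - Y.\<close>
  define k :: "nat \<times> nat \<Rightarrow> complex" where "k = (\<lambda>i. if i = (1, 0) then 1 else if i = (0, 1) then - 1 else 0)"
  have k: "\<exists>i\<in>{..1::nat}\<times>{..1}. k i \<noteq> 0" by (intro bexI[of _ "(1, 0)"]) (auto simp: k_def)
  have bk: "bipoly 1 k p q = p - q" for p q
    by (simp add: bipoly_alt k_def)
  have ne: "ball x r \<noteq> {}" using u(1) by simp
  have Jx: "modJ (moeb a b c d t) = modJ t" "Im (moeb a b c d t) > 0" if "t \<in> ball x r" for t
    using A(3)[OF that] image_uhpD[OF u(4) that] u(6) that by metis+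
  have pos: "c * z + d \<noteq> 0 \<and> Im (moeb a b c d z) > 0" if "Im z > 0" for z
    by (rule moeb_preserves_uhp(1)[OF A(1) k open_ball ne sub _ that]) (use A(2) Jx bk in auto)
  have f: "moeb a b c d holomorphic_on uhp" "moeb a b c d ` uhp \<subseteq> uhp" using pos by (auto intro!: holomorphic_moeb)
  have Jf: "(\<lambda>z. modJ (moeb a b c d z)) holomorphic_on uhp"
    using holomorphic_on_compose_gen[OF f(1) holomorphic_modJ f(2)] by (simp add: o_def)
  have "modJ (moeb a b c d z) - modJ z = 0" if "Im z > 0" for z
    by (rule holomorphic_eq_0_of_uncountable[where f = "\<lambda>z. modJ (moeb a b c d z) - modJ z", OF _ open_uhp connected_uhp uncountable_open[OF open_ball ne] sub])
       (use Jx that in \<open>auto intro!: holomorphic_intros Jf holomorphic_modJ\<close>)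
  then obtain g where "g \<in> SL2Z" "\<forall>z\<in>uhp. moeb a b c d z = act g z"
    using modJ_automorphism[OF f] by auto
  moreover have "y = moeb a b c d x" using A(3)[of x] u(1,5) by simp
  ultimately show ?thesis using x(1) by auto
qed

text \<open>At a point on the curve, \<open>modJ_eq_imp_orbit\<close> writes the parameter as act g
  (s t) with g depending on t; if there are uncountably many such t, one g serves on the whole ball.
  The implication stands in the conclusion so that it refers to the same lift
  \<open>s\<close>.\<close>

lemma modular_on_ball:
  assumes U: "open U" "t0 \<in> U" and j: "j1 holomorphic_on U" "j2 holomorphic_on U"
    and gen: "\<And>t. t \<in> U \<Longrightarrow> j1 t \<notin> {0, 1}" and n: "n \<ge> 1"
  obtains r s where "r > 0" "ball t0 r \<subseteq> U" "s holomorphic_on ball t0 r" "s ` ball t0 r \<subseteq> uhp"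
    "\<forall>t\<in>ball t0 r. modJ (s t) = j1 t"
    "uncountable {t \<in> ball t0 r. (j1 t, j2 t) \<in> X0_affine n} \<longrightarrow>
       (\<exists>g\<in>SL2Z. \<forall>t\<in>ball t0 r. j2 t = modJ (of_nat n * act g (s t)))"
proof -
  have "j1 t0 \<in> modJ ` uhp" using modJ_surj by simp
  then obtain y where y: "Im y > 0" "modJ y = j1 t0" by auto
  obtain r s where s: "r > 0" "ball t0 r \<subseteq> U" "s holomorphic_on ball t0 r" "s ` ball t0 r \<subseteq> uhp" "s t0 = y"
    "\<forall>t\<in>ball t0 r. modJ (s t) = j1 t"
    by (rule modJ_lift[OF U j(1) y]) (use y gen U in auto)
  have "\<exists>g\<in>SL2Z. \<forall>t\<in>ball t0 r. j2 t = modJ (of_nat n * act g (s t))"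
    if unc: "uncountable {t \<in> ball t0 r. (j1 t, j2 t) \<in> X0_affine n}"
  proof (rule holomorphic_eq_countable_family[OF open_ball connected_ball holomorphic_on_subset[OF j(2) s(2)] countable_SL2Z _ unc])
    fix g assume g: "g \<in> SL2Z"
    have "(act g \<circ> s) holomorphic_on ball t0 r"
      by (rule holomorphic_on_compose_gen[OF s(3) holomorphic_act[OF g] s(4)])
    then have "(\<lambda>t. of_nat n * act g (s t)) holomorphic_on ball t0 r" by (auto simp: o_def intro!: holomorphic_intros)
    moreover have "(\<lambda>t. of_nat n * act g (s t)) ` ball t0 r \<subseteq> uhp" using Im_act[OF g] s(4) n by auto
    ultimately have "(modJ \<circ> (\<lambda>t. of_nat n * act g (s t))) holomorphic_on ball t0 r"
      by (rule holomorphic_on_compose_gen[OF _ holomorphic_modJ])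
    then show "(\<lambda>t. modJ (of_nat n * act g (s t))) holomorphic_on ball t0 r" by (simp add: o_def)
  next
    fix t assume "t \<in> {t \<in> ball t0 r. (j1 t, j2 t) \<in> X0_affine n}"
    then have t: "t \<in> ball t0 r" and "(j1 t, j2 t) \<in> X0_affine n" by auto
    then obtain \<sigma> where \<sigma>: "Im \<sigma> > 0" "j1 t = modJ \<sigma>" "j2 t = modJ (of_nat n * \<sigma>)" unfolding X0_affine_eq[OF n] by auto
    have st: "Im (s t) > 0" "modJ (s t) = modJ \<sigma>" "modJ (s t) \<notin> {0, 1}"
      using image_uhpD[OF s(4) t] s(6) t \<sigma>(2) gen[of t] s(2) by auto
    show "\<exists>g\<in>SL2Z. j2 t = modJ (of_nat n * act g (s t))"
      using modJ_eq_imp_orbit[OF st(1) \<sigma>(1) st(2,3)] \<sigma>(3) by auto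
  qed auto
  then show ?thesis using that[OF s(1-4,6)] by blast
qed

text \<open>The nonconstant lift s is an open map, so the relation between j1 and j2 becomes one
  between \<open>modJ\<close> and \<open>modJ\<close> after a Moebius map, on an open subset of the
  half-plane.\<close>

lemma Box_eq_imp_X0_locally:
  assumes U: "open U" "t0 \<in> U" and j: "j1 holomorphic_on U" "j2 holomorphic_on U"
    and gen: "\<And>t. t \<in> U \<Longrightarrow> j1 t \<notin> {0, 1} \<and> j2 t \<notin> {0, 1} \<and> deriv j1 t \<noteq> 0 \<and> deriv j2 t \<noteq> 0 \<and> Box j1 t = Box j2 t"
    and k: "\<exists>i\<in>{..N}\<times>{..N}. k i \<noteq> 0" and rel: "\<And>t. t \<in> U \<Longrightarrow> bipoly N k (j1 t) (j2 t) = 0"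
  shows "\<exists>n\<ge>1. \<exists>r>0. ball t0 r \<subseteq> U \<and> (\<forall>t\<in>ball t0 r. (j1 t, j2 t) \<in> X0_affine n)"
proof -
  have "j1 t0 \<in> modJ ` uhp" "j2 t0 \<in> modJ ` uhp" using modJ_surj by auto
  then obtain y1 y2 where y: "Im y1 > 0" "modJ y1 = j1 t0" "Im y2 > 0" "modJ y2 = j2 t0" by auto
  obtain r1 s where s: "r1 > 0" "ball t0 r1 \<subseteq> U" "s holomorphic_on ball t0 r1" "s ` ball t0 r1 \<subseteq> uhp" "s t0 = y1"
    "\<forall>t\<in>ball t0 r1. modJ (s t) = j1 t"
    by (rule modJ_lift[OF U j(1) y(1,2)]) (use y gen[OF U(2)] in auto)
  obtain r2 u where u: "r2 > 0" "ball t0 r2 \<subseteq> U" "u holomorphic_on ball t0 r2" "u ` ball t0 r2 \<subseteq> uhp" "u t0 = y2"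
    "\<forall>t\<in>ball t0 r2. modJ (u t) = j2 t"
    by (rule modJ_lift[OF U j(2) y(3,4)]) (use y gen[OF U(2)] in auto)
  define r where "r = min r1 r2"
  let ?B = "ball t0 r"
  have r: "r > 0" "?B \<subseteq> ball t0 r1" "?B \<subseteq> ball t0 r2" using s(1) u(1) by (auto simp: r_def)
  have sB: "s holomorphic_on ?B" "s ` ?B \<subseteq> uhp" "\<forall>t\<in>?B. modJ (s t) = j1 t"
    using holomorphic_on_subset[OF s(3) r(2)] order_trans[OF image_mono[OF r(2)] s(4)] s(6) r(2) by blast+
  have uB: "u holomorphic_on ?B" "u ` ?B \<subseteq> uhp" "\<forall>t\<in>?B. modJ (u t) = j2 t"
    using holomorphic_on_subset[OF u(3) r(3)] order_trans[OF image_mono[OF r(3)] u(4)] u(6) r(3) by blast+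
  have BU: "?B \<subseteq> U" using r s(2) by auto
  have ne: "?B \<noteq> {}" using r(1) by simp
  obtain a b c d where A: "a * d - b * c = 1" "\<And>t. t \<in> ?B \<Longrightarrow> c * s t + d \<noteq> 0" "\<And>t. t \<in> ?B \<Longrightarrow> u t = moeb a b c d (s t)"
    by (rule lifts_moebius_related[OF open_ball convex_ball ne sB uB]) (use gen BU in blast)+
  have t0B: "t0 \<in> ?B" using r(1) by simp
  have "\<not> s constant_on ?B"
  proof
    assume "s constant_on ?B"
    then obtain k0 where "\<forall>t\<in>?B. s t = k0" by (auto simp: constant_on_def)
    then have "(s has_field_derivative 0) (at t0)"
      by (intro has_field_derivative_transform_within_open[OF DERIV_const open_ball t0B]) auto
    then have "deriv s t0 = 0" by (rule DERIV_imp_deriv)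
    moreover have "deriv s t0 \<noteq> 0"
      using Box_compose_modJ(1)[OF open_ball t0B sB(1,2), of j1] sB(3) gen[OF U(2)] t0B by auto
    ultimately show False by simp
  qed
  then have V: "open (s ` ?B)" by (intro open_mapping_thm[OF sB(1) open_ball connected_ball open_ball order_refl])
  obtain n h where nh: "n \<ge> 1" "h \<in> SL2Z" "\<forall>z. Im z > 0 \<longrightarrow> modJ (moeb a b c d z) = modJ (of_nat n * act h z)"
  proof (rule algebraic_moeb_is_modular[OF A(1) k V _ sB(2)])
    show "s ` ?B \<noteq> {}" using ne by simp
    fix z assume "z \<in> s ` ?B"
    then obtain t where t: "t \<in> ?B" "z = s t" by auto
    have "modJ z = j1 t" "modJ (moeb a b c d z) = j2 t" "Im (moeb a b c d z) > 0"
      using A(3)[OF t(1)] t sB(3) uB(3) image_uhpD[OF uB(2) t(1)] by metis+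
    then show "c * z + d \<noteq> 0 \<and> Im (moeb a b c d z) > 0 \<and> bipoly N k (modJ z) (modJ (moeb a b c d z)) = 0"
      using A(2)[OF t(1)] t rel BU by auto
  qed
  have "(j1 t, j2 t) \<in> X0_affine n" if t: "t \<in> ?B" for t
  proof -
    have st: "Im (s t) > 0" using image_uhpD[OF sB(2) t] .
    \<comment> \<open>The curve parameter is act h (s t) rather than s t: the element h leaves
      \<open>modJ\<close> unchanged, but it need not leave modJ (n z) unchanged.\<close>
    have "(j1 t, j2 t) = (modJ (act h (s t)), modJ (of_nat n * act h (s t)))"
      using sB(3) uB(3) t A(3)[OF t] nh(3) st modJ_act[OF nh(2) st] by metis
    then show ?thesis unfolding X0_affine_eq[OF nh(1)] using Im_act[OF nh(2) st] by auto
  qed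
  then show ?thesis using nh(1) r(1) BU by blast
qed

lemma schwarzian_moeb:
  assumes z: "c * z + d \<noteq> 0" and det: "a * d - b * c \<noteq> 0"
  shows "deriv (moeb a b c d) z \<noteq> 0" "schwarzian (moeb a b c d) z = 0"
proof -
  define S where "S = {z. c * z + d \<noteq> 0}"
  have S: "open S" "z \<in> S" using z unfolding S_def by (auto intro!: open_Collect_neq continuous_intros)
  let ?g = "\<lambda>z. (a * d - b * c) / (c * z + d) ^ 2"
  have 1: "(moeb a b c d has_field_derivative ?g x) (at x)" if "x \<in> S" for x
  proof -
    have nz: "c * x + d \<noteq> 0" using that by (simp add: S_def)
    have "((\<lambda>z. (a * z + b) / (c * z + d)) has_field_derivative (a * (c * x + d) - (a * x + b) * c) / ((c * x + d) * (c * x + d))) (at x)"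
      by (rule DERIV_divide) (use nz in \<open>auto intro!: derivative_eq_intros\<close>)
    moreover have "a * (c * x + d) - (a * x + b) * c = a * d - b * c" by algebra
    ultimately show ?thesis by (simp add: moeb_def[abs_def] power2_eq_square)
  qed
  show "deriv (moeb a b c d) z \<noteq> 0" using DERIV_imp_deriv[OF 1[OF S(2)]] z det by simp
  have "schwarzian (moeb a b c d) z = 2 * c ^ 2 / (c * z + d) ^ 2 - (- 2 * c / (c * z + d)) ^ 2 / 2"
  proof (rule schwarzian_via_log_deriv[OF S 1])
    fix x assume "x \<in> S"
    then have nz: "c * x + d \<noteq> 0" by (simp add: S_def)
    have "(?g has_field_derivative (0 * (c * x + d) ^ 2 - (a * d - b * c) * (2 * (c * x + d) * c)) / ((c * x + d) ^ 2 * (c * x + d) ^ 2)) (at x)"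
      by (rule DERIV_divide) (use nz in \<open>auto intro!: derivative_eq_intros\<close>)
    moreover have "(0 * (c * x + d) ^ 2 - (a * d - b * c) * (2 * (c * x + d) * c)) / ((c * x + d) ^ 2 * (c * x + d) ^ 2)
       = ?g x * (- 2 * c / (c * x + d))"
      using nz by (simp add: divide_simps) (simp add: eval_nat_numeral algebra_simps)
    ultimately show "(?g has_field_derivative ?g x * (- 2 * c / (c * x + d))) (at x)" by simp
  next
    have "((\<lambda>x. - 2 * c / (c * x + d)) has_field_derivative (0 * (c * z + d) - (- 2 * c) * c) / ((c * z + d) * (c * z + d))) (at z)"
      by (rule DERIV_divide) (use z in \<open>auto intro!: derivative_eq_intros\<close>)
    then show "((\<lambda>x. - 2 * c / (c * x + d)) has_field_derivative 2 * c ^ 2 / (c * z + d) ^ 2) (at z)"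
      by (simp add: power2_eq_square mult_ac)
    show "?g z \<noteq> 0" using z det by simp
  qed
  also have "\<dots> = 0" by (simp add: power_divide power_mult_distrib)
  finally show "schwarzian (moeb a b c d) z = 0" .
qed

lemma X0_imp_Box_eq:
  assumes U: "open U" "t0 \<in> U" and j: "j1 holomorphic_on U" "j2 holomorphic_on U"
    and gen: "\<And>t. t \<in> U \<Longrightarrow> j1 t \<notin> {0, 1} \<and> j2 t \<notin> {0, 1} \<and> deriv j1 t \<noteq> 0 \<and> deriv j2 t \<noteq> 0"
    and n: "n \<ge> 1" and X: "\<And>t. t \<in> U \<Longrightarrow> (j1 t, j2 t) \<in> X0_affine n"
  shows "Box j1 t0 = Box j2 t0"
proof -
  obtain r s where s: "r > 0" "ball t0 r \<subseteq> U" "s holomorphic_on ball t0 r" "s ` ball t0 r \<subseteq> uhp"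
    "\<forall>t\<in>ball t0 r. modJ (s t) = j1 t"
    "uncountable {t \<in> ball t0 r. (j1 t, j2 t) \<in> X0_affine n} \<longrightarrow>
       (\<exists>g\<in>SL2Z. \<forall>t\<in>ball t0 r. j2 t = modJ (of_nat n * act g (s t)))"
    by (rule modular_on_ball[OF U j _ n]) (use gen in auto)
  have t0: "t0 \<in> ball t0 r" using s(1) by simp
  have "{t \<in> ball t0 r. (j1 t, j2 t) \<in> X0_affine n} = ball t0 r" using X s(2) by auto
  moreover have "uncountable (ball t0 r)" using uncountable_ball[OF s(1)] .
  ultimately obtain g where g: "g \<in> SL2Z" "\<forall>t\<in>ball t0 r. j2 t = modJ (of_nat n * act g (s t))" using s(6) by auto
  obtain a b c d where abcd: "g = (a, b, c, d)" by (cases g)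
  \<comment> \<open>Multiplication by n after the group action, as one Moebius map of determinant n;
    its Schwarzian is zero, so it does not affect that of s.\<close>
  define f where "f = moeb (of_nat n * of_int a) (of_nat n * of_int b) (of_int c) (of_int d)"
  have f: "of_nat n * act g z = f z" for z by (simp add: f_def abcd act_def moeb_def algebra_simps add_divide_distrib)
  have det: "a * d - b * c = 1" using g(1) by (simp add: abcd SL2Z_def)
  have nz: "of_int c * z + of_int d \<noteq> (0 :: complex)" if "Im z > 0" for z using modJ_modular(3)[OF that det] .
  have "of_nat n * of_int a * of_int d - of_nat n * of_int b * of_int c = (of_nat n :: complex)"
  proof -
    have "of_nat n * of_int a * of_int d - of_nat n * of_int b * of_int c = of_nat n * (of_int (a * d - b * c) :: complex)"
      by (simp add: algebra_simps)
    then show ?thesis using det by simp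
  qed
  then have D: "of_nat n * of_int a * of_int d - of_nat n * of_int b * of_int c \<noteq> (0 :: complex)" using n by simp
  have holf: "f holomorphic_on uhp" unfolding f_def by (rule holomorphic_moeb) (use nz in auto)
  have fu: "f ` uhp \<subseteq> uhp" using Im_act[OF g(1)] n by (auto simp flip: f)
  have st0: "Im (s t0) > 0" using image_uhpD[OF s(4) t0] .
  let ?w = "\<lambda>t. f (s t)"
  have w: "?w holomorphic_on ball t0 r" "?w ` ball t0 r \<subseteq> uhp"
    using holomorphic_on_compose_gen[OF s(3) holf s(4)] s(4) fu by (auto simp: o_def)
  have B1: "deriv s t0 \<noteq> 0" "Box j1 t0 = schwarzian s t0 / 2"
    using Box_compose_modJ[OF open_ball t0 s(3,4), of j1] s(5) gen[OF U(2)] t0 by auto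
  have B2: "Box j2 t0 = schwarzian ?w t0 / 2"
    using Box_compose_modJ(2)[OF open_ball t0 w, of j2] g(2) gen[OF U(2)] t0 f by auto
  have "deriv f (s t0) \<noteq> 0" "schwarzian f (s t0) = 0"
    unfolding f_def using schwarzian_moeb[OF nz[OF st0] D] by auto
  then have "schwarzian ?w t0 = schwarzian s t0"
    using schwarzian_compose(2)[OF open_ball t0 open_uhp s(3,4) holf refl B1(1)] by simp
  then show ?thesis by (simp only: B1(2) B2)
qed

section \<open>Passage from local to global\<close>

lemma countable_nongeneric:
  assumes U: "open U" "connected U" and j: "j holomorphic_on U" "\<not> (\<exists>c. \<forall>t\<in>U. j t = c)"
  shows "countable {t \<in> U. j t \<in> {0, 1} \<or> deriv j t = 0}"
proof -
  have c: "countable {t \<in> U. j t = e}" for e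
  proof (rule ccontr)
    assume "uncountable {t \<in> U. j t = e}"
    then have "U \<subseteq> {t \<in> U. j t = e}"
      by (intro holomorphic_countable_equal[OF j(1) _ U open_imp_fsigma[OF U(1)]]) auto
    then show False using j(2) by blast
  qed
  have d: "countable {t \<in> U. deriv j t = 0}"
  proof (rule ccontr)
    assume "uncountable {t \<in> U. deriv j t = 0}"
    then have "U \<subseteq> {t \<in> U. deriv j t = 0}"
      by (intro holomorphic_countable_equal[OF holomorphic_deriv[OF j(1) U(1)] _ U open_imp_fsigma[OF U(1)]]) auto
    then have "(j has_field_derivative 0) (at t)" if "t \<in> U" for t
      using holomorphic_derivI[OF j(1) U(1) that] that by auto
    then have "j constant_on U" using U by (intro has_field_derivative_0_imp_constant_on)
    then show False using j(2) by (auto simp: constant_on_def)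
  qed
  have "{t \<in> U. j t \<in> {0, 1} \<or> deriv j t = 0} = {t \<in> U. j t = 0} \<union> {t \<in> U. j t = 1} \<union> {t \<in> U. deriv j t = 0}" by auto
  then show ?thesis using c d by simp
qed

theorem theorem4:
  fixes U :: "complex set" and j1 j2 :: "complex \<Rightarrow> complex"
  assumes "open U" and "connected U" and "U \<noteq> {}"
    and "j1 holomorphic_on U" and "j2 holomorphic_on U"
    and "\<not> (\<exists>c. \<forall>t\<in>U. j1 t = c)" and "\<not> (\<exists>c. \<forall>t\<in>U. j2 t = c)"
    and "rational_on U (\<lambda>t. j1 t + j2 t)" and "rational_on U (\<lambda>t. j1 t * j2 t)"
  shows "(\<forall>t\<in>U. (j1 t \<notin> {0, 1} \<and> j2 t \<notin> {0, 1} \<and> deriv j1 t \<noteq> 0 \<and> deriv j2 t \<noteq> 0)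
             \<longrightarrow> Box j1 t = Box j2 t)
         \<longleftrightarrow> (\<exists>n::nat. n \<ge> 1 \<and> (\<forall>t\<in>U. (j1 t, j2 t) \<in> X0_affine n))"
proof
  define G where "G = {t \<in> U. j1 t \<notin> {0, 1} \<and> deriv j1 t \<noteq> 0} \<inter> {t \<in> U. j2 t \<notin> {0, 1} \<and> deriv j2 t \<noteq> 0}"
  define T where "T = {t \<in> U. j1 t \<in> {0, 1} \<or> deriv j1 t = 0} \<union> {t \<in> U. j2 t \<in> {0, 1} \<or> deriv j2 t = 0}"
  have G: "open G" "G \<subseteq> U" "j1 holomorphic_on G" "j2 holomorphic_on G"
    unfolding G_def using open_generic assms(1,4,5) by (auto intro: holomorphic_on_subset)
  have gen: "j1 t \<notin> {0, 1} \<and> j2 t \<notin> {0, 1} \<and> deriv j1 t \<noteq> 0 \<and> deriv j2 t \<noteq> 0" if "t \<in> G" for t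
    using that by (auto simp: G_def)
  show "\<exists>n\<ge>1. \<forall>t\<in>U. (j1 t, j2 t) \<in> X0_affine n"
    if eq: "\<forall>t\<in>U. (j1 t \<notin> {0, 1} \<and> j2 t \<notin> {0, 1} \<and> deriv j1 t \<noteq> 0 \<and> deriv j2 t \<noteq> 0) \<longrightarrow> Box j1 t = Box j2 t"
  proof -
    have T: "countable T" unfolding T_def using countable_nongeneric[OF assms(1,2)] assms(4-7) by simp
    have GT: "G = U - T" by (auto simp: G_def T_def)
    have conn: "connected G" unfolding GT by (rule connected_open_diff_countable[OF _ assms(1,2) T]) simp
    have "uncountable G" unfolding GT using uncountable_open[OF assms(1,3)] T by (rule uncountable_minus_countable)
    then obtain t0 where t0: "t0 \<in> G" by (metis countable_empty ex_in_conv)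
    obtain N k where k: "\<exists>i\<in>{..N}\<times>{..N}. k i \<noteq> 0"
      "\<forall>t\<in>U. (\<Sum>i\<in>{..N}\<times>{..N}. k i * (j1 t ^ fst i * j2 t ^ snd i)) = 0"
      by (rule algebraic_relation[OF assms(1-5,8,9)])
    have "\<exists>n\<ge>1. \<exists>r>0. ball t0 r \<subseteq> G \<and> (\<forall>t\<in>ball t0 r. (j1 t, j2 t) \<in> X0_affine n)"
      by (rule Box_eq_imp_X0_locally[OF G(1) t0 G(3,4) _ k(1)]) (use gen eq G(2) k(2) in \<open>auto simp: bipoly_def\<close>)
    then obtain n r0 where n: "n \<ge> 1" "r0 > 0" "ball t0 r0 \<subseteq> G" "\<forall>t\<in>ball t0 r0. (j1 t, j2 t) \<in> X0_affine n" by blast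
    \<comment> \<open>The largest open part of the generic set on which the pair lies on the curve
      for this fixed n.\<close>
    define W where "W = \<Union>{B. open B \<and> B \<subseteq> G \<and> (\<forall>t\<in>B. (j1 t, j2 t) \<in> X0_affine n)}"
    have W: "open W" "W \<subseteq> G" "\<And>t. t \<in> W \<Longrightarrow> (j1 t, j2 t) \<in> X0_affine n" unfolding W_def by auto
    have "t0 \<in> W" unfolding W_def using n by (auto intro!: exI[of _ "ball t0 r0"])
    \<comment> \<open>If a ball around a point outside W met W, it would contain uncountably many
      curve points; \<open>modular_on_ball\<close> spreads the relation over the ball and puts its
      centre into W.\<close>
    have "open (G - W)"
      unfolding open_contains_ball
    proof
      fix t1 assume t1: "t1 \<in> G - W"
      obtain r s where s: "r > 0" "ball t1 r \<subseteq> G" "s holomorphic_on ball t1 r" "s ` ball t1 r \<subseteq> uhp"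
        "\<forall>t\<in>ball t1 r. modJ (s t) = j1 t"
        "uncountable {t \<in> ball t1 r. (j1 t, j2 t) \<in> X0_affine n} \<longrightarrow>
           (\<exists>g\<in>SL2Z. \<forall>t\<in>ball t1 r. j2 t = modJ (of_nat n * act g (s t)))"
        by (rule modular_on_ball[OF G(1) _ G(3,4) _ n(1), of t1]) (use t1 gen in auto)
      have "ball t1 r \<inter> W = {}"
      proof (rule ccontr)
        assume "ball t1 r \<inter> W \<noteq> {}"
        then have "uncountable (ball t1 r \<inter> W)" using W(1) by (intro uncountable_open open_Int) auto
        moreover have "ball t1 r \<inter> W \<subseteq> {t \<in> ball t1 r. (j1 t, j2 t) \<in> X0_affine n}" using W(3) by auto
        ultimately have "uncountable {t \<in> ball t1 r. (j1 t, j2 t) \<in> X0_affine n}" using countable_subset by blast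
        then obtain g where g: "g \<in> SL2Z" "\<forall>t\<in>ball t1 r. j2 t = modJ (of_nat n * act g (s t))" using s(6) by auto
        have "(j1 t, j2 t) \<in> X0_affine n" if t: "t \<in> ball t1 r" for t
        proof -
          have st: "Im (s t) > 0" using image_uhpD[OF s(4) t] .
          have "(j1 t, j2 t) = (modJ (act g (s t)), modJ (of_nat n * act g (s t)))"
            using s(5) g(2) t modJ_act[OF g(1) st] by simp
          then show ?thesis unfolding X0_affine_eq[OF n(1)] using Im_act[OF g(1) st] by auto
        qed
        then have "t1 \<in> W" unfolding W_def using s(1,2) by (auto intro!: exI[of _ "ball t1 r"])
        then show False using t1 by simp
      qed
      then show "\<exists>e>0. ball t1 e \<subseteq> G - W" using s(1,2) by (intro exI[of _ r]) auto
    qed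
    then have "W \<inter> G = {} \<or> (G - W) \<inter> G = {}"
      using connectedD[OF conn W(1), of "G - W"] by auto
    then have GW: "G \<subseteq> W" using \<open>t0 \<in> W\<close> t0 by auto
    \<comment> \<open>At exceptional points: the curve is closed, so a failure would persist on a
      nonempty open set, which is uncountable, whereas the exceptional points are countable.\<close>
    have "(j1 t, j2 t) \<in> X0_affine n" if t: "t \<in> U" for t
    proof (rule ccontr)
      assume nX: "(j1 t, j2 t) \<notin> X0_affine n"
      have "continuous_on U (\<lambda>t. (j1 t, j2 t))"
        by (intro continuous_on_Pair holomorphic_on_imp_continuous_on assms)
      moreover have "open (- X0_affine n)" unfolding X0_affine_def by (simp add: open_Compl)
      ultimately have "open (U \<inter> (\<lambda>t. (j1 t, j2 t)) -` (- X0_affine n))"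
        by (rule continuous_open_preimage[OF _ assms(1)])
      moreover have "t \<in> U \<inter> (\<lambda>t. (j1 t, j2 t)) -` (- X0_affine n)" using t nX by simp
      ultimately have "uncountable (U \<inter> (\<lambda>t. (j1 t, j2 t)) -` (- X0_affine n))" by (intro uncountable_open) auto
      moreover have "U \<inter> (\<lambda>t. (j1 t, j2 t)) -` (- X0_affine n) \<subseteq> T" using GW W(3) GT by blast
      ultimately show False using T countable_subset by blast
    qed
    then show ?thesis using n(1) by blast
  qed
  show "\<forall>t\<in>U. (j1 t \<notin> {0, 1} \<and> j2 t \<notin> {0, 1} \<and> deriv j1 t \<noteq> 0 \<and> deriv j2 t \<noteq> 0) \<longrightarrow> Box j1 t = Box j2 t"
    if X: "\<exists>n\<ge>1. \<forall>t\<in>U. (j1 t, j2 t) \<in> X0_affine n"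
  proof (intro ballI impI)
    obtain n where n: "n \<ge> 1" "\<forall>t\<in>U. (j1 t, j2 t) \<in> X0_affine n" using X by blast
    fix t assume "t \<in> U" "j1 t \<notin> {0, 1} \<and> j2 t \<notin> {0, 1} \<and> deriv j1 t \<noteq> 0 \<and> deriv j2 t \<noteq> 0"
    then have t: "t \<in> G" by (auto simp: G_def)
    show "Box j1 t = Box j2 t"
      by (rule X0_imp_Box_eq[OF G(1) t G(3,4) gen n(1)]) (use G(2) n(2) in auto)
  qed
qed

end
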